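(* Let $\phi$ be the implicit equation of a parameterized plane curve (with the supports of the parametric polynomials fixed and with generic coefficients), and let $N(\phi)\subset\mathbb{R}^2$ be its Newton polygon. Then $N(\phi)$ is obtained by corner cuts from a polygon with one vertex at the origin and two edges lying on the coordinate axes. In particular: (1) (Polynomial parameterizations) If $x=P_0(t)$, $y=P_1(t)$ with $P_0,P_1\in\mathbb{C}[t]$, then $N(\phi)$ is obtained from a right triangle (with one vertex at the origin and two edges on the axes) by at most one corner cut, this cut being at the corner at the origin (so that the origin is excluded). (2) (Rational parameterizations with equal denominators) If $x=P_0(t)/Q(t)$, $y=P_1(t)/Q(t)$ with $P_0,P_1,Q\in\mathbb{C}[t]$ and $\gcd(P_i,Q)=1$ for $i=0,1$, then $N(\phi)$ is obtained from a right triangle (with one vertex at the origin and two edges on the axes) by at most two cuts, on the same or different corners. (3) (Rational parameterizations with different denominators) If $x=P_0(t)/Q_0(t)$, $y=P_1(t)/Q_1(t)$ with $P_i,Q_i\in\mathbb{C}[t]$ and $\gcd(P_i,Q_i)=1$ for $i=0,1$, then $N(\phi)$ is obtained from a quadrilateral (with one vertex at the origin and two edges on the axes) by at most two cuts, on the same or different corners.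
   Context: The implicit equation $\phi\in\mathbb{C}[x,y]$ is the generator (unique up to a nonzero constant) of the ideal of all polynomials in $x,y$ that vanish identically when $x,y$ are replaced by the given parametric expressions. The Newton polygon $N(\phi)$ is the convex hull of the exponent vectors of the monomials with nonzero coefficient in $\phi$. Standing assumptions: each of the polynomials in the parameterization has a fixed support (set of exponents with nonzero coefficient), and the coefficients are generic with respect to these supports, i.e. the result holds for all coefficient vectors in some open dense subset of the coefficient space (in case (2) there is one coefficient vector for the common denominator $Q$; in case (3) the coefficients of $Q_0$ and $Q_1$ are independent). The degree of the parameterization is assumed to be $1$. A cut of a polygon at a corner (vertex) $v$ means intersecting with a closed half-plane that does not contain $v$ but contains all the other vertices of the original polygon; two cuts on the same corner are given by two such half-planes for the same $v$. Degenerate polygons (e.g. segments) are allowed as outcomes.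
   Formalization: In (1) and (3), if a coordinate x or y is constant, the triangle or quadrilateral may degenerate to a segment on an axis starting at the origin; with a nondegenerate base the claim fails there (e.g. x = c, N(φ) an axis segment). *)

theory Defs
  imports "HOL-Analysis.Analysis" "HOL-Computational_Algebra.Computational_Algebra"
begin

section \<open>Generic polynomials with prescribed supports\<close>

inductive_set polynomial_maps :: "'i set \<Rightarrow> (('i \<Rightarrow> complex) \<Rightarrow> complex) set"
  for I :: "'i set" where
  const: "(\<lambda>c. a) \<in> polynomial_maps I"
| coord: "i \<in> I \<Longrightarrow> (\<lambda>c. c i) \<in> polynomial_maps I"
| add: "F \<in> polynomial_maps I \<Longrightarrow> G \<in> polynomial_maps I \<Longrightarrow> (\<lambda>c. F c + G c) \<in> polynomial_maps I"
| mult: "F \<in> polynomial_maps I \<Longrightarrow> G \<in> polynomial_maps I \<Longrightarrow> (\<lambda>c. F c * G c) \<in> polynomial_maps I"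

text \<open>The index \<open>(k, i)\<close> stands for the coefficient of \<open>t ^ i\<close> in the \<open>k\<close>-th polynomial.\<close>

definition coeff_index :: "nat set list \<Rightarrow> (nat \<times> nat) set" where
  "coeff_index Ss = {(k, i). k < length Ss \<and> i \<in> Ss ! k}"

text \<open>Coefficients are nonzero, so that the supports are exactly the given sets.\<close>

definition coeff_space :: "nat set list \<Rightarrow> (nat \<times> nat \<Rightarrow> complex) set" where
  "coeff_space Ss = coeff_index Ss \<rightarrow>\<^sub>E (UNIV - {0})"

text \<open>The Zariski topology: the sets where a given polynomial does not vanish are closed under
  finite intersection and hence form a base. A Zariski open dense set is also open and dense in
  the Euclidean topology.\<close>

definition coeff_zariski :: "nat set list \<Rightarrow> (nat \<times> nat \<Rightarrow> complex) topology" where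
  "coeff_zariski Ss = topology_generated_by
     {{c \<in> coeff_space Ss. F c \<noteq> 0} | F. F \<in> polynomial_maps (coeff_index Ss)}"

definition supported_poly :: "nat set list \<Rightarrow> (nat \<times> nat \<Rightarrow> complex) \<Rightarrow> nat \<Rightarrow> complex poly" where
  "supported_poly Ss c k = (\<Sum>i\<in>Ss ! k. monom (c (k, i)) i)"

definition for_generic_coeffs :: "nat set list \<Rightarrow> ((nat \<Rightarrow> complex poly) \<Rightarrow> bool) \<Rightarrow> bool" where
  "for_generic_coeffs Ss \<Phi> \<longleftrightarrow>
     (\<exists>U. openin (coeff_zariski Ss) U \<and>
          coeff_zariski Ss closure_of U = topspace (coeff_zariski Ss) \<and>
          (\<forall>c\<in>U. \<Phi> (supported_poly Ss c)))"

section \<open>Parameterized plane curves\<close>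

text \<open>The degree of \<open>t \<mapsto> (P0 t / Q0 t, P1 t / Q1 t)\<close> is the cardinality of its generic fibre.
  If both coordinates are constant, the fibres are infinite and the degree is \<open>0\<close>.\<close>

definition has_param_degree ::
  "complex poly \<Rightarrow> complex poly \<Rightarrow> complex poly \<Rightarrow> complex poly \<Rightarrow> nat \<Rightarrow> bool" where
  "has_param_degree P0 Q0 P1 Q1 d \<longleftrightarrow>
     (\<forall>\<^sub>\<infinity>t. card {s. poly Q0 s \<noteq> 0 \<and> poly Q1 s \<noteq> 0 \<and>
                   poly P0 s / poly Q0 s = poly P0 t / poly Q0 t \<and>
                   poly P1 s / poly Q1 s = poly P1 t / poly Q1 t} = d)"

definition const_fract :: "complex \<Rightarrow> complex poly fract" where
  "const_fract a = Fract [:a:] 1"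

text \<open>Bivariate polynomials are elements of \<open>complex poly poly\<close>, with \<open>y\<close> as the outer and \<open>x\<close> as
  the inner variable: the coefficient of \<open>x ^ i * y ^ j\<close> in \<open>f\<close> is \<open>coeff (coeff f j) i\<close>.
  Rational functions in \<open>t\<close> are elements of \<open>complex poly fract\<close>.\<close>

definition subst_xy ::
  "complex poly poly \<Rightarrow> complex poly fract \<Rightarrow> complex poly fract \<Rightarrow> complex poly fract" where
  "subst_xy f x y = poly (map_poly (\<lambda>p. poly (map_poly const_fract p) x) f) y"

definition implicit_equation ::
  "complex poly poly \<Rightarrow> complex poly fract \<Rightarrow> complex poly fract \<Rightarrow> bool" where
  "implicit_equation \<phi> x y \<longleftrightarrow> {f. subst_xy f x y = 0} = {f. \<phi> dvd f}"

definition newton_polygon :: "complex poly poly \<Rightarrow> (real \<times> real) set" where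
  "newton_polygon f = convex hull {(real i, real j) | i j. coeff (coeff f j) i \<noteq> 0}"

section \<open>Polygons and corner cuts\<close>

text \<open>A nondegenerate convex polygon with \<open>n\<close> vertices, one of them the origin, and with two edges
  on the (nonnegative) coordinate axes. For \<open>n = 3\<close> this is a right triangle.\<close>

definition axis_polygon :: "nat \<Rightarrow> (real \<times> real) set \<Rightarrow> bool" where
  "axis_polygon n P \<longleftrightarrow>
     polytope P \<and> card {v. v extreme_point_of P} = n \<and> (0, 0) extreme_point_of P \<and>
     (\<exists>a>0. closed_segment (0, 0) (a, 0) edge_of P) \<and>
     (\<exists>b>0. closed_segment (0, 0) (0, b) edge_of P)"

text \<open>What remains of such a polygon when its extent along one of the axes shrinks to zero.
  This is needed when a coordinate of the parameterization is constant: the curve is then an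
  axis-parallel line, and its Newton polygon lies on an axis.\<close>

definition axis_segment :: "(real \<times> real) set \<Rightarrow> bool" where
  "axis_segment P \<longleftrightarrow>
     (\<exists>a>0. P = closed_segment (0, 0) (a, 0) \<or> P = closed_segment (0, 0) (0, a))"

definition constant_coordinate :: "complex poly fract \<Rightarrow> complex poly fract \<Rightarrow> bool" where
  "constant_coordinate x y \<longleftrightarrow> x \<in> range const_fract \<or> y \<in> range const_fract"

definition closed_half_plane :: "(real \<times> real) set \<Rightarrow> bool" where
  "closed_half_plane H \<longleftrightarrow> (\<exists>n c. n \<noteq> 0 \<and> H = {z. n \<bullet> z \<le> c})"

definition corner_cut :: "(real \<times> real) set \<Rightarrow> real \<times> real \<Rightarrow> (real \<times> real) set \<Rightarrow> bool" where
  "corner_cut P v H \<longleftrightarrow>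
     v extreme_point_of P \<and> closed_half_plane H \<and> v \<notin> H \<and>
     (\<forall>w. w extreme_point_of P \<and> w \<noteq> v \<longrightarrow> w \<in> H)"

text \<open>At most \<open>k\<close> cuts, each at a corner of the original polygon \<open>P\<close> that belongs to \<open>V\<close>;
  several cuts may share a corner.\<close>

definition obtained_by_cuts ::
  "(real \<times> real) set \<Rightarrow> nat \<Rightarrow> (real \<times> real) set \<Rightarrow> (real \<times> real) set \<Rightarrow> bool" where
  "obtained_by_cuts V k P N \<longleftrightarrow>
     (\<exists>Hs. finite Hs \<and> card Hs \<le> k \<and> (\<forall>H\<in>Hs. \<exists>v\<in>V. corner_cut P v H) \<and> N = P \<inter> \<Inter>Hs)"

definition cut_axis_polygon :: "(real \<times> real) set \<Rightarrow> bool" where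
  "cut_axis_polygon N \<longleftrightarrow> (\<exists>n P k. axis_polygon n P \<and> obtained_by_cuts UNIV k P N)"

end

theory Submission
  imports Defs "Subresultants.Subresultant_Gcd" "Jordan_Normal_Form.Char_Poly"
    "HOL-Computational_Algebra.Field_as_Ring"
begin

text \<open>Let \<open>x\<close> and \<open>y\<close> be the coordinates of the curve, as rational functions of \<open>t\<close>. At a place \<open>v\<close> of
  the projective line they vanish to certain orders, negative at poles; the pair of these two
  integers is the \<^emph>\<open>place vector\<close> of \<open>v\<close>. The proof rests on one half of the fundamental theorem of
  tropical geometry for rational curves: if a linear form \<open>w\<close> attains its minimum over the
  exponents of \<open>\<phi>\<close> at two exponents, then \<open>w\<close> is a positive multiple of a place vector
  (\<open>place_vector_of_newton_polygon_tie\<close>). So the inner normals of the edges of the Newton polygon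
  are among the place vectors.

  To prove this, suppose that no place vector is a positive multiple of \<open>w = (w1, w2)\<close>. The
  monomial \<open>X = x ^ w2 * y ^ (- w1)\<close> has weight zero, \<open>Y = x ^ w1 * y ^ w2\<close> has positive weight, and
  a zero of \<open>Y\<close> at which \<open>X\<close> has order zero would have a positive multiple of \<open>w\<close> as its place
  vector. Hence every pole of \<open>1 / Y\<close> is a zero or a pole of \<open>X\<close>, which makes \<open>1 / Y\<close> integral over
  every ring that contains the constants, \<open>X\<close> and \<open>1 / X\<close> (\<open>integral_over_if_poles_subset\<close>), in
  particular over the values of the Laurent polynomials in \<open>x\<close> and \<open>y\<close> without terms of
  negative weight. Multiplied by a power of \<open>Y\<close> and cleared of denominators, the integral equation
  becomes a relation between \<open>x\<close> and \<open>y\<close> in which a single monomial has minimal weight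
  (\<open>relation_with_unique_initial_exponent\<close>). The implicit equation divides this relation, and
  initial forms multiply, so \<open>\<phi>\<close> has only one exponent of minimal weight as well.

  For generic coefficients, different polynomials of the parameterization share no root
  \<open>t \<noteq> 0\<close> (\<open>generic_no_common_roots\<close>). Then the places other than zero and infinity contribute only
  the directions of the coordinate axes and, for a common denominator, the direction \<open>(- 1, - 1)\<close>.
  Half-planes with these normals that are tight around the Newton polygon bound a rectangle or a
  right triangle \<open>T\<close>; for polynomial parameterizations the hypotenuse comes from the place at
  infinity. What remains are at most two half-planes, one for each of the places zero and infinity,
  and the Newton polygon is the intersection of \<open>T\<close> with them (\<open>convex_hull_eq_halfplanes\<close>). As it
  touches every side of \<open>T\<close>, each of these half-planes either contains \<open>T\<close> or misses exactly one
  corner (\<open>axis_triangle_cut\<close>, \<open>axis_rectangle_cut\<close>), so it is a corner cut. If a coordinate is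
  constant, then \<open>\<phi>\<close> is linear and its Newton polygon is explicit.\<close>

section \<open>Convex hulls, half-planes and corner cuts\<close>

text \<open>If \<open>z\<close> is not in the convex hull, some \<open>w\<close> separates it from \<open>S\<close>. Let \<open>p\<close> minimize \<open>w\<close> on \<open>S\<close>. Adding to
  \<open>w\<close> a multiple of a vector orthogonal to \<open>z - p\<close> keeps it separating until a second point of \<open>S\<close> ties
  with \<open>p\<close>, which the last assumption forbids. No tie arises if \<open>S\<close> lies on the line
  through \<open>p\<close> and \<open>z\<close>; then \<open>p\<close> is the end of \<open>S\<close> facing \<open>z\<close>, and the positively spanning set \<open>D\<close>
  provides a separating direction.\<close>

lemma convex_hull_from_ties:
  fixes S D :: "(real \<times> real) set"
  assumes S: "finite S" "S \<noteq> {}"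
    and span: "\<And>v. v \<noteq> 0 \<Longrightarrow> \<exists>w\<in>D. inner w v < 0"
    and D: "\<And>w. w \<in> D \<Longrightarrow> \<exists>q\<in>S. inner w q \<le> inner w z"
    and tie: "\<And>p q w. \<lbrakk>p \<in> S; q \<in> S; p \<noteq> q; inner w p = inner w q; \<forall>s\<in>S. inner w p \<le> inner w s\<rbrakk>
      \<Longrightarrow> inner w p \<le> inner w z"
  shows "z \<in> convex hull S"
proof (rule ccontr)
  assume "z \<notin> convex hull S"
  moreover have "closed (convex hull S)"
    using S(1) by (simp add: compact_imp_closed finite_imp_compact_convex_hull)
  ultimately obtain a b where ab: "inner a z < b" "\<forall>x\<in>convex hull S. b < inner a x"
    using separating_hyperplane_closed_point[OF convex_convex_hull] by metis
  obtain p where p: "p \<in> S" "\<And>s. s \<in> S \<Longrightarrow> inner a p \<le> inner a s"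
    by (rule that[OF arg_min_if_finite(1)[OF S] arg_min_least[OF S]])
  define v where "v = z - p"
  have "b < inner a p" by (rule ab(2)[rule_format, OF hull_inc[OF p(1)]])
  then have av: "inner a v < 0" using ab(1) by (simp add: v_def inner_diff_right)
  then have v0: "v \<noteq> 0" by auto
  define u where "u = (- snd v, fst v)"
  have uv: "inner u v = 0" by (simp add: u_def inner_prod_def)
  show False
  proof (cases "\<forall>s\<in>S. inner u (s - p) = 0")
    case True
    obtain w where w: "w \<in> D" "inner w v < 0" using span[OF v0] by blast
    obtain q where q: "q \<in> S" "inner w q \<le> inner w z" using D[OF w(1)] by blast
    (* All of S lies on the line through p and z. *)
    have "\<exists>c. q - p = c *\<^sub>R v"
    proof -
      have "- snd v * fst (q - p) + fst v * snd (q - p) = 0"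
        using True q(1) by (auto simp: u_def inner_prod_def)
      then have e: "snd v * fst (q - p) = fst v * snd (q - p)" by simp
      show ?thesis
      proof (cases "fst v = 0")
        case True
        then have "snd v \<noteq> 0" using v0 by (auto simp: prod_eq_iff)
        with e True have "q - p = (snd (q - p) / snd v) *\<^sub>R v" by (auto simp: prod_eq_iff)
        then show ?thesis by blast
      next
        case False
        with e have "q - p = (fst (q - p) / fst v) *\<^sub>R v"
          by (auto simp: prod_eq_iff field_simps)
        then show ?thesis by blast
      qed
    qed
    then obtain c where c: "q - p = c *\<^sub>R v" by blast
    have "0 \<le> inner a (q - p)" using p(2)[OF q(1)] by (simp add: inner_diff_right)
    then have "c \<le> 0" using av by (simp add: c zero_le_mult_iff)
    then have "0 \<le> inner w (q - p)" using w(2) by (simp add: c zero_le_mult_iff)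
    moreover have "inner w z < inner w p" using w(2) by (simp add: v_def inner_diff_right)
    ultimately show False using q(2) by (simp add: inner_diff_right)
  next
    case False
    then obtain s where s: "s \<in> S" "inner u (s - p) \<noteq> 0" by blast
    obtain u' where u': "inner u' v = 0" "inner u' (s - p) < 0"
    proof (cases "inner u (s - p) < 0")
      case True
      then show ?thesis using that uv by blast
    next
      case False
      then show ?thesis using that[of "- u"] uv s(2) by simp
    qed
    \<comment> \<open>Rotating \<open>a\<close> towards \<open>u'\<close> keeps its value on \<open>z - p\<close>; stop as soon as \<open>p\<close> ties with another point.\<close>
    define T where "T = {s\<in>S. inner u' (s - p) < 0}"
    define r where "r = (\<lambda>s. inner a (s - p) / - inner u' (s - p))"
    have T: "finite T" "T \<noteq> {}" using S(1) s(1) u'(2) unfolding T_def by (simp, blast)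
    obtain q where q: "q \<in> T" "\<And>s. s \<in> T \<Longrightarrow> r q \<le> r s"
      by (rule that[OF arg_min_if_finite(1)[OF T] arg_min_least[OF T]])
    have ge: "0 \<le> inner a (s - p)" if "s \<in> S" for s
      using p(2)[OF that] by (simp add: inner_diff_right)
    define w where "w = a + r q *\<^sub>R u'"
    have rq: "0 \<le> r q"
    proof -
      have "0 \<le> inner a (q - p)" "0 < - inner u' (q - p)" using q(1) ge by (auto simp: T_def)
      then show ?thesis unfolding r_def by (rule divide_nonneg_pos)
    qed
    have neg: "inner u' (t - p) < 0" if "t \<in> T" for t using that by (simp add: T_def)
    have wq: "inner w (q - p) = 0"
      using neg[OF q(1)] by (simp add: w_def r_def inner_add_left inner_diff_left)
    have ws: "0 \<le> inner w (s - p)" if "s \<in> S" for s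
    proof (cases "s \<in> T")
      case True
      then have "r q * (- inner u' (s - p)) \<le> inner a (s - p)"
        using q(2)[OF True] neg[OF True] pos_le_divide_eq[of "- inner u' (s - p)" "r q" "inner a (s - p)"]
        unfolding r_def by simp
      then show ?thesis by (simp add: w_def inner_add_left)
    next
      case False
      then have "0 \<le> r q * inner u' (s - p)" using that rq by (simp add: T_def)
      then show ?thesis using ge[OF that] by (simp add: w_def inner_add_left)
    qed
    have "inner w p \<le> inner w z"
    proof (rule tie[of p q w])
      show "p \<in> S" "q \<in> S" using p(1) q(1) by (auto simp: T_def)
      show "p \<noteq> q" using q(1) by (auto simp: T_def)
      show "inner w p = inner w q" using wq by (simp add: inner_diff_right)
      show "\<forall>s\<in>S. inner w p \<le> inner w s" using ws by (simp add: inner_diff_right)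
    qed
    moreover have "inner w v < 0" using av u'(1) by (simp add: w_def inner_add_left)
    ultimately show False by (simp add: v_def inner_diff_right)
  qed
qed

lemma obtained_by_cutsI:
  assumes "finite K" "card K \<le> k"
    and N: "N = T \<inter> (\<Inter>\<rho>\<in>K. {z. c \<rho> \<le> inner \<rho> z})"
    and cut: "\<And>\<rho>. \<rho> \<in> K \<Longrightarrow>
      T \<subseteq> {z. c \<rho> \<le> inner \<rho> z} \<or> (\<exists>v\<in>V. corner_cut T v {z. c \<rho> \<le> inner \<rho> z})"
  shows "obtained_by_cuts V k T N"
proof -
  define H where "H = (\<lambda>\<rho>. {z. c \<rho> \<le> inner \<rho> z})"
  define Hs where "Hs = H ` {\<rho>\<in>K. \<not> T \<subseteq> H \<rho>}"
  have "card Hs \<le> card {\<rho>\<in>K. \<not> T \<subseteq> H \<rho>}" unfolding Hs_def using assms(1) by (intro card_image_le) auto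
  also have "\<dots> \<le> card K" using assms(1) by (intro card_mono) auto
  finally have "card Hs \<le> k" using assms(2) by simp
  moreover have "finite Hs" using assms(1) by (simp add: Hs_def)
  moreover have "\<exists>v\<in>V. corner_cut T v X" if X: "X \<in> Hs" for X
  proof -
    obtain \<rho> where "\<rho> \<in> K" "\<not> T \<subseteq> H \<rho>" "X = H \<rho>" using X unfolding Hs_def by blast
    then show ?thesis using cut[of \<rho>] unfolding H_def by simp
  qed
  moreover have "N = T \<inter> \<Inter>Hs"
  proof -
    have "x \<in> (\<Inter>\<rho>\<in>K. H \<rho>) \<longleftrightarrow> x \<in> \<Inter>Hs" if "x \<in> T" for x
      unfolding Hs_def using that by blast
    moreover have "N = T \<inter> (\<Inter>\<rho>\<in>K. H \<rho>)" using N by (simp only: H_def)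
    ultimately show ?thesis by blast
  qed
  ultimately show ?thesis unfolding obtained_by_cuts_def by (intro exI[of _ Hs]) simp
qed

lemma corner_cutI:
  assumes "v extreme_point_of T" "\<not> c \<le> inner \<rho> v"
    and "\<And>w. w extreme_point_of T \<Longrightarrow> w \<noteq> v \<Longrightarrow> c \<le> inner \<rho> w"
    and "\<exists>w. w extreme_point_of T \<and> w \<noteq> v"
  shows "corner_cut T v {z. c \<le> inner \<rho> z}"
proof -
  have "- \<rho> \<noteq> 0" using assms(2,3,4) by auto
  moreover have "{z. c \<le> inner \<rho> z} = {z. inner (- \<rho>) z \<le> - c}"
    by (simp only: inner_minus_left neg_le_iff_le)
  ultimately have "closed_half_plane {z. c \<le> inner \<rho> z}"
    unfolding closed_half_plane_def by (intro exI conjI)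
  then show ?thesis using assms(1-3) unfolding corner_cut_def by simp
qed

definition axis_triangle :: "real \<Rightarrow> real \<Rightarrow> (real \<times> real) set" where
  "axis_triangle a b = convex hull {(0, 0), (a, 0), (0, b)}"

definition axis_rectangle :: "real \<Rightarrow> real \<Rightarrow> (real \<times> real) set" where
  "axis_rectangle a b = {0..a} \<times> {0..b}"

lemma axis_triangle_eq:
  assumes "a > 0" "b > 0"
  shows "axis_triangle a b = {z. 0 \<le> fst z \<and> 0 \<le> snd z \<and> fst z / a + snd z / b \<le> 1}" (is "_ = ?R")
proof (intro equalityI subsetI)
  have "?R = {z. inner (1, 0) z \<ge> 0} \<inter> {z. inner (0, 1) z \<ge> 0} \<inter> {z. inner (1 / a, 1 / b) z \<le> 1}"
    by (auto simp: inner_prod_def)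
  then have "convex ?R"
    by (simp only:) (intro convex_Int convex_halfspace_ge convex_halfspace_le)
  then have "axis_triangle a b \<subseteq> ?R"
    unfolding axis_triangle_def using assms by (intro hull_minimal) auto
  then show "z \<in> ?R" if "z \<in> axis_triangle a b" for z
    using that by blast
next
  fix z assume z: "z \<in> ?R"
  define s t where "s = fst z / a" and "t = snd z / b"
  define r where "r = 1 - s - t"
  have "z = r *\<^sub>R (0, 0) + s *\<^sub>R (a, 0) + t *\<^sub>R (0, b)"
    using assms by (simp add: s_def t_def prod_eq_iff)
  moreover have "0 \<le> r" "0 \<le> s" "0 \<le> t" "r + s + t = 1"
    using z assms by (auto simp: r_def s_def t_def)
  ultimately show "z \<in> axis_triangle a b"
    unfolding axis_triangle_def
    by (simp only: convex_hull_3 mem_Collect_eq) (rule exI[of _ r], rule exI[of _ s], rule exI[of _ t], simp)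
qed

lemma extreme_point_of_axis_triangle:
  assumes "a > 0" "b > 0"
  shows "v extreme_point_of axis_triangle a b \<longleftrightarrow> v \<in> {(0, 0), (a, 0), (0, b)}"
proof -
  have "\<not> collinear {(a, 0), (0, 0), (0, b)}"
  proof
    assume "collinear {(a, 0), (0, 0), (0::real, b)}"
    then have "collinear {(0, 0), (a, 0), (0::real, b)}" by (simp add: insert_commute)
    then have "collinear {0, (a, 0), (0::real, b)}" by (simp add: zero_prod_def)
    then show False using assms unfolding collinear_lemma by (auto simp: prod_eq_iff)
  qed
  then have "\<not> affine_dependent {(a, 0), (0, 0), (0::real, b)}"
    using affine_dependent_imp_collinear_3 by blast
  then have "\<not> affine_dependent {(0, 0), (a, 0), (0::real, b)}" by (simp add: insert_commute)
  then show ?thesis unfolding axis_triangle_def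
    by (rule extreme_point_of_convex_hull_affine_independent)
qed

lemma segment_edge_ofI:
  assumes "convex T" "p \<noteq> q" and "\<And>x. x \<in> T \<Longrightarrow> 0 \<le> inner w x"
    and "\<And>x. x \<in> closed_segment p q \<longleftrightarrow> x \<in> T \<and> inner w x = 0"
  shows "closed_segment p q edge_of T"
proof -
  have eq: "closed_segment p q = T \<inter> {x. inner w x = 0}" using assms(4) by blast
  have "closed_segment p q face_of T"
    unfolding eq by (rule face_of_Int_supporting_hyperplane_ge[OF assms(1,3)])
  moreover have "aff_dim (closed_segment p q) = 1"
    using assms(2) by (simp add: segment_convex_hull aff_dim_convex_hull aff_dim_2)
  ultimately show ?thesis by (simp add: edge_of_def)
qed

lemma closed_segment_axis:
  fixes a :: real
  assumes "a > 0"
  shows "closed_segment (0, 0) (a, 0) = {z. 0 \<le> fst z \<and> fst z \<le> a \<and> snd z = (0::real)}"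
    and "closed_segment (0, 0) (0, a) = {z. fst z = (0::real) \<and> 0 \<le> snd z \<and> snd z \<le> a}"
proof -
  have seg: "closed_segment 0 a = {0..a}" using assms by (simp add: closed_segment_eq_real_ivl)
  have "closed_segment (0, 0) (a, 0) = {0..a} \<times> {0::real}"
    by (simp add: closed_segment_same_snd seg)
  also have "\<dots> = {z. 0 \<le> fst z \<and> fst z \<le> a \<and> snd z = 0}"
    by (intro Set.set_eqI) (simp add: mem_Times_iff)
  finally show "closed_segment (0, 0) (a, 0) = {z. 0 \<le> fst z \<and> fst z \<le> a \<and> snd z = (0::real)}" .
  have "closed_segment (0, 0) (0, a) = {0::real} \<times> {0..a}"
    by (simp add: closed_segment_same_fst seg)
  also have "\<dots> = {z. fst z = 0 \<and> 0 \<le> snd z \<and> snd z \<le> a}"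
    by (intro Set.set_eqI) (simp add: mem_Times_iff)
  finally show "closed_segment (0, 0) (0, a) = {z. fst z = (0::real) \<and> 0 \<le> snd z \<and> snd z \<le> a}" .
qed

lemma axis_polygon_triangle:
  assumes "a > 0" "b > 0"
  shows "axis_polygon 3 (axis_triangle a b)"
proof -
  have cv: "convex (axis_triangle a b)" by (simp add: axis_triangle_def)
  have T: "z \<in> axis_triangle a b \<longleftrightarrow> 0 \<le> fst z \<and> 0 \<le> snd z \<and> fst z / a + snd z / b \<le> 1" for z
    using assms by (simp add: axis_triangle_eq)
  have "closed_segment (0, 0) (a, 0) edge_of axis_triangle a b"
    by (rule segment_edge_ofI[OF cv, where w = "(0, 1)"])
      (use assms in \<open>auto simp: closed_segment_axis T\<close>)
  moreover have "closed_segment (0, 0) (0, b) edge_of axis_triangle a b"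
    by (rule segment_edge_ofI[OF cv, where w = "(1, 0)"])
      (use assms in \<open>auto simp: closed_segment_axis T\<close>)
  moreover have "polytope (axis_triangle a b)"
    unfolding axis_triangle_def by (rule polytope_convex_hull) simp
  moreover have "card {(0, 0), (a, 0), (0, b)} = 3" using assms by auto
  moreover have "{v. v extreme_point_of axis_triangle a b} = {(0, 0), (a, 0), (0, b)}"
    using extreme_point_of_axis_triangle[OF assms] by blast
  ultimately show ?thesis using assms
    unfolding axis_polygon_def by auto
qed

lemma extreme_point_of_axis_rectangle:
  assumes "a > 0" "b > 0"
  shows "v extreme_point_of axis_rectangle a b \<longleftrightarrow> v \<in> {(0, 0), (a, 0), (0, b), (a, b)}"
proof -
  have *: "x extreme_point_of {0..c} \<longleftrightarrow> x = 0 \<or> x = c" if "c > 0" for x c :: real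
  proof -
    have "{0..c} = closed_segment 0 c" using that by (simp add: closed_segment_eq_real_ivl)
    then show ?thesis by (simp only: extreme_point_of_segment)
  qed
  obtain x y where v: "v = (x, y)" by (cases v)
  have "v extreme_point_of axis_rectangle a b \<longleftrightarrow> {x} \<times> {y} face_of {0..a} \<times> {0..b}"
    by (simp add: v axis_rectangle_def face_of_singleton[symmetric])
  also have "\<dots> \<longleftrightarrow> x extreme_point_of {0..a} \<and> y extreme_point_of {0..b}"
    by (simp only: face_of_Times_eq face_of_singleton) simp
  finally show ?thesis using *[OF assms(1)] *[OF assms(2)] v by auto
qed

lemma axis_polygon_rectangle:
  assumes "a > 0" "b > 0"
  shows "axis_polygon 4 (axis_rectangle a b)"
proof -
  have pt: "polytope (axis_rectangle a b)"
    unfolding axis_rectangle_def by (metis cbox_Pair_eq cbox_interval polytope_interval)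
  then have cv: "convex (axis_rectangle a b)" by (rule polytope_imp_convex)
  have "closed_segment (0, 0) (a, 0) edge_of axis_rectangle a b"
    by (rule segment_edge_ofI[where w = "(0, 1)", OF cv])
      (use assms in \<open>auto simp: closed_segment_axis axis_rectangle_def inner_prod_def\<close>)
  moreover have "closed_segment (0, 0) (0, b) edge_of axis_rectangle a b"
    by (rule segment_edge_ofI[where w = "(1, 0)", OF cv])
      (use assms in \<open>auto simp: closed_segment_axis axis_rectangle_def inner_prod_def\<close>)
  moreover have "card {(0, 0), (a, 0), (0, b), (a, b)} = 4" using assms by auto
  moreover have "{v. v extreme_point_of axis_rectangle a b} = {(0, 0), (a, 0), (0, b), (a, b)}"
    using extreme_point_of_axis_rectangle[OF assms] by blast
  ultimately show ?thesis using assms pt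
    unfolding axis_polygon_def by (metis insertI1 mem_Collect_eq)
qed

lemma scale_between_zero_and_self:
  fixes s z :: real
  assumes "0 \<le> s" "s \<le> 1"
  shows "s * z \<le> max 0 z"
  using assms mult_left_le_one_le[of z s] by (auto simp: max_def mult_le_0_iff)

text \<open>A side of the triangle whose two end points violate \<open>c \<le> inner \<rho> z\<close> consists of violating points only.
  So if every side contains a point that satisfies the inequality, then at most one corner of the
  triangle violates it.\<close>

lemma axis_triangle_cut:
  assumes ab: "a > 0" "b > 0"
    and touch: "p \<in> axis_triangle a b" "fst p = 0" "q \<in> axis_triangle a b" "snd q = 0"
      "r \<in> axis_triangle a b" "fst r / a + snd r / b = 1"
    and H: "c \<le> inner \<rho> p" "c \<le> inner \<rho> q" "c \<le> inner \<rho> r"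
  shows "axis_triangle a b \<subseteq> {z. c \<le> inner \<rho> z} \<or>
    (\<exists>v. inner \<rho> v < c \<and> corner_cut (axis_triangle a b) v {z. c \<le> inner \<rho> z})"
proof -
  obtain x y where \<rho>: "\<rho> = (x, y)" by (cases \<rho>)
  \<comment> \<open>The values of \<open>\<rho>\<close> at the three corners; each side carries a point with value at least \<open>c\<close>.\<close>
  define A B where "A = x * a" and "B = y * b"
  define s t u where "s = snd p / b" and "t = fst q / a" and "u = fst r / a"
  have st: "0 \<le> s" "s \<le> 1" "0 \<le> t" "t \<le> 1" "0 \<le> u" "u \<le> 1" "snd r / b = 1 - u"
  proof -
    show "0 \<le> s" "s \<le> 1" using touch(1,2) ab by (simp_all add: axis_triangle_eq s_def)
    show "0 \<le> t" "t \<le> 1" using touch(3,4) ab by (simp_all add: axis_triangle_eq t_def)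
    show "0 \<le> u" using touch(5) ab by (simp add: axis_triangle_eq u_def)
    show r: "snd r / b = 1 - u" using touch(6) by (simp add: u_def)
    have "0 \<le> snd r / b" using touch(5) ab by (simp add: axis_triangle_eq)
    then show "u \<le> 1" using r by simp
  qed
  have "inner \<rho> p = s * B" "inner \<rho> q = t * A"
    using touch ab by (auto simp: \<rho> s_def t_def A_def B_def inner_prod_def)
  moreover have "inner \<rho> r = u * A + (1 - u) * B"
    using ab unfolding st(7)[symmetric] by (simp add: \<rho> u_def A_def B_def inner_prod_def)
  ultimately have c: "c \<le> s * B" "c \<le> t * A" "c \<le> u * A + (1 - u) * B"
    using H by auto
  have cut: "\<exists>v. inner \<rho> v < c \<and> corner_cut (axis_triangle a b) v {z. c \<le> inner \<rho> z}"
    if v: "v \<in> {(0, 0), (a, 0), (0, b)}" "inner \<rho> v < c"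
      and w: "\<forall>w\<in>{(0, 0), (a, 0), (0, b)} - {v}. c \<le> inner \<rho> w" for v
  proof -
    have w': "\<And>w. w \<in> {(0, 0), (a, 0), (0, b)} \<Longrightarrow> w \<noteq> v \<Longrightarrow> c \<le> inner \<rho> w" using w by blast
    have "\<exists>w. w \<in> {(0, 0), (a, 0), (0, b)} \<and> w \<noteq> v" using ab by auto
    then have "corner_cut (axis_triangle a b) v {z. c \<le> inner \<rho> z}"
      by (intro corner_cutI) (use v w' in \<open>simp_all add: extreme_point_of_axis_triangle[OF ab] del: insert_iff split_paired_Ex\<close>)
    with v(2) show ?thesis by blast
  qed
  have iA: "inner \<rho> (a, 0) = A" and iB: "inner \<rho> (0, b) = B" and i0: "inner \<rho> (0, 0) = 0"
    by (simp_all add: \<rho> A_def B_def)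
  consider "c \<le> 0" "c \<le> A" "c \<le> B" | "0 < c" | "A < c" "c \<le> 0" | "B < c" "c \<le> 0" by linarith
  then show ?thesis
  proof cases
    case 1
    have "{(0, 0), (a, 0), (0, b)} \<subseteq> {z. c \<le> inner \<rho> z}" using 1 iA iB i0 by simp
    then show ?thesis unfolding axis_triangle_def by (simp only: hull_minimal convex_halfspace_ge) simp
  next
    case 2
    have "c \<le> max 0 B" "c \<le> max 0 A"
      using c scale_between_zero_and_self[of s B] scale_between_zero_and_self[of t A] st by linarith+
    then have "c \<le> B" "c \<le> A" using 2 by auto
    then show ?thesis by (intro disjI2 cut[of "(0, 0)"]) (use 2 iA iB i0 in auto)
  next
    case 3
    have "c \<le> B"
    proof (rule ccontr)
      assume "\<not> c \<le> B"
      then have "u * A + (1 - u) * B < c" using 3 st by (intro convex_bound_lt) auto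
      then show False using c by simp
    qed
    then show ?thesis by (intro disjI2 cut[of "(a, 0)"]) (use 3 iA iB i0 in auto)
  next
    case 4
    have "c \<le> A"
    proof (rule ccontr)
      assume "\<not> c \<le> A"
      then have "u * A + (1 - u) * B < c" using 4 st by (intro convex_bound_lt) auto
      then show False using c by simp
    qed
    then show ?thesis by (intro disjI2 cut[of "(0, b)"]) (use 4 iA iB i0 in auto)
  qed
qed

text \<open>By the same argument two adjacent corners cannot both violate the inequality. Neither can
  two opposite corners: the sum of the values of \<open>\<rho>\<close> is the same for both pairs of opposite corners,
  so a third corner would violate it too.\<close>

lemma axis_rectangle_cut:
  assumes ab: "a > 0" "b > 0"
    and touch: "p1 \<in> axis_rectangle a b" "fst p1 = 0" "p2 \<in> axis_rectangle a b" "snd p2 = 0"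
      "p3 \<in> axis_rectangle a b" "fst p3 = a" "p4 \<in> axis_rectangle a b" "snd p4 = b"
    and H: "c \<le> inner \<rho> p1" "c \<le> inner \<rho> p2" "c \<le> inner \<rho> p3" "c \<le> inner \<rho> p4"
  shows "axis_rectangle a b \<subseteq> {z. c \<le> inner \<rho> z} \<or>
    (\<exists>v. corner_cut (axis_rectangle a b) v {z. c \<le> inner \<rho> z})"
proof -
  obtain x y where \<rho>: "\<rho> = (x, y)" by (cases \<rho>)
  define A B where "A = x * a" and "B = y * b"
  define s1 s2 s3 s4 where "s1 = snd p1 / b" and "s2 = fst p2 / a" and "s3 = snd p3 / b" and "s4 = fst p4 / a"
  have st: "0 \<le> s1" "s1 \<le> 1" "0 \<le> s2" "s2 \<le> 1" "0 \<le> s3" "s3 \<le> 1" "0 \<le> s4" "s4 \<le> 1"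
    using touch ab by (auto simp: axis_rectangle_def mem_Times_iff s1_def s2_def s3_def s4_def)
  have "inner \<rho> p1 = s1 * B" "inner \<rho> p2 = s2 * A" "inner \<rho> p3 = A + s3 * B" "inner \<rho> p4 = s4 * A + B"
    using touch ab by (auto simp: \<rho> s1_def s2_def s3_def s4_def A_def B_def inner_prod_def)
  then have c: "c \<le> s1 * B" "c \<le> s2 * A" "c \<le> A + s3 * B" "c \<le> s4 * A + B"
    using H by auto
  have iA: "inner \<rho> (a, 0) = A" and iB: "inner \<rho> (0, b) = B" and i0: "inner \<rho> (0, 0) = 0"
    and iAB: "inner \<rho> (a, b) = A + B"
    by (simp_all add: \<rho> A_def B_def)
  have c': "c \<le> max 0 B" "c \<le> max 0 A" "c \<le> A + max 0 B" "c \<le> max 0 A + B"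
    using c scale_between_zero_and_self[of s1 B] scale_between_zero_and_self[of s2 A]
      scale_between_zero_and_self[of s3 B] scale_between_zero_and_self[of s4 A] st by linarith+
  let ?V = "{(0, 0), (a, 0), (0, b), (a, b)}"
  have cut: "\<exists>v. corner_cut (axis_rectangle a b) v {z. c \<le> inner \<rho> z}"
    if v: "v \<in> ?V" "inner \<rho> v < c"
      and w: "\<forall>w\<in>?V - {v}. c \<le> inner \<rho> w" for v
  proof -
    have w': "\<And>w. w \<in> ?V \<Longrightarrow> w \<noteq> v \<Longrightarrow> c \<le> inner \<rho> w" using w by blast
    have "\<exists>w. w \<in> ?V \<and> w \<noteq> v" using ab by auto
    then have "corner_cut (axis_rectangle a b) v {z. c \<le> inner \<rho> z}"
      by (intro corner_cutI) (use v w' in \<open>simp_all add: extreme_point_of_axis_rectangle[OF ab] del: insert_iff split_paired_Ex\<close>)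
    then show ?thesis by blast
  qed
  consider "c \<le> 0" "c \<le> A" "c \<le> B" "c \<le> A + B" | "0 < c" "c \<le> A" "c \<le> B" "c \<le> A + B"
    | "A < c" "c \<le> 0" "c \<le> B" "c \<le> A + B" | "B < c" "c \<le> 0" "c \<le> A" "c \<le> A + B"
    | "A + B < c" "c \<le> 0" "c \<le> A" "c \<le> B"
    using c' by (smt (verit))
  then show ?thesis
  proof cases
    case 1
    have V: "?V \<subseteq> {z. c \<le> inner \<rho> z}" using 1 iA iB i0 iAB by simp
    have "axis_rectangle a b = convex hull {v. v extreme_point_of axis_rectangle a b}"
      using axis_polygon_rectangle[OF ab] unfolding axis_polygon_def
      by (intro Krein_Milman_Minkowski polytope_imp_compact polytope_imp_convex) auto
    also have "\<dots> \<subseteq> {z. c \<le> inner \<rho> z}"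
      using V by (intro hull_minimal convex_halfspace_ge) (auto simp: extreme_point_of_axis_rectangle[OF ab])
    finally show ?thesis ..
  next
    case 2
    then show ?thesis by (intro disjI2 cut[of "(0, 0)"]) (use iA iB i0 iAB in auto)
  next
    case 3
    then show ?thesis by (intro disjI2 cut[of "(a, 0)"]) (use iA iB i0 iAB in auto)
  next
    case 4
    then show ?thesis by (intro disjI2 cut[of "(0, b)"]) (use iA iB i0 iAB in auto)
  next
    case 5
    then show ?thesis by (intro disjI2 cut[of "(a, b)"]) (use iA iB i0 iAB in auto)
  qed
qed

text \<open>The representation of a polygon by its edge normals, in a form that also covers segments and
  points: \<open>D\<close> may contain directions in which there is no edge, and \<open>K\<close> may contain the zero vector
  or directions that are already in \<open>D\<close>.\<close>

lemma convex_hull_eq_halfplanes: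
  fixes S D K T :: "(real \<times> real) set"
  defines "m \<equiv> \<lambda>\<rho>. Min (inner \<rho> ` S)"
  assumes S: "finite S" "S \<noteq> {}"
    and span: "\<And>v. v \<noteq> 0 \<Longrightarrow> \<exists>w\<in>D. inner w v < 0"
    and T: "\<And>z. z \<in> T \<longleftrightarrow> (\<forall>w\<in>D. m w \<le> inner w z)"
    and tie: "\<And>p q w. \<lbrakk>p \<in> S; q \<in> S; p \<noteq> q; w \<noteq> 0; inner w p = inner w q; \<forall>s\<in>S. inner w p \<le> inner w s\<rbrakk>
      \<Longrightarrow> \<exists>\<rho>\<in>D \<union> K. \<exists>l>0. w = l *\<^sub>R \<rho>"
  shows "convex hull S = T \<inter> (\<Inter>\<rho>\<in>K. {z. m \<rho> \<le> inner \<rho> z})"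
proof (intro equalityI subsetI)
  fix z assume "z \<in> convex hull S"
  moreover have "convex hull S \<subseteq> {z. m \<rho> \<le> inner \<rho> z}" for \<rho>
    using S by (intro hull_minimal convex_halfspace_ge) (auto simp: m_def)
  ultimately show "z \<in> T \<inter> (\<Inter>\<rho>\<in>K. {z. m \<rho> \<le> inner \<rho> z})"
    by (simp add: T subset_iff del: split_paired_All)
next
  fix z assume "z \<in> T \<inter> (\<Inter>\<rho>\<in>K. {z. m \<rho> \<le> inner \<rho> z})"
  then have z: "m \<rho> \<le> inner \<rho> z" if "\<rho> \<in> D \<union> K" for \<rho> using that T by blast
  show "z \<in> convex hull S"
  proof (rule convex_hull_from_ties[OF S span])
    fix w assume "w \<in> D"
    moreover have "m w \<in> inner w ` S" unfolding m_def using S by (intro Min_in) auto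
    ultimately show "\<exists>q\<in>S. inner w q \<le> inner w z" using z by fastforce
  next
    fix p q w
    assume *: "p \<in> S" "q \<in> S" "p \<noteq> q" "inner w p = inner w q" "\<forall>s\<in>S. inner w p \<le> inner w s"
    show "inner w p \<le> inner w z"
    proof (cases "w = 0")
      case False
      then obtain \<rho> l where \<rho>: "\<rho> \<in> D \<union> K" "l > 0" "w = l *\<^sub>R \<rho>" using tie[OF *(1-3) _ *(4,5)] by blast
      then have "\<forall>s\<in>S. inner \<rho> p \<le> inner \<rho> s" using *(5) by simp
      then have "inner \<rho> p \<le> m \<rho>" unfolding m_def using S by (intro Min.boundedI) auto
      then show ?thesis using z[OF \<rho>(1)] \<rho>(2,3) by simp
    qed simp
  qed
qed

text \<open>The condition on \<open>V\<close> has two cases because a half-plane with nonnegative normal that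
  misses a point of the first quadrant also misses the origin, so that it can only cut there.\<close>

lemma obtained_by_cuts_of_triangle:
  fixes S K :: "(real \<times> real) set"
  assumes S: "finite S" "\<And>s. s \<in> S \<Longrightarrow> 0 \<le> fst s \<and> 0 \<le> snd s"
    and touch: "p \<in> S" "fst p = 0" "q \<in> S" "snd q = 0" and nonzero: "s0 \<in> S" "s0 \<noteq> 0"
    and r: "r1 > 0" "r2 > 0" and K: "finite K" "card K \<le> k"
    and V: "V = UNIV \<or> V = {(0, 0)} \<and> (\<forall>\<rho>\<in>K. 0 \<le> fst \<rho> \<and> 0 \<le> snd \<rho>)"
    and tie: "\<And>p q w. \<lbrakk>p \<in> S; q \<in> S; p \<noteq> q; w \<noteq> 0; inner w p = inner w q; \<forall>s\<in>S. inner w p \<le> inner w s\<rbrakk>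
      \<Longrightarrow> \<exists>\<rho>\<in>{(1, 0), (0, 1), (- r1, - r2)} \<union> K. \<exists>l>0. w = l *\<^sub>R \<rho>"
  shows "\<exists>T. axis_polygon 3 T \<and> obtained_by_cuts V k T (convex hull S)"
proof -
  define m where "m = (\<lambda>\<rho>. Min (inner \<rho> ` S))"
  have m_le: "m \<rho> \<le> inner \<rho> s" if "s \<in> S" for \<rho> s using that S(1) by (simp add: m_def)
  have m_in: "\<exists>s\<in>S. m \<rho> = inner \<rho> s" for \<rho>
  proof -
    have "m \<rho> \<in> inner \<rho> ` S" unfolding m_def using S(1) touch(1) by (intro Min_in) auto
    then show ?thesis by blast
  qed
  obtain t where t: "t \<in> S" "m (- r1, - r2) = inner (- r1, - r2) t" using m_in by blast
  define c where "c = r1 * fst t + r2 * snd t"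
  have mc: "m (- r1, - r2) = - c" using t(2) by (simp add: c_def inner_prod_def)
  have c_ge: "r1 * fst s + r2 * snd s \<le> c" if "s \<in> S" for s
    using m_le[OF that, of "(- r1, - r2)"] by (simp add: mc inner_prod_def)
  have "0 < c"
  proof -
    have "0 < fst s0 \<or> 0 < snd s0" using S(2)[OF nonzero(1)] nonzero(2) by (auto simp: prod_eq_iff)
    then have "0 < r1 * fst s0 + r2 * snd s0"
      using S(2)[OF nonzero(1)] r by (auto intro: add_pos_nonneg add_nonneg_pos)
    then show ?thesis using c_ge[OF nonzero(1)] by simp
  qed
  define a b where "a = c / r1" and "b = c / r2"
  have ab: "a > 0" "b > 0" using \<open>0 < c\<close> r by (auto simp: a_def b_def)
  have m1: "m (1, 0) = 0"
    unfolding m_def using S touch by (intro Min_eqI) (auto simp: inner_prod_def rev_image_eqI)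
  have m2: "m (0, 1) = 0"
    unfolding m_def using S touch by (intro Min_eqI) (auto simp: inner_prod_def rev_image_eqI)
  have line: "fst z / a + snd z / b = (r1 * fst z + r2 * snd z) / c" for z :: "real \<times> real"
    using r by (simp add: a_def b_def add_divide_distrib mult.commute)
  have T: "z \<in> axis_triangle a b \<longleftrightarrow> (\<forall>w\<in>{(1, 0), (0, 1), (- r1, - r2)}. m w \<le> inner w z)" for z
    using \<open>0 < c\<close> by (auto simp: axis_triangle_eq[OF ab] line m1 m2 mc inner_prod_def divide_le_eq_1)
  have ST: "S \<subseteq> axis_triangle a b" using T m_le by blast
  have span: "\<exists>w\<in>{(1, 0), (0, 1), (- r1, - r2)}. inner w v < 0" if "v \<noteq> 0" for v :: "real \<times> real"
  proof (rule ccontr)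
    assume "\<not> ?thesis"
    then have v: "0 \<le> fst v" "0 \<le> snd v" "r1 * fst v + r2 * snd v \<le> 0" by (auto simp: inner_prod_def)
    then have "r1 * fst v = 0 \<and> r2 * snd v = 0"
      using r mult_nonneg_nonneg[of r1 "fst v"] mult_nonneg_nonneg[of r2 "snd v"] by linarith
    then show False using that r by (auto simp: prod_eq_iff)
  qed
  have "convex hull S = axis_triangle a b \<inter> (\<Inter>\<rho>\<in>K. {z. m \<rho> \<le> inner \<rho> z})"
    unfolding m_def
    by (rule convex_hull_eq_halfplanes[OF S(1) _ span T[unfolded m_def] tie]) (use touch(1) in blast)
  moreover have "axis_triangle a b \<subseteq> {z. m \<rho> \<le> inner \<rho> z} \<or>
      (\<exists>v\<in>V. corner_cut (axis_triangle a b) v {z. m \<rho> \<le> inner \<rho> z})" if "\<rho> \<in> K" for \<rho>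
  proof -
    have "fst t / a + snd t / b = 1" using \<open>0 < c\<close> by (simp add: line c_def)
    then consider "axis_triangle a b \<subseteq> {z. m \<rho> \<le> inner \<rho> z}"
      | v where "inner \<rho> v < m \<rho>" "corner_cut (axis_triangle a b) v {z. m \<rho> \<le> inner \<rho> z}"
      using axis_triangle_cut[OF ab, of p q t "m \<rho>" \<rho>] ST touch t(1) m_le by blast
    then show ?thesis
    proof cases
      case 2
      have v: "v \<in> {(0, 0), (a, 0), (0, b)}"
        using 2(2) by (simp add: corner_cut_def extreme_point_of_axis_triangle[OF ab])
      have "v = (0, 0)" if pos: "0 \<le> fst \<rho>" "0 \<le> snd \<rho>"
      proof (rule ccontr)
        assume "v \<noteq> (0, 0)"
        then have "m \<rho> \<le> inner \<rho> (0, 0)"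
          using 2(2) by (simp add: corner_cut_def extreme_point_of_axis_triangle[OF ab])
        moreover have "0 \<le> inner \<rho> v" using v pos ab by (auto simp: inner_prod_def)
        ultimately show False using 2(1) by (simp add: inner_prod_def)
      qed
      then have "v \<in> V" using V \<open>\<rho> \<in> K\<close> by blast
      then show ?thesis using 2(2) by blast
    qed simp
  qed
  ultimately have "obtained_by_cuts V k (axis_triangle a b) (convex hull S)"
    by (rule obtained_by_cutsI[OF K])
  then show ?thesis using axis_polygon_triangle[OF ab] by blast
qed

lemma obtained_by_cuts_of_rectangle:
  fixes S K :: "(real \<times> real) set"
  assumes S: "finite S" "\<And>s. s \<in> S \<Longrightarrow> 0 \<le> fst s \<and> 0 \<le> snd s"
    and touch: "p1 \<in> S" "fst p1 = 0" "p2 \<in> S" "snd p2 = 0"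
    and pos: "s1 \<in> S" "0 < fst s1" "s2 \<in> S" "0 < snd s2"
    and K: "finite K" "card K \<le> k"
    and tie: "\<And>p q w. \<lbrakk>p \<in> S; q \<in> S; p \<noteq> q; w \<noteq> 0; inner w p = inner w q; \<forall>s\<in>S. inner w p \<le> inner w s\<rbrakk>
      \<Longrightarrow> \<exists>\<rho>\<in>{(1, 0), (0, 1), (- 1, 0), (0, - 1)} \<union> K. \<exists>l>0. w = l *\<^sub>R \<rho>"
  shows "\<exists>T. axis_polygon 4 T \<and> obtained_by_cuts UNIV k T (convex hull S)"
proof -
  define m where "m = (\<lambda>\<rho>. Min (inner \<rho> ` S))"
  have m_le: "m \<rho> \<le> inner \<rho> s" if "s \<in> S" for \<rho> s using that S(1) by (simp add: m_def)
  have m_in: "\<exists>s\<in>S. m \<rho> = inner \<rho> s" for \<rho>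
  proof -
    have "m \<rho> \<in> inner \<rho> ` S" unfolding m_def using S(1) touch(1) by (intro Min_in) auto
    then show ?thesis by blast
  qed
  obtain t1 where t1: "t1 \<in> S" "m (- 1, 0) = inner (- 1, 0) t1" using m_in by blast
  obtain t2 where t2: "t2 \<in> S" "m (0, - 1) = inner (0, - 1) t2" using m_in by blast
  define a b where "a = fst t1" and "b = snd t2"
  have ma: "m (- 1, 0) = - a" and mb: "m (0, - 1) = - b"
    using t1(2) t2(2) by (simp_all add: a_def b_def inner_prod_def)
  have ab: "a > 0" "b > 0"
    using m_le[OF pos(1), of "(- 1, 0)"] m_le[OF pos(3), of "(0, - 1)"] pos
    by (simp_all add: ma mb inner_prod_def)
  have m1: "m (1, 0) = 0"
    unfolding m_def using S touch by (intro Min_eqI) (auto simp: inner_prod_def rev_image_eqI)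
  have m2: "m (0, 1) = 0"
    unfolding m_def using S touch by (intro Min_eqI) (auto simp: inner_prod_def rev_image_eqI)
  let ?D = "{(1, 0), (0, 1), (- 1, 0), (0, - 1)} :: (real \<times> real) set"
  have T: "z \<in> axis_rectangle a b \<longleftrightarrow> (\<forall>w\<in>?D. m w \<le> inner w z)" for z
    by (auto simp: axis_rectangle_def mem_Times_iff m1 m2 ma mb inner_prod_def)
  have ST: "S \<subseteq> axis_rectangle a b" using T m_le by blast
  have span: "\<exists>w\<in>?D. inner w v < 0" if "v \<noteq> 0" for v :: "real \<times> real"
  proof (rule ccontr)
    assume "\<not> ?thesis"
    then have "fst v = 0" "snd v = 0" by (auto simp: inner_prod_def)
    then show False using that by (simp add: prod_eq_iff)
  qed
  have "convex hull S = axis_rectangle a b \<inter> (\<Inter>\<rho>\<in>K. {z. m \<rho> \<le> inner \<rho> z})"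
    unfolding m_def
    by (rule convex_hull_eq_halfplanes[OF S(1) _ span T[unfolded m_def] tie]) (use touch(1) in blast)
  moreover have "axis_rectangle a b \<subseteq> {z. m \<rho> \<le> inner \<rho> z} \<or>
      (\<exists>v\<in>UNIV. corner_cut (axis_rectangle a b) v {z. m \<rho> \<le> inner \<rho> z})" for \<rho>
    using axis_rectangle_cut[OF ab, of p1 p2 t1 t2 "m \<rho>" \<rho>] ST touch t1(1) t2(1) m_le a_def b_def by blast
  ultimately have "obtained_by_cuts UNIV k (axis_rectangle a b) (convex hull S)"
    by (rule obtained_by_cutsI[OF K])
  then show ?thesis using axis_polygon_rectangle[OF ab] by blast
qed

section \<open>Generic coefficients\<close>

lemma for_generic_coeffs_mono:
  assumes "for_generic_coeffs Ss \<Phi>" "\<And>P. \<Phi> P \<Longrightarrow> \<Psi> P"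
  shows "for_generic_coeffs Ss \<Psi>"
  using assms unfolding for_generic_coeffs_def by metis

lemma polynomial_maps_sum:
  "(\<And>a. a \<in> A \<Longrightarrow> F a \<in> polynomial_maps I) \<Longrightarrow> (\<lambda>c. \<Sum>a\<in>A. F a c) \<in> polynomial_maps I"
  by (induction A rule: infinite_finite_induct) (auto intro: polynomial_maps.intros)

lemma polynomial_maps_prod:
  "(\<And>a. a \<in> A \<Longrightarrow> F a \<in> polynomial_maps I) \<Longrightarrow> (\<lambda>c. \<Prod>a\<in>A. F a c) \<in> polynomial_maps I"
  by (induction A rule: infinite_finite_induct) (auto intro: polynomial_maps.intros)

lemma polynomial_map_on_line:
  assumes "F \<in> polynomial_maps I"
  shows "\<exists>p. \<forall>s. F (\<lambda>i. if i \<in> I then a i + s * b i else undefined) = poly p s"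
  using assms
proof induction
  case (const a)
  show ?case by (rule exI[of _ "[:a:]"]) simp
next
  case (coord i)
  then show ?case by (intro exI[of _ "[:a i, b i:]"]) simp
next
  case (add F G)
  then obtain p q where "\<forall>s. F (\<lambda>i. if i \<in> I then a i + s * b i else undefined) = poly p s"
    "\<forall>s. G (\<lambda>i. if i \<in> I then a i + s * b i else undefined) = poly q s" by blast
  then show ?case by (intro exI[of _ "p + q"]) simp
next
  case (mult F G)
  then obtain p q where "\<forall>s. F (\<lambda>i. if i \<in> I then a i + s * b i else undefined) = poly p s"
    "\<forall>s. G (\<lambda>i. if i \<in> I then a i + s * b i else undefined) = poly q s" by blast
  then show ?case by (intro exI[of _ "p * q"]) simp
qed

lemma finite_coeff_index:
  assumes "\<forall>S\<in>set Ss. finite S"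
  shows "finite (coeff_index Ss)"
proof -
  have "coeff_index Ss = (SIGMA k:{..<length Ss}. Ss ! k)" by (auto simp: coeff_index_def)
  then show ?thesis using assms by (metis finite_SigmaI finite_lessThan lessThan_iff nth_mem)
qed

text \<open>The coefficient space is irreducible: on the line through \<open>a\<close> and \<open>b\<close> both functions are
  nonzero univariate polynomials, and so are all coordinates. Hence all but finitely many points of
  that line are as required.\<close>

lemma common_nonvanishing_point:
  assumes fin: "\<forall>S\<in>set Ss. finite S"
    and F: "F \<in> polynomial_maps (coeff_index Ss)" "a \<in> coeff_space Ss" "F a \<noteq> 0"
    and G: "G \<in> polynomial_maps (coeff_index Ss)" "b \<in> coeff_space Ss" "G b \<noteq> 0"
  shows "\<exists>c\<in>coeff_space Ss. F c \<noteq> 0 \<and> G c \<noteq> 0"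
proof -
  let ?I = "coeff_index Ss"
  define L where "L = (\<lambda>s i. if i \<in> ?I then a i + s * (b i - a i) else undefined)"
  have ab: "a i \<noteq> 0" "b i \<noteq> 0" if "i \<in> ?I" for i
    using F(2) G(2) that by (auto simp: coeff_space_def)
  have L0: "L 0 = a" and L1: "L 1 = b"
    using F(2) G(2) by (auto simp: L_def coeff_space_def PiE_def extensional_def)
  obtain p where p: "\<And>s. F (L s) = poly p s"
    using polynomial_map_on_line[OF F(1), of a "\<lambda>i. b i - a i"] unfolding L_def by blast
  obtain q where q: "\<And>s. G (L s) = poly q s"
    using polynomial_map_on_line[OF G(1), of a "\<lambda>i. b i - a i"] unfolding L_def by blast
  have "p \<noteq> 0" "q \<noteq> 0" using p[of 0] q[of 1] F(3) G(3) L0 L1 by auto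
  then have "finite {s. poly p s = 0}" "finite {s. poly q s = 0}" by (simp_all add: poly_roots_finite)
  moreover have "finite (\<Union>i\<in>?I. {s. poly [:a i, b i - a i:] s = 0})"
    using ab by (intro finite_UN_I finite_coeff_index fin poly_roots_finite) auto
  ultimately have "finite ({s. poly p s = 0} \<union> {s. poly q s = 0} \<union> (\<Union>i\<in>?I. {s. poly [:a i, b i - a i:] s = 0}))"
    by (intro finite_UnI)
  from ex_new_if_finite[OF infinite_UNIV_char_0 this]
  obtain s where s: "poly p s \<noteq> 0" "poly q s \<noteq> 0" "\<forall>i\<in>?I. poly [:a i, b i - a i:] s \<noteq> 0"
    by auto
  have "L s i \<noteq> 0" if "i \<in> ?I" for i
    using s(3)[rule_format, OF that] that by (simp add: L_def)
  then have "L s \<in> coeff_space Ss" by (auto simp: coeff_space_def L_def)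
  moreover have "F (L s) \<noteq> 0" "G (L s) \<noteq> 0" using s p q by simp_all
  ultimately show ?thesis by blast
qed

lemma common_nonvanishing_point_finite:
  assumes fin: "\<forall>S\<in>set Ss. finite S" and "finite A"
    and F: "\<And>a. a \<in> A \<Longrightarrow> F a \<in> polynomial_maps (coeff_index Ss)"
    and nz: "\<And>a. a \<in> A \<Longrightarrow> \<exists>c\<in>coeff_space Ss. F a c \<noteq> 0"
  shows "\<exists>c\<in>coeff_space Ss. (\<Prod>a\<in>A. F a c) \<noteq> 0"
  using \<open>finite A\<close> F nz
proof (induction A)
  case empty
  have "restrict (\<lambda>_. 1) (coeff_index Ss) \<in> coeff_space Ss" by (auto simp: coeff_space_def)
  then show ?case by auto
next
  case (insert x A)
  obtain a b where "a \<in> coeff_space Ss" "F x a \<noteq> 0" "b \<in> coeff_space Ss" "(\<Prod>a\<in>A. F a b) \<noteq> 0"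
    using insert by blast
  then show ?case
    using common_nonvanishing_point[OF fin, of "F x" a "\<lambda>c. \<Prod>a\<in>A. F a c" b] insert
    by (auto intro: polynomial_maps_prod)
qed

text \<open>A nonempty principal open set is dense in the Zariski topology, because any two such sets
  meet.\<close>

lemma for_generic_coeffsI:
  assumes fin: "\<forall>S\<in>set Ss. finite S"
    and F: "F \<in> polynomial_maps (coeff_index Ss)" "\<exists>c\<in>coeff_space Ss. F c \<noteq> 0"
    and \<Phi>: "\<And>c. c \<in> coeff_space Ss \<Longrightarrow> F c \<noteq> 0 \<Longrightarrow> \<Phi> (supported_poly Ss c)"
  shows "for_generic_coeffs Ss \<Phi>"
proof -
  let ?PM = "polynomial_maps (coeff_index Ss)"
  let ?B = "{{c \<in> coeff_space Ss. F c \<noteq> 0} | F. F \<in> ?PM}"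
  define U where "U = {c \<in> coeff_space Ss. F c \<noteq> 0}"
  have "openin (coeff_zariski Ss) U"
    unfolding coeff_zariski_def U_def using F(1) by (intro topology_generated_by_Basis) auto
  have basic: "\<forall>c\<in>T. \<exists>G\<in>?PM. c \<in> coeff_space Ss \<and> G c \<noteq> 0 \<and> {c \<in> coeff_space Ss. G c \<noteq> 0} \<subseteq> T"
    if "generate_topology_on ?B T" for T
    using that
  proof induction
    case (Int S T)
    show ?case
    proof
      fix c assume "c \<in> S \<inter> T"
      then have "c \<in> S" "c \<in> T" by auto
      obtain G where "G \<in> ?PM" "c \<in> coeff_space Ss" "G c \<noteq> 0" "{c \<in> coeff_space Ss. G c \<noteq> 0} \<subseteq> S"
        using Int.IH(1) \<open>c \<in> S\<close> by blast
      moreover obtain H where "H \<in> ?PM" "H c \<noteq> 0" "{c \<in> coeff_space Ss. H c \<noteq> 0} \<subseteq> T"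
        using Int.IH(2) \<open>c \<in> T\<close> by blast
      ultimately show "\<exists>G\<in>?PM. c \<in> coeff_space Ss \<and> G c \<noteq> 0 \<and> {c \<in> coeff_space Ss. G c \<noteq> 0} \<subseteq> S \<inter> T"
        by (intro bexI[of _ "\<lambda>c. G c * H c"]) (auto intro: polynomial_maps.mult)
    qed
  next
    case (UN K)
    then show ?case by (meson Union_iff Union_upper order_trans)
  next
    case (Basis S)
    then show ?case by auto
  qed simp
  have "coeff_zariski Ss closure_of U = topspace (coeff_zariski Ss)"
  proof (intro equalityI closure_of_subset_topspace subsetI)
    fix x assume x: "x \<in> topspace (coeff_zariski Ss)"
    have "\<exists>y. y \<in> U \<and> y \<in> T" if T: "x \<in> T" "openin (coeff_zariski Ss) T" for T
    proof -
      have "generate_topology_on ?B T"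
        using T(2) by (simp add: coeff_zariski_def openin_topology_generated_by_iff)
      then obtain G where G: "G \<in> ?PM" "x \<in> coeff_space Ss" "G x \<noteq> 0" "{c \<in> coeff_space Ss. G c \<noteq> 0} \<subseteq> T"
        using basic T(1) by blast
      obtain a where "a \<in> coeff_space Ss" "F a \<noteq> 0" using F(2) by blast
      then obtain c where "c \<in> coeff_space Ss" "F c \<noteq> 0" "G c \<noteq> 0"
        using common_nonvanishing_point[OF fin F(1) _ _ G(1-3)] by blast
      then show ?thesis using G(4) by (auto simp: U_def)
    qed
    then show "x \<in> coeff_zariski Ss closure_of U" using x by (auto simp: in_closure_of)
  qed
  then show ?thesis unfolding for_generic_coeffs_def
    using \<open>openin (coeff_zariski Ss) U\<close> \<Phi> by (intro exI[of _ U]) (auto simp: U_def)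
qed

text \<open>Removing the largest power of \<open>t\<close> leaves the roots outside the origin, and gives a polynomial
  whose degree does not depend on the coefficients. So the resultant of two such
  polynomials is the determinant of a matrix of fixed size.\<close>

definition torus_part :: "nat set list \<Rightarrow> (nat \<times> nat \<Rightarrow> complex) \<Rightarrow> nat \<Rightarrow> complex poly" where
  "torus_part Ss c k = (\<Sum>i\<in>Ss ! k. monom (c (k, i)) (i - Min (Ss ! k)))"

lemma supported_poly_eq_torus_part:
  assumes "finite (Ss ! k)"
  shows "supported_poly Ss c k = monom 1 (Min (Ss ! k)) * torus_part Ss c k"
  using assms by (auto simp: supported_poly_def torus_part_def sum_distrib_left mult_monom intro!: sum.cong)

lemma coeff_supported_poly:
  assumes "finite (Ss ! k)"
  shows "coeff (supported_poly Ss c k) n = (if n \<in> Ss ! k then c (k, n) else 0)"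
  using assms by (simp add: supported_poly_def coeff_sum sum.delta)

lemma coeff_torus_part:
  assumes "finite (Ss ! k)"
  shows "coeff (torus_part Ss c k) n = (if n + Min (Ss ! k) \<in> Ss ! k then c (k, n + Min (Ss ! k)) else 0)"
proof -
  have "coeff (supported_poly Ss c k) (n + Min (Ss ! k)) = coeff (torus_part Ss c k) n"
    by (simp add: supported_poly_eq_torus_part[OF assms] coeff_monom_mult)
  then show ?thesis by (simp add: coeff_supported_poly[OF assms])
qed

lemma coeff_space_nonzero:
  "c \<in> coeff_space Ss \<Longrightarrow> k < length Ss \<Longrightarrow> i \<in> Ss ! k \<Longrightarrow> c (k, i) \<noteq> 0"
  by (auto simp: coeff_space_def coeff_index_def)

lemma degree_torus_part:
  assumes S: "finite (Ss ! k)" "Ss ! k \<noteq> {}" and c: "c \<in> coeff_space Ss" "k < length Ss"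
  shows "degree (torus_part Ss c k) = Max (Ss ! k) - Min (Ss ! k)"
proof (rule antisym)
  have "Min (Ss ! k) \<le> Max (Ss ! k)" using S by (meson Max_ge Min_in)
  then have "coeff (torus_part Ss c k) (Max (Ss ! k) - Min (Ss ! k)) \<noteq> 0"
    using S c Max_in[OF S] by (simp add: coeff_torus_part coeff_space_nonzero)
  then show "Max (Ss ! k) - Min (Ss ! k) \<le> degree (torus_part Ss c k)" by (rule le_degree)
  show "degree (torus_part Ss c k) \<le> Max (Ss ! k) - Min (Ss ! k)"
  proof (intro degree_le allI impI)
    fix i assume i: "Max (Ss ! k) - Min (Ss ! k) < i"
    have "i + Min (Ss ! k) \<notin> Ss ! k" using i Max_ge[OF S(1), of "i + Min (Ss ! k)"] by linarith
    then show "coeff (torus_part Ss c k) i = 0" using S by (simp add: coeff_torus_part)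
  qed
qed

lemma poly_torus_part_0:
  assumes S: "finite (Ss ! k)" "Ss ! k \<noteq> {}" and c: "c \<in> coeff_space Ss" "k < length Ss"
  shows "poly (torus_part Ss c k) 0 \<noteq> 0"
  using S c Min_in[OF S] by (simp add: poly_0_coeff_0 coeff_torus_part coeff_space_nonzero)

lemma resultant_complex_0_iff:
  fixes p q :: "complex poly"
  assumes "p \<noteq> 0"
  shows "resultant p q = 0 \<longleftrightarrow> (\<exists>z. poly p z = 0 \<and> poly q z = 0)"
proof -
  have g: "gcd p q \<noteq> 0" using assms by simp
  have "degree (gcd p q) \<noteq> 0 \<longleftrightarrow> (\<exists>z. poly (gcd p q) z = 0)"
  proof
    assume "degree (gcd p q) \<noteq> 0"
    then show "\<exists>z. poly (gcd p q) z = 0"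
      using fundamental_theorem_of_algebra constant_degree by metis
  next
    assume "\<exists>z. poly (gcd p q) z = 0"
    then show "degree (gcd p q) \<noteq> 0" using g by (metis poly_zero constant_degree constant_def degree_0_id poly_const_conv pCons_0_0)
  qed
  also have "\<dots> \<longleftrightarrow> (\<exists>z. poly p z = 0 \<and> poly q z = 0)"
    by (simp add: poly_eq_0_iff_dvd)
  finally show ?thesis by (simp add: resultant_0_gcd)
qed

lemma resultant_sub_polynomial_map:
  assumes "\<And>i. (\<lambda>c. coeff (p c) i) \<in> polynomial_maps I" "\<And>i. (\<lambda>c. coeff (q c) i) \<in> polynomial_maps I"
  shows "(\<lambda>c. resultant_sub m n (p c) (q c)) \<in> polynomial_maps I"
proof -
  have entry: "(\<lambda>c. sylvester_mat_sub m n (p c) (q c) $$ (i, j)) \<in> polynomial_maps I"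
    if "i < m + n" "j < m + n" for i j
    unfolding sylvester_mat_sub_index[OF that]
    by (cases "i < n"; cases "i \<le> j \<and> j - i \<le> m"; cases "i - n \<le> j \<and> j \<le> i")
      (auto simp: assms polynomial_maps.const)
  have "resultant_sub m n (p c) (q c) =
      (\<Sum>\<pi>\<in>{\<pi>. \<pi> permutes {0..<m+n}}. signof \<pi> * (\<Prod>i=0..<m+n. sylvester_mat_sub m n (p c) (q c) $$ (i, \<pi> i)))" for c
    unfolding resultant_sub_def by (rule det_def'[OF sylvester_mat_sub_carrier])
  then show ?thesis
    by (simp only:) (intro polynomial_maps_sum polynomial_maps.mult polynomial_maps.const polynomial_maps_prod entry,
      auto simp: permutes_in_image[of _ "{0..<m+n}", simplified])
qed

lemma exists_coeffs_without_common_root: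
  assumes fin: "\<forall>S\<in>set Ss. finite S" and kl: "k < length Ss" "l < length Ss" "k \<noteq> l"
    and ne: "Ss ! k \<noteq> {}" "Ss ! l \<noteq> {}"
  shows "\<exists>c\<in>coeff_space Ss. \<forall>z. z \<noteq> 0 \<longrightarrow>
    \<not> (poly (supported_poly Ss c k) z = 0 \<and> poly (supported_poly Ss c l) z = 0)"
proof -
  define R where "R = (\<lambda>j. supported_poly Ss (\<lambda>_. 1) j)"
  have finj: "finite (Ss ! k)" "finite (Ss ! l)" using fin kl by auto
  have R: "R k \<noteq> 0" "R l \<noteq> 0"
  proof -
    obtain i j where "i \<in> Ss ! k" "j \<in> Ss ! l" using ne by blast
    then have "coeff (R k) i \<noteq> 0" "coeff (R l) j \<noteq> 0" using finj by (simp_all add: R_def coeff_supported_poly)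
    then show "R k \<noteq> 0" "R l \<noteq> 0" by auto
  qed
  have "finite ({0} \<union> (\<lambda>(r, z). r / z) ` ({r. poly (R l) r = 0} \<times> {z. poly (R k) z = 0}))"
    using R by (intro finite_UnI finite_imageI finite_cartesian_product poly_roots_finite) auto
  then obtain u where u: "u \<notin> {0} \<union> (\<lambda>(r, z). r / z) ` ({r. poly (R l) r = 0} \<times> {z. poly (R k) z = 0})"
    using ex_new_if_finite[OF infinite_UNIV_char_0] by blast
  \<comment> \<open>Rescaling the variable in one of the two polynomials moves its roots off those of the other.\<close>
  define c where "c = restrict (\<lambda>(j, i). if j = l then u ^ i else 1) (coeff_index Ss)"
  have "c \<in> coeff_space Ss" using u by (auto simp: c_def coeff_space_def split: if_splits)
  moreover have "\<not> (poly (supported_poly Ss c k) z = 0 \<and> poly (supported_poly Ss c l) z = 0)" if "z \<noteq> 0" for z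
  proof
    assume z: "poly (supported_poly Ss c k) z = 0 \<and> poly (supported_poly Ss c l) z = 0"
    have "supported_poly Ss c k = R k"
      unfolding R_def supported_poly_def
      by (rule sum.cong) (use kl in \<open>auto simp: c_def coeff_index_def\<close>)
    moreover have "poly (supported_poly Ss c l) z = poly (R l) (u * z)"
      unfolding R_def supported_poly_def poly_sum
      by (rule sum.cong) (use kl in \<open>auto simp: c_def coeff_index_def poly_monom power_mult_distrib\<close>)
    ultimately have "(u * z, z) \<in> {r. poly (R l) r = 0} \<times> {z. poly (R k) z = 0}" using z by simp
    moreover have "u = (\<lambda>(r, z). r / z) (u * z, z)" using that by simp
    ultimately show False using u by blast
  qed
  ultimately show ?thesis by blast
qed

text \<open>The product of the resultants of all pairs is a polynomial in the coefficients. It does not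
  vanish identically, because no factor does and the coefficient space is irreducible.\<close>

theorem generic_no_common_roots:
  assumes fin: "\<forall>S\<in>set Ss. finite S"
  shows "for_generic_coeffs Ss (\<lambda>P.
    (\<forall>k<length Ss. P k = 0 \<longleftrightarrow> Ss ! k = {}) \<and>
    (\<forall>k<length Ss. \<forall>l<length Ss. \<forall>z. k \<noteq> l \<longrightarrow> P k \<noteq> 0 \<longrightarrow> P l \<noteq> 0 \<longrightarrow> z \<noteq> 0 \<longrightarrow>
      poly (P k) z = 0 \<longrightarrow> poly (P l) z \<noteq> 0))"
proof -
  define A where "A = {(k, l). k < length Ss \<and> l < length Ss \<and> k \<noteq> l \<and> Ss ! k \<noteq> {} \<and> Ss ! l \<noteq> {}}"
  define d where "d = (\<lambda>k. Max (Ss ! k) - Min (Ss ! k))"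
  define F where "F = (\<lambda>(k, l) c. resultant_sub (d k) (d l) (torus_part Ss c k) (torus_part Ss c l))"
  have "A \<subseteq> {..<length Ss} \<times> {..<length Ss}" by (auto simp: A_def)
  then have "finite A" by (rule finite_subset) simp
  have finj: "finite (Ss ! k)" if "k < length Ss" for k using fin that by simp
  have coeffs: "(\<lambda>c. coeff (torus_part Ss c k) i) \<in> polynomial_maps (coeff_index Ss)" if "k < length Ss" for k i
    using that by (cases "i + Min (Ss ! k) \<in> Ss ! k")
      (simp_all add: coeff_torus_part finj coeff_index_def polynomial_maps.intros)
  have F: "F a \<in> polynomial_maps (coeff_index Ss)" if "a \<in> A" for a
    using that by (auto simp: A_def F_def intro!: resultant_sub_polynomial_map coeffs)
  have F0: "F (k, l) c = 0 \<longleftrightarrow> (\<exists>z. z \<noteq> 0 \<and> poly (supported_poly Ss c k) z = 0 \<and> poly (supported_poly Ss c l) z = 0)"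
    if a: "(k, l) \<in> A" and c: "c \<in> coeff_space Ss" for k l c
  proof -
    have kl: "k < length Ss" "l < length Ss" "Ss ! k \<noteq> {}" "Ss ! l \<noteq> {}" using a by (auto simp: A_def)
    have root: "poly (supported_poly Ss c j) z = 0 \<longleftrightarrow> (z = 0 \<and> Min (Ss ! j) \<noteq> 0) \<or> poly (torus_part Ss c j) z = 0"
      if "j < length Ss" for j z
      using finj[OF that] by (simp add: supported_poly_eq_torus_part poly_monom)
    have "poly (torus_part Ss c k) 0 \<noteq> 0" using kl c by (intro poly_torus_part_0 finj) auto
    then have "torus_part Ss c k \<noteq> 0" by auto
    then have "F (k, l) c = 0 \<longleftrightarrow> (\<exists>z. poly (torus_part Ss c k) z = 0 \<and> poly (torus_part Ss c l) z = 0)"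
      using degree_torus_part[OF finj[OF kl(1)] kl(3) c kl(1)] degree_torus_part[OF finj[OF kl(2)] kl(4) c kl(2)]
      by (simp add: F_def d_def resultant_complex_0_iff[symmetric] resultant_sub)
    also have "\<dots> \<longleftrightarrow> (\<exists>z. z \<noteq> 0 \<and> poly (supported_poly Ss c k) z = 0 \<and> poly (supported_poly Ss c l) z = 0)"
      using \<open>poly (torus_part Ss c k) 0 \<noteq> 0\<close> unfolding root[OF kl(1)] root[OF kl(2)] by metis
    finally show ?thesis .
  qed
  have nz: "\<exists>c\<in>coeff_space Ss. F a c \<noteq> 0" if "a \<in> A" for a
  proof -
    obtain k l where a: "a = (k, l)" by (cases a)
    then have "(k, l) \<in> A" using that by simp
    moreover obtain c where "c \<in> coeff_space Ss" "\<forall>z. z \<noteq> 0 \<longrightarrow>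
        \<not> (poly (supported_poly Ss c k) z = 0 \<and> poly (supported_poly Ss c l) z = 0)"
      using exists_coeffs_without_common_root[OF fin, of k l] \<open>(k, l) \<in> A\<close> by (auto simp: A_def)
    ultimately show ?thesis unfolding a using F0[of k l c] by blast
  qed
  show ?thesis
  proof (rule for_generic_coeffsI[OF fin])
    show "(\<lambda>c. \<Prod>a\<in>A. F a c) \<in> polynomial_maps (coeff_index Ss)" by (rule polynomial_maps_prod) (rule F)
    show "\<exists>c\<in>coeff_space Ss. (\<Prod>a\<in>A. F a c) \<noteq> 0"
      by (rule common_nonvanishing_point_finite[OF fin \<open>finite A\<close> F nz])
    fix c assume c: "c \<in> coeff_space Ss" and prod: "(\<Prod>a\<in>A. F a c) \<noteq> 0"
    have zero: "supported_poly Ss c k = 0 \<longleftrightarrow> Ss ! k = {}" if "k < length Ss" for k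
      using that c coeff_space_nonzero[OF c that]
      by (auto simp: poly_eq_iff coeff_supported_poly finj)
    moreover have "poly (supported_poly Ss c l) z \<noteq> 0"
      if "k < length Ss" "l < length Ss" "k \<noteq> l" "supported_poly Ss c k \<noteq> 0" "supported_poly Ss c l \<noteq> 0"
        "z \<noteq> 0" "poly (supported_poly Ss c k) z = 0" for k l z
    proof -
      have "(k, l) \<in> A" using that zero by (auto simp: A_def)
      then have "F (k, l) c \<noteq> 0" using prod \<open>finite A\<close> by auto
      then show ?thesis using F0[OF \<open>(k, l) \<in> A\<close> c] that by blast
    qed
    ultimately show "(\<forall>k<length Ss. supported_poly Ss c k = 0 \<longleftrightarrow> Ss ! k = {}) \<and>
      (\<forall>k<length Ss. \<forall>l<length Ss. \<forall>z. k \<noteq> l \<longrightarrow> supported_poly Ss c k \<noteq> 0 \<longrightarrow>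
        supported_poly Ss c l \<noteq> 0 \<longrightarrow> z \<noteq> 0 \<longrightarrow>
        poly (supported_poly Ss c k) z = 0 \<longrightarrow> poly (supported_poly Ss c l) z \<noteq> 0)" by blast
  qed
qed

section \<open>Integrality over subrings\<close>

locale unital_subring =
  fixes A :: "'a::comm_ring_1 set"
  assumes one_mem: "1 \<in> A" and diff_mem: "x \<in> A \<Longrightarrow> y \<in> A \<Longrightarrow> x - y \<in> A"
    and mult_mem: "x \<in> A \<Longrightarrow> y \<in> A \<Longrightarrow> x * y \<in> A"
begin

lemma zero_mem: "0 \<in> A"
  using diff_mem[OF one_mem one_mem] by simp

lemma uminus_mem: "x \<in> A \<Longrightarrow> - x \<in> A"
  using diff_mem[OF zero_mem] by simp

lemma add_mem: "x \<in> A \<Longrightarrow> y \<in> A \<Longrightarrow> x + y \<in> A"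
  using diff_mem[OF _ uminus_mem, of x y] by simp

lemma sum_mem: "(\<And>i. i \<in> I \<Longrightarrow> f i \<in> A) \<Longrightarrow> sum f I \<in> A"
  by (induction I rule: infinite_finite_induct) (auto intro: zero_mem add_mem)

lemma prod_mem: "(\<And>i. i \<in> I \<Longrightarrow> f i \<in> A) \<Longrightarrow> prod f I \<in> A"
  by (induction I rule: infinite_finite_induct) (auto intro: one_mem mult_mem)

lemma det_mem:
  assumes "M \<in> carrier_mat n n" "\<And>i j. i < n \<Longrightarrow> j < n \<Longrightarrow> M $$ (i, j) \<in> A"
  shows "det M \<in> A"
proof -
  have "signof \<pi> \<in> A" for \<pi> :: "nat \<Rightarrow> nat"
    by (cases \<pi> rule: sign_cases) (auto intro: one_mem uminus_mem)
  then show ?thesis unfolding det_def'[OF assms(1)]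
    by (intro sum_mem mult_mem prod_mem assms(2)) (auto simp: permutes_in_image[of _ "{0..<n}", simplified])
qed

end

definition polys_over :: "'a::comm_ring_1 set \<Rightarrow> 'a poly set" where
  "polys_over A = {p. \<forall>i. coeff p i \<in> A}"

lemma polys_overD: "p \<in> polys_over A \<Longrightarrow> coeff p i \<in> A"
  by (simp add: polys_over_def)

context unital_subring
begin

lemma pCons_mem_polys_over: "a \<in> A \<Longrightarrow> p \<in> polys_over A \<Longrightarrow> pCons a p \<in> polys_over A"
  by (auto simp: polys_over_def coeff_pCons split: nat.splits)

lemma zero_mem_polys_over: "0 \<in> polys_over A"
  by (simp add: polys_over_def zero_mem)

lemma smult_mem_polys_over: "a \<in> A \<Longrightarrow> p \<in> polys_over A \<Longrightarrow> Polynomial.smult a p \<in> polys_over A"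
  by (simp add: polys_over_def mult_mem)

lemma unital_subring_polys_over: "unital_subring (polys_over A)"
proof
  show "1 \<in> polys_over A" by (simp add: polys_over_def one_mem zero_mem coeff_1)
  show "x - y \<in> polys_over A" if "x \<in> polys_over A" "y \<in> polys_over A" for x y
    using that by (simp add: polys_over_def diff_mem)
  show "x * y \<in> polys_over A" if "x \<in> polys_over A" "y \<in> polys_over A" for x y
    using that by (auto simp: polys_over_def coeff_mult intro!: sum_mem mult_mem)
qed

lemma char_poly_mem_polys_over:
  assumes M: "M \<in> carrier_mat n n" "\<And>i j. i < n \<Longrightarrow> j < n \<Longrightarrow> M $$ (i, j) \<in> A"
  shows "char_poly M \<in> polys_over A"
proof -
  interpret P: unital_subring "polys_over A" by (rule unital_subring_polys_over)
  show ?thesis unfolding char_poly_def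
  proof (rule P.det_mem)
    show "char_poly_matrix M \<in> carrier_mat n n" using M(1) by simp
    show "char_poly_matrix M $$ (i, j) \<in> polys_over A" if "i < n" "j < n" for i j
      using that M
      by (auto simp: char_poly_matrix_def one_mem zero_mem uminus_mem add_mem
          intro!: pCons_mem_polys_over zero_mem_polys_over P.one_mem)
  qed
qed

end

definition integral_over :: "'a::comm_ring_1 set \<Rightarrow> 'a \<Rightarrow> bool" where
  "integral_over A z \<longleftrightarrow> (\<exists>h. lead_coeff h = 1 \<and> (\<forall>i. coeff h i \<in> A) \<and> poly h z = 0)"

text \<open>The determinant trick: \<open>z\<close> is an eigenvalue of a matrix over \<open>A\<close>, hence a root of its
  characteristic polynomial, which is monic with coefficients in \<open>A\<close>.\<close>

lemma integral_over_if_stable_span: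
  fixes A :: "'a::field set" and n :: nat
  assumes A: "unital_subring A" and n: "0 < n" and v: "v 0 \<noteq> 0"
    and m: "\<And>i j. i < n \<Longrightarrow> j < n \<Longrightarrow> m i j \<in> A"
    and z: "\<And>i. i < n \<Longrightarrow> z * v i = (\<Sum>j<n. m i j * v j)"
  shows "integral_over A z"
proof -
  interpret unital_subring A by fact
  interpret P: unital_subring "polys_over A" by (rule unital_subring_polys_over)
  define M where "M = mat n n (\<lambda>(i, j). m i j)"
  define x where "x = vec n v"
  have M: "M \<in> carrier_mat n n" by (simp add: M_def)
  have "eigenvector M x z"
    unfolding eigenvector_def
  proof (intro conjI)
    show "x \<in> carrier_vec (dim_row M)" by (simp add: x_def M_def)
    have "x $ 0 \<noteq> 0\<^sub>v (dim_row M) $ 0" using n v by (simp add: x_def M_def)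
    then show "x \<noteq> 0\<^sub>v (dim_row M)" by metis
    show "M *\<^sub>v x = z \<cdot>\<^sub>v x"
      by (rule eq_vecI) (use z in \<open>auto simp: M_def x_def scalar_prod_def lessThan_atLeast0\<close>)
  qed
  then have "poly (char_poly M) z = 0"
    using eigenvalue_root_char_poly[OF M] by (auto simp: eigenvalue_def)
  moreover have "char_poly M \<in> polys_over A"
    by (rule char_poly_mem_polys_over[OF M]) (use m in \<open>auto simp: M_def\<close>)
  ultimately show ?thesis
    using degree_monic_char_poly[OF M] unfolding integral_over_def polys_over_def by auto
qed

text \<open>As \<open>h\<close> is monic, the powers of \<open>s\<close> below its degree span \<open>A[s]\<close> over \<open>A\<close>, and multiplication by
  \<open>poly r s\<close> preserves this span.\<close>

lemma integral_over_adjoin: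
  fixes A :: "'a::field set"
  assumes A: "unital_subring A"
    and h: "h \<in> polys_over A" "lead_coeff h = 1" "poly h s = 0"
    and r: "r \<in> polys_over A"
  shows "integral_over A (poly r s)"
proof -
  interpret unital_subring A by fact
  interpret P: unital_subring "polys_over A" by (rule unital_subring_polys_over)
  define n where "n = degree h"
  have "n \<noteq> 0"
  proof
    assume "n = 0"
    then have "h = 1" using h(2) unfolding n_def by (metis degree_eq_zeroE lead_coeff_pCons(2) one_pCons)
    then show False using h(3) by simp
  qed
  then obtain k where k: "n = Suc k" by (cases n) auto
  define span where "span = {b. \<exists>m. (\<forall>j. m j \<in> A) \<and> b = (\<Sum>j<n. m j * s ^ j)}"
  have span_add: "x + y \<in> span" if xy: "x \<in> span" "y \<in> span" for x y
  proof -
    obtain f g where "\<forall>j. f j \<in> A" "\<forall>j. g j \<in> A" "x = (\<Sum>j<n. f j * s ^ j)" "y = (\<Sum>j<n. g j * s ^ j)"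
      using xy unfolding span_def by blast
    then show ?thesis unfolding span_def
      by (intro CollectI exI[of _ "\<lambda>j. f j + g j"]) (simp add: add_mem ring_distribs sum.distrib)
  qed
  have span_scale: "a * x \<in> span" if ax: "a \<in> A" "x \<in> span" for a x
  proof -
    obtain f where "\<forall>j. f j \<in> A" "x = (\<Sum>j<n. f j * s ^ j)" using ax(2) unfolding span_def by blast
    then show ?thesis unfolding span_def using ax(1)
      by (intro CollectI exI[of _ "\<lambda>j. a * f j"]) (simp add: mult_mem sum_distrib_left mult.assoc)
  qed
  have span_power: "s ^ i \<in> span" if "i < n" for i
    unfolding span_def
    by (intro CollectI exI[of _ "\<lambda>j. if j = i then 1 else 0"])
      (use that in \<open>simp add: one_mem zero_mem if_distrib[of "\<lambda>x. x * _"] sum.delta cong: if_cong\<close>)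
  have span_zero: "0 \<in> span" using span_scale[OF zero_mem span_power[of 0]] k by simp
  have span_sum: "(\<Sum>j\<in>J. f j) \<in> span" if "\<And>j. j \<in> J \<Longrightarrow> f j \<in> span" for f and J :: "nat set"
    using that by (induction J rule: infinite_finite_induct) (auto intro: span_add span_zero)
  have top: "s ^ n \<in> span"
  proof -
    have "0 = (\<Sum>i\<le>n. coeff h i * s ^ i)" using h(3) by (simp add: poly_altdef n_def)
    also have "\<dots> = (\<Sum>i<n. coeff h i * s ^ i) + s ^ n"
      using h(2) by (simp add: lessThan_Suc_atMost[symmetric] n_def)
    finally have "s ^ n = (\<Sum>i<n. - coeff h i * s ^ i)"
      by (simp add: sum_negf eq_neg_iff_add_eq_0 add.commute)
    also have "\<dots> \<in> span"
      by (intro span_sum span_scale uminus_mem polys_overD[OF h(1)] span_power) simp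
    finally show ?thesis .
  qed
  have span_mult: "s * x \<in> span" if x: "x \<in> span" for x
  proof -
    obtain f where f: "\<forall>j. f j \<in> A" "x = (\<Sum>j<n. f j * s ^ j)" using x unfolding span_def by blast
    have "s * x = (\<Sum>j<n. f j * s ^ Suc j)" by (simp add: f(2) sum_distrib_left mult_ac)
    also have "\<dots> \<in> span"
    proof (intro span_sum span_scale)
      show "f j \<in> A" for j using f(1) by blast
      show "s ^ Suc j \<in> span" if "j \<in> {..<n}" for j
        using that top span_power[of "Suc j"] by (cases "Suc j = n") auto
    qed
    finally show ?thesis .
  qed
  have span_poly: "poly p s \<in> span" if "p \<in> polys_over A" for p
    using that
  proof (induction p)
    case (pCons a p)
    then have "a \<in> A" "p \<in> polys_over A"
      using polys_overD[OF pCons.prems, of 0] polys_overD[OF pCons.prems, of "Suc _"] by (auto simp: polys_over_def)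
    then show ?case
      using pCons.IH span_add[OF span_scale[OF _ span_power[of 0]] span_mult] k by simp
  qed (simp add: span_zero)
  have "\<exists>m. (\<forall>j. m j \<in> A) \<and> poly r s * s ^ i = (\<Sum>j<n. m j * s ^ j)" for i
  proof -
    have "r * monom 1 i \<in> polys_over A"
      using r by (intro P.mult_mem) (auto simp: polys_over_def one_mem zero_mem)
    from span_poly[OF this] show ?thesis by (simp add: span_def poly_monom)
  qed
  then obtain m where "\<And>i j. m i j \<in> A" "\<And>i. poly r s * s ^ i = (\<Sum>j<n. m i j * s ^ j)" by metis
  then show ?thesis
    using \<open>n \<noteq> 0\<close> by (intro integral_over_if_stable_span[OF A, of n "\<lambda>i. s ^ i" m]) auto
qed

section \<open>Rational functions with prescribed poles\<close>

interpretation const_fract: inj_comm_ring_hom const_fract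
proof
  show "x = 0" if "const_fract x = 0" for x using that by (simp add: const_fract_def Zero_fract_def eq_fract)
qed (simp_all add: const_fract_def Zero_fract_def One_fract_def mult_ac)

interpretation map_const_fract: map_poly_comm_ring_hom const_fract ..

definition eval_at :: "complex poly \<Rightarrow> complex poly fract \<Rightarrow> complex poly fract" where
  "eval_at p s = poly (map_poly const_fract p) s"

lemma eval_at_simps [simp]:
  "eval_at 0 s = 0" "eval_at 1 s = 1"
  "eval_at (pCons c p) s = const_fract c + s * eval_at p s"
  "eval_at (p + q) s = eval_at p s + eval_at q s"
  "eval_at (p * q) s = eval_at p s * eval_at q s"
  by (simp_all add: eval_at_def Polynomial.map_poly_pCons map_const_fract.hom_add map_const_fract.hom_mult)

text \<open>Since the degrees of \<open>p\<close> and \<open>q\<close> differ, the relation \<open>p(s) - X q(s) = 0\<close> has a leading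
  coefficient that is a unit in \<open>A\<close>, so \<open>s\<close> is integral over \<open>A\<close>. At a root \<open>a\<close> of \<open>p q\<close> exactly one of
  \<open>p(a)\<close> and \<open>q(a)\<close> vanishes, so \<open>p(a) - X q(a)\<close> is a unit as well. It differs from
  \<open>p(s) - X q(s) = 0\<close> by a multiple of \<open>s - a\<close>, so \<open>1 / (s - a)\<close> lies in \<open>A[s]\<close>. Thus \<open>A[s]\<close>
  contains \<open>1 / g(s)\<close> and \<open>z\<close>.\<close>

lemma integral_over_quotient_at:
  fixes X s z :: "complex poly fract"
  assumes A: "unital_subring A" "\<And>c. const_fract c \<in> A" "X \<in> A" "inverse X \<in> A" "X \<noteq> 0"
    and X: "X * eval_at q s = eval_at p s"
    and pq: "p \<noteq> 0" "q \<noteq> 0" "degree p \<noteq> degree q" "\<And>a. poly p a = 0 \<Longrightarrow> poly q a \<noteq> 0"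
    and g: "g \<noteq> 0" "\<And>a. poly g a = 0 \<Longrightarrow> poly p a = 0 \<or> poly q a = 0"
    and z: "z * eval_at g s = eval_at f s"
  shows "integral_over A z"
proof -
  interpret unital_subring A by fact
  interpret P: unital_subring "polys_over A" by (rule unital_subring_polys_over)
  have const_polys: "map_poly const_fract r \<in> polys_over A" for r
    by (simp add: polys_over_def coeff_map_poly A(2))
  \<comment> \<open>A monic equation for \<open>s\<close>: the leading coefficient of \<open>p - X q\<close> is invertible in \<open>A\<close>.\<close>
  define H where "H = map_poly const_fract p - Polynomial.smult X (map_poly const_fract q)"
  have H: "H \<in> polys_over A" unfolding H_def by (intro P.diff_mem smult_mem_polys_over const_polys A(3))
  have Hs: "poly H s = 0" using X by (simp add: H_def eval_at_def)
  have dp: "degree (map_poly const_fract p) = degree p" "degree (map_poly const_fract q) = degree q" for p q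
    by simp_all
  have "\<exists>u\<in>A. u * lead_coeff H = 1"
  proof (cases "degree q < degree p")
    case True
    then have "degree (Polynomial.smult X (map_poly const_fract q)) < degree (map_poly const_fract p)"
      using A(5) by simp
    moreover from this have "degree H = degree p"
      using degree_add_eq_left[of "- Polynomial.smult X (map_poly const_fract q)" "map_poly const_fract p"]
      by (simp add: H_def)
    ultimately have "lead_coeff H = const_fract (lead_coeff p)"
      using True by (simp add: H_def coeff_eq_0)
    then show ?thesis
      using pq(1) A(2) by (intro bexI[of _ "const_fract (inverse (lead_coeff p))"])
        (simp_all add: const_fract.hom_mult[symmetric])
  next
    case False
    then have lt: "degree (map_poly const_fract p) < degree (Polynomial.smult X (map_poly const_fract q))"
      using A(5) pq(3) by simp
    then have "degree H = degree q"
      using degree_add_eq_right[of "map_poly const_fract p" "- Polynomial.smult X (map_poly const_fract q)"] A(5)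
      by (simp add: H_def)
    then have "lead_coeff H = - (X * const_fract (lead_coeff q))"
      using lt A(5) by (simp add: H_def coeff_eq_0 coeff_map_poly)
    then show ?thesis
      using pq(2) A by (intro bexI[of _ "- (inverse X * const_fract (inverse (lead_coeff q)))"])
        (auto simp: const_fract.hom_mult[symmetric] mult_ac intro!: uminus_mem mult_mem
          simp flip: mult.assoc)
  qed
  then obtain u where u: "u \<in> A" "u * lead_coeff H = 1" by blast
  have monic: "Polynomial.smult u H \<in> polys_over A" "lead_coeff (Polynomial.smult u H) = 1" "poly (Polynomial.smult u H) s = 0"
    using u H Hs by (auto intro: smult_mem_polys_over)
  (* The inverse of s - a, from dividing p and q by t - a with remainder. *)
  have inv_root: "\<exists>r\<in>polys_over A. poly r s * (s - const_fract a) = 1" if a: "poly p a = 0 \<or> poly q a = 0" for a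
  proof -
    define p' q' where "p' = synthetic_div p a" and "q' = synthetic_div q a"
    have div: "eval_at r s = (s - const_fract a) * eval_at (synthetic_div r a) s + const_fract (poly r a)" for r
    proof -
      have "eval_at r s = eval_at ([:-a, 1:] * synthetic_div r a + [:poly r a:]) s"
        by (simp only: synthetic_div_correct')
      also have "\<dots> = (s - const_fract a) * eval_at (synthetic_div r a) s + const_fract (poly r a)"
        by (simp only: eval_at_simps) (simp add: const_fract.hom_uminus)
      finally show ?thesis .
    qed
    define e where "e = X * const_fract (poly q a) - const_fract (poly p a)"
    have "(s - const_fract a) * (eval_at p' s - X * eval_at q' s) = e"
      using X div[of p] div[of q] unfolding p'_def q'_def e_def by (simp add: algebra_simps)
    moreover have "\<exists>e'\<in>A. e' * e = 1"
    proof (cases "poly p a = 0")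
      case True
      let ?k = "const_fract (inverse (poly q a))"
      have "inverse X * ?k * e = (inverse X * X) * (?k * const_fract (poly q a))"
        by (simp add: e_def True)
      also have "\<dots> = 1" using pq(4)[OF True] A(5) by (simp add: const_fract.hom_mult[symmetric])
      finally show ?thesis using A(2,4) by (intro bexI[of _ "inverse X * ?k"] mult_mem)
    next
      case False
      then show ?thesis using a A
        by (intro bexI[of _ "- const_fract (inverse (poly p a))"])
          (auto simp: e_def const_fract.hom_mult[symmetric] intro!: uminus_mem)
    qed
    ultimately obtain e' where e': "e' \<in> A" "e' * ((s - const_fract a) * (eval_at p' s - X * eval_at q' s)) = 1"
      by blast
    define r where "r = Polynomial.smult e' (map_poly const_fract p' - Polynomial.smult X (map_poly const_fract q'))"
    have "r \<in> polys_over A" unfolding r_def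
      by (intro smult_mem_polys_over P.diff_mem const_polys e'(1) A(3))
    moreover have "poly r s * (s - const_fract a) = 1"
      using e'(2) by (simp add: r_def eval_at_def mult_ac)
    ultimately show ?thesis by blast
  qed
  have inv_g: "\<exists>r\<in>polys_over A. poly r s * eval_at g s = 1"
    using g
  proof (induction "degree g" arbitrary: g)
    case 0
    then obtain c where "g = [:c:]" "c \<noteq> 0" by (metis degree_eq_zeroE pCons_0_0)
    then show ?case
      by (intro bexI[of _ "[:const_fract (inverse c):]"])
        (simp_all add: const_fract.hom_mult[symmetric] pCons_mem_polys_over zero_mem_polys_over A(2))
  next
    case (Suc d)
    then have "\<not> constant (poly g)" by (simp add: constant_degree)
    then obtain a where a: "poly g a = 0" using fundamental_theorem_of_algebra by blast
    then obtain g' where g': "g = [:- a, 1:] * g'" by (metis dvd_def poly_eq_0_iff_dvd)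
    have "g' \<noteq> 0" using Suc.prems(1) g' by auto
    then have "degree g = degree [:- a, 1:] + degree g'" unfolding g' by (intro degree_mult_eq) auto
    then have "degree g' = d" using Suc.hyps(2) by simp
    then obtain r where r: "r \<in> polys_over A" "poly r s * eval_at g' s = 1"
      using Suc.hyps(1)[of g'] \<open>g' \<noteq> 0\<close> Suc.prems(2) by (auto simp: g')
    obtain r' where r': "r' \<in> polys_over A" "poly r' s * (s - const_fract a) = 1"
      using inv_root Suc.prems(2)[OF a] by blast
    have "eval_at g s = (s - const_fract a) * eval_at g' s"
      unfolding g' by (simp only: eval_at_simps) (simp add: const_fract.hom_uminus)
    then have "poly (r' * r) s * eval_at g s = (poly r' s * (s - const_fract a)) * (poly r s * eval_at g' s)"
      by simp
    then show ?case using r r' by (intro bexI[of _ "r' * r"]) (auto intro: P.mult_mem)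
  qed
  then obtain r where r: "r \<in> polys_over A" "poly r s * eval_at g s = 1" by blast
  have "z = z * eval_at g s * poly r s" using r(2) by (simp add: mult_ac)
  also have "\<dots> = poly (map_poly const_fract f * r) s" by (simp add: z) (simp add: eval_at_def)
  finally show ?thesis
    using integral_over_adjoin[OF A(1) monic, of "map_poly const_fract f * r"] r(1)
    by (auto intro: P.mult_mem const_polys)
qed

text \<open>The places of the projective line are the points \<open>Some a\<close> and the point \<open>None\<close> at infinity.\<close>

definition poly_ord :: "complex option \<Rightarrow> complex poly \<Rightarrow> int" where
  "poly_ord v p = (case v of None \<Rightarrow> - int (degree p) | Some a \<Rightarrow> int (order a p))"

definition ord_at :: "complex option \<Rightarrow> complex poly fract \<Rightarrow> int" where
  "ord_at v u = poly_ord v (fst (quot_of_fract u)) - poly_ord v (snd (quot_of_fract u))"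

lemma poly_ord_mult: "p \<noteq> 0 \<Longrightarrow> q \<noteq> 0 \<Longrightarrow> poly_ord v (p * q) = poly_ord v p + poly_ord v q"
  by (simp add: poly_ord_def order_mult degree_mult_eq split: option.splits)

lemma ord_at_Fract:
  assumes "p \<noteq> 0" "q \<noteq> 0"
  shows "ord_at v (Fract p q) = poly_ord v p - poly_ord v q"
proof -
  define p' q' where "p' = fst (quot_of_fract (Fract p q))" and "q' = snd (quot_of_fract (Fract p q))"
  have "q' \<noteq> 0" by (simp add: q'_def)
  have eq: "Fract p' q' = Fract p q" by (simp add: p'_def q'_def)
  then have "p' * q = p * q'" using \<open>q' \<noteq> 0\<close> assms(2) by (simp add: eq_fract)
  moreover from this have "p' \<noteq> 0" using assms \<open>q' \<noteq> 0\<close> by auto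
  ultimately have "poly_ord v p' + poly_ord v q = poly_ord v p + poly_ord v q'"
    using assms \<open>q' \<noteq> 0\<close> by (metis poly_ord_mult)
  then show ?thesis by (simp add: ord_at_def p'_def[symmetric] q'_def[symmetric])
qed

lemma nonzero_fract_cases:
  assumes "u \<noteq> (0 :: complex poly fract)"
  obtains p q where "u = Fract p q" "p \<noteq> 0" "q \<noteq> 0" "coprime p q"
proof
  show "u = Fract (fst (quot_of_fract u)) (snd (quot_of_fract u))" by simp
  show "fst (quot_of_fract u) \<noteq> 0" "snd (quot_of_fract u) \<noteq> 0" using assms by simp_all
  show "coprime (fst (quot_of_fract u)) (snd (quot_of_fract u))" by (rule coprime_quot_of_fract)
qed

lemma ord_at_mult:
  assumes "u \<noteq> 0" "w \<noteq> 0"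
  shows "ord_at v (u * w) = ord_at v u + ord_at v w"
proof -
  obtain p q where "u = Fract p q" "p \<noteq> 0" "q \<noteq> 0" by (rule nonzero_fract_cases[OF assms(1)])
  moreover obtain r s where "w = Fract r s" "r \<noteq> 0" "s \<noteq> 0" by (rule nonzero_fract_cases[OF assms(2)])
  ultimately show ?thesis by (simp add: ord_at_Fract poly_ord_mult)
qed

lemma ord_at_inverse:
  assumes "u \<noteq> 0"
  shows "ord_at v (inverse u) = - ord_at v u"
proof -
  obtain p q where "u = Fract p q" "p \<noteq> 0" "q \<noteq> 0" by (rule nonzero_fract_cases[OF assms])
  then show ?thesis by (simp add: ord_at_Fract)
qed

lemma ord_at_power_int:
  assumes "u \<noteq> 0"
  shows "ord_at v (u powi n) = n * ord_at v u"
proof -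
  have nat_power: "ord_at v (w ^ k) = int k * ord_at v w" if "w \<noteq> 0" for w k
    using that
    by (induction k) (simp_all add: ord_at_mult ring_distribs ord_at_Fract[of 1 1, folded One_fract_def])
  show ?thesis
    using assms by (cases "n \<ge> 0") (simp_all add: power_int_def nat_power ord_at_inverse del: power_inverse)
qed

lemma eval_at_variable: "eval_at p (Fract [:0, 1:] 1) = Fract p 1"
  by (induction p) (simp_all add: Zero_fract_def const_fract_def)

lemma eval_at_monom: "eval_at (monom c k) s = const_fract c * s ^ k"
  by (simp add: eval_at_def map_poly_monom poly_monom)

lemma eval_at_pcompose: "eval_at (pcompose p q) s = eval_at p (eval_at q s)"
  by (induction p) (simp_all add: pcompose_pCons)

lemma Fract_power: "Fract p q ^ n = Fract (p ^ n) (q ^ n)"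
  by (induction n) (simp_all add: One_fract_def)

text \<open>In terms of \<open>s = 1 / (t - a)\<close>, a polynomial \<open>p\<close> in \<open>t\<close> becomes
  \<open>s ^ (- degree p)\<close> times a polynomial in \<open>s\<close>.\<close>

lemma eval_at_moebius:
  "eval_at (reflect_poly (pcompose p [:a, 1:])) (Fract 1 [:-a, 1:]) = Fract p ([:-a, 1:] ^ degree p)"
proof -
  define r where "r = pcompose p [:a, 1:]"
  define L where "L = [:-a, 1:]"
  have "L \<noteq> 0" by (simp add: L_def)
  have deg: "degree r = degree p" by (simp add: r_def)
  have "map_poly const_fract (reflect_poly r) = reflect_poly (map_poly const_fract r)"
    by (rule poly_eqI) (simp add: coeff_map_poly coeff_reflect_poly)
  then have "eval_at (reflect_poly r) (Fract 1 L) = Fract 1 L ^ degree r * eval_at r (inverse (Fract 1 L))"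
    using poly_reflect_poly_nz[of "Fract 1 L" "map_poly const_fract r"] \<open>L \<noteq> 0\<close>
    by (simp add: eval_at_def Zero_fract_def eq_fract)
  also have "eval_at r (inverse (Fract 1 L)) = eval_at p (Fract [:0, 1:] 1)"
    by (simp add: r_def eval_at_pcompose const_fract_def L_def)
  also have "\<dots> = Fract p 1" by (rule eval_at_variable)
  finally have "eval_at (reflect_poly r) (Fract 1 L) = Fract p (L ^ degree p)"
    by (simp add: Fract_power deg)
  then show ?thesis unfolding r_def L_def .
qed

lemma common_root_not_coprime:
  fixes p q :: "complex poly"
  assumes "coprime p q" "poly p a = 0"
  shows "poly q a \<noteq> 0"
proof
  assume "poly q a = 0"
  then have "[:-a, 1:] dvd p" "[:-a, 1:] dvd q" using assms(2) by (simp_all add: poly_eq_0_iff_dvd)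
  then have "is_unit [:-a, 1:]" using assms(1) coprime_common_divisor by blast
  then show False by (simp add: is_unit_iff_degree)
qed

lemma order_pos_iff_root: "p \<noteq> 0 \<Longrightarrow> 0 < order a p \<longleftrightarrow> poly p a = 0"
  using order_root by (metis gr0I not_gr0)

text \<open>If infinity is a zero or a pole of \<open>X\<close>, then the numerator and denominator of \<open>X\<close> have different
  degrees in \<open>s = t\<close>. Otherwise \<open>Z\<close> has no pole at infinity, so either it is constant or it has a
  finite pole \<open>a\<close>; the parameter \<open>s = 1 / (t - a)\<close> moves \<open>a\<close> to infinity.\<close>

lemma integral_over_if_poles_subset:
  assumes A: "unital_subring A" "\<And>c. const_fract c \<in> A" "X \<in> A" "inverse X \<in> A"
    and nz: "X \<noteq> 0" "Z \<noteq> 0"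
    and poles: "\<And>v. ord_at v Z < 0 \<Longrightarrow> ord_at v X \<noteq> 0"
  shows "integral_over A Z"
proof -
  interpret unital_subring A by fact
  obtain p q where X: "X = Fract p q" "p \<noteq> 0" "q \<noteq> 0" and pq: "coprime p q"
    by (rule nonzero_fract_cases[OF nz(1)])
  obtain f g where Z: "Z = Fract f g" "f \<noteq> 0" "g \<noteq> 0" and fg: "coprime f g"
    by (rule nonzero_fract_cases[OF nz(2)])
  have finite_pole: "poly p a = 0 \<or> poly q a = 0" if "poly g a = 0" for a
  proof -
    have "poly f a \<noteq> 0" using common_root_not_coprime[of g f a] that fg by (simp add: coprime_commute)
    then have "ord_at (Some a) Z < 0"
      using that Z by (simp add: ord_at_Fract poly_ord_def order_0I order_pos_iff_root)
    then have "order a p \<noteq> order a q" using poles[of "Some a"] X by (auto simp: ord_at_Fract poly_ord_def)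
    then show ?thesis using order_0I by metis
  qed
  show ?thesis
  proof (cases "degree p = degree q")
    case False
    show ?thesis
      by (rule integral_over_quotient_at[where s = "Fract [:0, 1:] 1" and f = f,
          OF A nz(1) _ X(2,3) False common_root_not_coprime[OF pq] Z(3) finite_pole])
        (use X Z in \<open>simp_all only: eval_at_variable, simp_all add: eq_fract\<close>)
  next
    case True
    then have "ord_at None X = 0" using X by (simp add: ord_at_Fract poly_ord_def)
    then have "\<not> ord_at None Z < 0" using poles[of None] by blast
    then have deg_fg: "degree f \<le> degree g" using Z by (simp add: ord_at_Fract poly_ord_def)
    show ?thesis
    proof (cases "degree g = 0")
      case True
      then obtain c d where cd: "f = [:c:]" "g = [:d:]" using deg_fg by (metis degree_eq_zeroE le_zero_eq)
      then have "Z = const_fract (c / d)" using Z by (simp add: const_fract_def eq_fract)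
      then show ?thesis using A(2)[of "c / d"] unfolding integral_over_def
        by (intro exI[of _ "[:- Z, 1:]"]) (auto simp: coeff_pCons one_mem zero_mem uminus_mem split: nat.splits)
    next
      case False
      then have "\<not> constant (poly g)" by (simp add: constant_degree)
      then obtain a where a: "poly g a = 0" using fundamental_theorem_of_algebra by blast
      define s where "s = Fract 1 [:-a, 1:]"
      define L where "L = [:-a, 1:]"
      define tr where "tr = (\<lambda>r. reflect_poly (pcompose r [:a, 1:]))"
      have "L \<noteq> 0" by (simp add: L_def)
      have sL: "s = Fract 1 L" unfolding s_def L_def ..
      have tr0: "tr r \<noteq> 0" if "r \<noteq> 0" for r
        using that by (simp add: tr_def pcompose_eq_0_iff)
      have ev: "eval_at (tr r) s = Fract r (L ^ degree r)" for r
        unfolding tr_def s_def L_def by (rule eval_at_moebius)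
      have root0: "poly (tr r) 0 \<noteq> 0" if "r \<noteq> 0" for r
        using tr0[OF that] unfolding tr_def reflect_poly_at_0_eq_0_iff reflect_poly_eq_0_iff .
      have root: "poly (tr r) b = 0 \<longleftrightarrow> poly r (a + inverse b) = 0" if "b \<noteq> 0" for r b
        using that by (simp add: tr_def poly_reflect_poly_nz poly_pcompose add.commute)
      have deg: "degree (tr r) = degree r" if "poly r a \<noteq> 0" for r
        using that by (simp add: tr_def poly_pcompose poly_0_coeff_0[symmetric])
      have deg_less: "degree (tr r) < degree r" if "poly r a = 0" "r \<noteq> 0" for r
      proof -
        have "coeff (tr r) (degree r) = poly r a"
          by (simp add: tr_def coeff_reflect_poly poly_0_coeff_0[symmetric] poly_pcompose)
        then have "degree (tr r) \<noteq> degree r" using that tr0[of r] by (metis leading_coeff_0_iff)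
        moreover have "degree (tr r) \<le> degree r"
          using degree_reflect_poly_le[of "pcompose r [:a, 1:]"] by (simp add: tr_def)
        ultimately show ?thesis by simp
      qed
      have "degree (tr p) \<noteq> degree (tr q)"
      proof (cases "poly p a = 0")
        case p: True
        then show ?thesis
          using deg[of q] deg_less[of p] common_root_not_coprime[OF pq p] True X(2) by simp
      next
        case p: False
        then show ?thesis using deg[of p] deg_less[of q] finite_pole[OF a] True X(3) by simp
      qed
      show ?thesis
      proof (rule integral_over_quotient_at[OF A nz(1) _ tr0[OF X(2)] tr0[OF X(3)]])
        show "degree (tr p) \<noteq> degree (tr q)" by fact
        show "X * eval_at (tr q) s = eval_at (tr p) s"
          using X True \<open>L \<noteq> 0\<close> by (simp add: ev eq_fract)
        show "Z * eval_at (tr g) s = eval_at (tr f * monom 1 (degree g - degree f)) s"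
        proof -
          have "L ^ degree g = L ^ degree f * L ^ (degree g - degree f)"
            using deg_fg by (simp add: power_add[symmetric])
          then show ?thesis
            using Z \<open>L \<noteq> 0\<close>
            by (simp only: eval_at_simps ev eval_at_monom) (simp add: sL Fract_power eq_fract)
        qed
        show "tr g \<noteq> 0" using tr0 Z by blast
        show "poly (tr q) b \<noteq> 0" if "poly (tr p) b = 0" for b
          using that root0[OF X(2)] root[of b] common_root_not_coprime[OF pq] by (cases "b = 0") auto
        show "poly (tr p) b = 0 \<or> poly (tr q) b = 0" if "poly (tr g) b = 0" for b
          using that root0[OF Z(3)] root[of b] finite_pole by (cases "b = 0") auto
      qed
    qed
  qed
qed

section \<open>Exponents of bivariate polynomials\<close>

interpretation eval_at: comm_ring_hom "\<lambda>p. eval_at p s" for s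
  by unfold_locales simp_all

interpretation map_eval_at: map_poly_comm_ring_hom "\<lambda>p. eval_at p s" for s ..

lemma subst_xy_eval_at: "subst_xy f x y = poly (map_poly (\<lambda>p. eval_at p x) f) y"
  by (simp add: subst_xy_def eval_at_def)

lemma subst_xy_simps [simp]:
  "subst_xy 0 x y = 0" "subst_xy 1 x y = 1"
  "subst_xy (pCons p f) x y = eval_at p x + y * subst_xy f x y"
  "subst_xy (f + g) x y = subst_xy f x y + subst_xy g x y"
  "subst_xy (f * g) x y = subst_xy f x y * subst_xy g x y"
  by (simp_all add: subst_xy_eval_at Polynomial.map_poly_pCons map_eval_at.hom_add map_eval_at.hom_mult)

definition bimonom :: "nat \<Rightarrow> nat \<Rightarrow> complex poly poly" where
  "bimonom i j = monom (monom 1 i) j"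

definition exponents :: "complex poly poly \<Rightarrow> (nat \<times> nat) set" where
  "exponents f = {(i, j). coeff (coeff f j) i \<noteq> 0}"

lemma subst_xy_bimonom [simp]: "subst_xy (bimonom i j) x y = x ^ i * y ^ j"
  by (simp add: subst_xy_eval_at bimonom_def map_poly_monom poly_monom eval_at_monom)

lemma exponents_bimonom [simp]: "exponents (bimonom i j) = {(i, j)}"
  by (auto simp: exponents_def bimonom_def split: if_splits)

lemma exponents_1 [simp]: "exponents 1 = {(0, 0)}"
  by (auto simp: exponents_def coeff_1 split: if_splits)

lemma exponents_eq_empty_iff [simp]: "exponents f = {} \<longleftrightarrow> f = 0"
  by (auto simp: exponents_def poly_eq_iff)

lemma exponents_add: "exponents (f + g) \<subseteq> exponents f \<union> exponents g"
  by (auto simp: exponents_def)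

lemma finite_exponents: "finite (exponents f)"
proof (rule finite_subset)
  show "exponents f \<subseteq> (\<Union>j\<le>degree f. (\<lambda>i. (i, j)) ` {..degree (coeff f j)})"
  proof
    fix z assume "z \<in> exponents f"
    then obtain i j where z: "z = (i, j)" "coeff (coeff f j) i \<noteq> 0" by (auto simp: exponents_def)
    then have "j \<le> degree f" by (intro le_degree) auto
    then show "z \<in> (\<Union>j\<le>degree f. (\<lambda>i. (i, j)) ` {..degree (coeff f j)})"
      using z le_degree[OF z(2)] by auto
  qed
qed simp

lemma coeff_coeff_mult:
  "coeff (coeff (f * g) j) i = (\<Sum>b\<le>j. \<Sum>a\<le>i. coeff (coeff f b) a * coeff (coeff g (j - b)) (i - a))"
  by (simp add: coeff_mult coeff_sum)

lemma exponents_mult: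
  assumes "s \<in> exponents (f * g)"
  shows "\<exists>p\<in>exponents f. \<exists>q\<in>exponents g. s = (fst p + fst q, snd p + snd q)"
proof -
  obtain i j where s: "s = (i, j)" "coeff (coeff (f * g) j) i \<noteq> 0" using assms by (auto simp: exponents_def)
  obtain b where b: "b \<le> j" "(\<Sum>a\<le>i. coeff (coeff f b) a * coeff (coeff g (j - b)) (i - a)) \<noteq> 0"
    using s(2) unfolding coeff_coeff_mult by (meson atMost_iff sum.neutral)
  obtain a where a: "a \<le> i" "coeff (coeff f b) a * coeff (coeff g (j - b)) (i - a) \<noteq> 0"
    using b(2) by (meson atMost_iff sum.neutral)
  then show ?thesis using s(1) b(1)
    by (intro bexI[of _ "(a, b)"] bexI[of _ "(i - a, j - b)"]) (auto simp: exponents_def)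
qed

text \<open>There is no cancellation at an exponent that decomposes in only one way.\<close>

lemma unique_sum_mem_exponents_mult:
  assumes pq: "(a, b) \<in> exponents f" "(c, d) \<in> exponents g"
    and uniq: "\<And>a' b' c' d'. \<lbrakk>(a', b') \<in> exponents f; (c', d') \<in> exponents g; a' + c' = a + c; b' + d' = b + d\<rbrakk>
      \<Longrightarrow> (a', b') = (a, b)"
  shows "(a + c, b + d) \<in> exponents (f * g)"
proof -
  let ?t = "\<lambda>v u. coeff (coeff f v) u * coeff (coeff g (b + d - v)) (a + c - u)"
  have zero: "?t v u = 0" if vu: "v \<le> b + d" "u \<le> a + c" "(u, v) \<noteq> (a, b)" for u v
  proof (rule ccontr)
    assume "?t v u \<noteq> 0"
    then have "(u, v) \<in> exponents f" "(a + c - u, b + d - v) \<in> exponents g" by (auto simp: exponents_def)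
    from uniq[OF this] vu show False by auto
  qed
  have "coeff (coeff (f * g) (b + d)) (a + c) = (\<Sum>v\<le>b+d. \<Sum>u\<le>a+c. ?t v u)"
    by (rule coeff_coeff_mult)
  also have "\<dots> = (\<Sum>v\<in>{b}. \<Sum>u\<le>a+c. ?t v u)"
    by (rule sum.mono_neutral_right) (auto intro!: sum.neutral zero)
  also have "\<dots> = (\<Sum>u\<le>a+c. ?t b u)" by simp
  also have "\<dots> = (\<Sum>u\<in>{a}. ?t b u)"
    by (rule sum.mono_neutral_right) (use zero[of b] in auto)
  also have "\<dots> \<noteq> 0" using pq by (simp add: exponents_def)
  finally show ?thesis by (simp add: exponents_def)
qed

definition weight :: "int \<Rightarrow> int \<Rightarrow> nat \<times> nat \<Rightarrow> int" where
  "weight w1 w2 s = w1 * int (fst s) + w2 * int (snd s)"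

definition initial_exponents :: "int \<Rightarrow> int \<Rightarrow> complex poly poly \<Rightarrow> (nat \<times> nat) set" where
  "initial_exponents w1 w2 f = {p \<in> exponents f. \<forall>q\<in>exponents f. weight w1 w2 p \<le> weight w1 w2 q}"

lemma initial_exponents_nonempty:
  assumes "f \<noteq> 0"
  shows "initial_exponents w1 w2 f \<noteq> {}"
proof -
  have "finite (exponents f)" "exponents f \<noteq> {}" using assms finite_exponents by auto
  then have "arg_min_on (weight w1 w2) (exponents f) \<in> initial_exponents w1 w2 f"
    unfolding initial_exponents_def by (simp add: arg_min_if_finite(1) arg_min_least)
  then show ?thesis by blast
qed

lemma weight_pair_injective:
  assumes "(w1, w2) \<noteq> (0, 0)" "weight w1 w2 p = weight w1 w2 q" "weight (- w2) w1 p = weight (- w2) w1 q"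
  shows "p = q"
proof -
  define a b where "a = int (fst p) - int (fst q)" and "b = int (snd p) - int (snd q)"
  have e: "w1 * a + w2 * b = 0" "w1 * b - w2 * a = 0"
    using assms(2,3) by (simp_all add: weight_def a_def b_def algebra_simps)
  have "w1 * (w1 * a + w2 * b) - w2 * (w1 * b - w2 * a) = (w1\<^sup>2 + w2\<^sup>2) * a"
    "w2 * (w1 * a + w2 * b) + w1 * (w1 * b - w2 * a) = (w1\<^sup>2 + w2\<^sup>2) * b"
    by (simp_all add: algebra_simps power2_eq_square)
  moreover have "w1\<^sup>2 + w2\<^sup>2 \<noteq> 0" using assms(1) by (simp add: sum_power2_eq_zero_iff)
  ultimately have "a = 0" "b = 0" unfolding e by auto
  then show ?thesis by (simp add: a_def b_def prod_eq_iff)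
qed

text \<open>Among the exponents of minimal weight, \<open>p\<close> and \<open>q\<close> are extreme in the orthogonal direction; the
  sign \<open>e\<close> selects one of the two ends.\<close>

lemma corner_of_initial_exponents_mult:
  assumes w: "(w1, w2) \<noteq> (0, 0)" and e: "e = 1 \<or> e = - 1"
    and p: "p \<in> initial_exponents w1 w2 f"
      "\<And>p'. p' \<in> initial_exponents w1 w2 f \<Longrightarrow> e * weight (- w2) w1 p \<le> e * weight (- w2) w1 p'"
    and q: "q \<in> initial_exponents w1 w2 g"
      "\<And>q'. q' \<in> initial_exponents w1 w2 g \<Longrightarrow> e * weight (- w2) w1 q \<le> e * weight (- w2) w1 q'"
  shows "(fst p + fst q, snd p + snd q) \<in> exponents (f * g)"
proof (rule unique_sum_mem_exponents_mult)
  show "(fst p, snd p) \<in> exponents f" "(fst q, snd q) \<in> exponents g"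
    using p q by (simp_all add: initial_exponents_def)
  fix a b c d
  assume ab: "(a, b) \<in> exponents f" and cd: "(c, d) \<in> exponents g"
    and sum: "a + c = fst p + fst q" "b + d = snd p + snd q"
  have add: "weight u v (a, b) + weight u v (c, d) = weight u v p + weight u v q" for u v
    using arg_cong[OF sum(1), of "\<lambda>n. u * int n"] arg_cong[OF sum(2), of "\<lambda>n. v * int n"]
    by (simp add: weight_def algebra_simps)
  have "weight w1 w2 p \<le> weight w1 w2 (a, b)" "weight w1 w2 q \<le> weight w1 w2 (c, d)"
    using p(1) q(1) ab cd by (simp_all add: initial_exponents_def)
  then have eq: "weight w1 w2 (a, b) = weight w1 w2 p" "weight w1 w2 (c, d) = weight w1 w2 q"
    using add[of w1 w2] by linarith+
  have "(a, b) \<in> initial_exponents w1 w2 f" "(c, d) \<in> initial_exponents w1 w2 g"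
    using p(1) q(1) ab cd eq by (auto simp: initial_exponents_def)
  then have "e * weight (- w2) w1 p \<le> e * weight (- w2) w1 (a, b)"
    "e * weight (- w2) w1 q \<le> e * weight (- w2) w1 (c, d)"
    using p(2) q(2) by blast+
  then have "weight (- w2) w1 (a, b) = weight (- w2) w1 p"
    using add[of "- w2" w1] e by auto
  then show "(a, b) = (fst p, snd p)" using weight_pair_injective[OF w eq(1)] by simp
qed

text \<open>The two ends of the initial exponents of \<open>f\<close>, added to the corresponding ends for
  \<open>g\<close>, are two different exponents of the product.\<close>

lemma initial_exponents_mult_tie:
  assumes w: "(w1, w2) \<noteq> (0, 0)" and g: "g \<noteq> 0"
    and p: "p \<in> initial_exponents w1 w2 f" "p' \<in> initial_exponents w1 w2 f" "p \<noteq> p'"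
  shows "\<exists>s\<in>exponents (f * g). \<exists>s'\<in>exponents (f * g). s \<noteq> s' \<and> weight w1 w2 s = weight w1 w2 s' \<and>
    (\<forall>t\<in>exponents (f * g). weight w1 w2 s \<le> weight w1 w2 t)"
proof -
  let ?F = "initial_exponents w1 w2 f" and ?G = "initial_exponents w1 w2 g"
  let ?u = "weight (- w2) w1"
  have fin: "finite ?F" "finite ?G"
    by (auto intro: finite_subset[OF _ finite_exponents] simp: initial_exponents_def)
  have ne: "?F \<noteq> {}" "?G \<noteq> {}" using p(1) initial_exponents_nonempty[OF g] by blast+
  have ext: "\<exists>z\<in>I. \<forall>z'\<in>I. e * ?u z \<le> e * ?u z'" if "finite I" "I \<noteq> {}" for e :: int and I
    using arg_min_if_finite(1)[OF that, of "\<lambda>z. e * ?u z"] arg_min_least[OF that, of _ "\<lambda>z. e * ?u z"] by blast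
  obtain p1 where p1: "p1 \<in> ?F" "\<forall>z\<in>?F. 1 * ?u p1 \<le> 1 * ?u z" using ext[OF fin(1) ne(1)] by blast
  obtain p2 where p2: "p2 \<in> ?F" "\<forall>z\<in>?F. - 1 * ?u p2 \<le> - 1 * ?u z" using ext[OF fin(1) ne(1)] by blast
  obtain q1 where q1: "q1 \<in> ?G" "\<forall>z\<in>?G. 1 * ?u q1 \<le> 1 * ?u z" using ext[OF fin(2) ne(2)] by blast
  obtain q2 where q2: "q2 \<in> ?G" "\<forall>z\<in>?G. - 1 * ?u q2 \<le> - 1 * ?u z" using ext[OF fin(2) ne(2)] by blast
  define s1 s2 where "s1 = (fst p1 + fst q1, snd p1 + snd q1)" and "s2 = (fst p2 + fst q2, snd p2 + snd q2)"
  have "s1 \<in> exponents (f * g)" unfolding s1_def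
    by (rule corner_of_initial_exponents_mult[OF w, of 1]) (use p1 q1 in auto)
  moreover have "s2 \<in> exponents (f * g)" unfolding s2_def
    by (rule corner_of_initial_exponents_mult[OF w, of "- 1"]) (use p2 q2 in auto)
  moreover have w_eq: "weight w1 w2 p1 = weight w1 w2 p2" "weight w1 w2 q1 = weight w1 w2 q2"
    using p1(1) p2(1) q1(1) q2(1) by (auto simp: initial_exponents_def intro: antisym)
  then have "weight w1 w2 s1 = weight w1 w2 s2" by (simp add: s1_def s2_def weight_def algebra_simps)
  moreover have "s1 \<noteq> s2"
  proof -
    have "weight w1 w2 p = weight w1 w2 p'" using p(1,2) by (auto simp: initial_exponents_def intro: antisym)
    then have "?u p \<noteq> ?u p'" using weight_pair_injective[OF w] p(3) by blast
    moreover have "?u p1 \<le> ?u p" "?u p1 \<le> ?u p'" "?u p \<le> ?u p2" "?u p' \<le> ?u p2" "?u q1 \<le> ?u q2"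
      using p p1 p2 q1 q2 by auto
    ultimately have "?u p1 + ?u q1 < ?u p2 + ?u q2" by linarith
    then have "?u s1 < ?u s2" by (simp add: s1_def s2_def weight_def algebra_simps)
    then show ?thesis by auto
  qed
  moreover have "weight w1 w2 s1 \<le> weight w1 w2 t" if t: "t \<in> exponents (f * g)" for t
  proof -
    obtain a b where ab: "a \<in> exponents f" "b \<in> exponents g" "t = (fst a + fst b, snd a + snd b)"
      using exponents_mult[OF t] by blast
    have "weight w1 w2 p1 \<le> weight w1 w2 a" "weight w1 w2 q1 \<le> weight w1 w2 b"
      using p1(1) q1(1) ab by (auto simp: initial_exponents_def)
    then show ?thesis by (simp add: ab(3) s1_def weight_def algebra_simps)
  qed
  ultimately show ?thesis by blast
qed

section \<open>Places in the directions of ties\<close>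

text \<open>Values of Laurent polynomials all of whose exponents have weight at least \<open>d\<close>, written as a
  polynomial divided by a power of \<open>x * y\<close>.\<close>

definition laurent_values ::
  "complex poly fract \<Rightarrow> complex poly fract \<Rightarrow> int \<Rightarrow> int \<Rightarrow> int \<Rightarrow> complex poly fract set" where
  "laurent_values x y w1 w2 d = {u. \<exists>f m. u * (x * y) ^ m = subst_xy f x y \<and>
     (\<forall>s\<in>exponents f. d + weight w1 w2 (m, m) \<le> weight w1 w2 s)}"

lemma weight_add:
  "weight w1 w2 (fst p + fst q, snd p + snd q) = weight w1 w2 p + weight w1 w2 q"
  "weight w1 w2 (m + n, m + n) = weight w1 w2 (m, m) + weight w1 w2 (n, n)"
  by (simp_all add: weight_def algebra_simps)

lemma laurent_values_mult:
  assumes "u \<in> laurent_values x y w1 w2 d" "v \<in> laurent_values x y w1 w2 e"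
  shows "u * v \<in> laurent_values x y w1 w2 (d + e)"
proof -
  obtain f m where f: "u * (x * y) ^ m = subst_xy f x y"
    "\<forall>s\<in>exponents f. d + weight w1 w2 (m, m) \<le> weight w1 w2 s"
    using assms(1) unfolding laurent_values_def by blast
  obtain g n where g: "v * (x * y) ^ n = subst_xy g x y"
    "\<forall>s\<in>exponents g. e + weight w1 w2 (n, n) \<le> weight w1 w2 s"
    using assms(2) unfolding laurent_values_def by blast
  have "u * v * (x * y) ^ (m + n) = subst_xy (f * g) x y"
    unfolding subst_xy_simps f(1)[symmetric] g(1)[symmetric] power_add by (simp only: mult_ac)
  moreover have "d + e + weight w1 w2 (m + n, m + n) \<le> weight w1 w2 s" if s: "s \<in> exponents (f * g)" for s
  proof -
    obtain a b where ab: "a \<in> exponents f" "b \<in> exponents g" "s = (fst a + fst b, snd a + snd b)"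
      using exponents_mult[OF s] by blast
    have "d + weight w1 w2 (m, m) \<le> weight w1 w2 a" "e + weight w1 w2 (n, n) \<le> weight w1 w2 b"
      using f(2) g(2) ab by blast+
    then show ?thesis unfolding ab(3) weight_add by linarith
  qed
  ultimately show ?thesis unfolding laurent_values_def by blast
qed

lemma laurent_values_add:
  assumes "u \<in> laurent_values x y w1 w2 d" "v \<in> laurent_values x y w1 w2 d"
  shows "u + v \<in> laurent_values x y w1 w2 d"
proof -
  obtain f m where f: "u * (x * y) ^ m = subst_xy f x y"
    "\<forall>s\<in>exponents f. d + weight w1 w2 (m, m) \<le> weight w1 w2 s"
    using assms(1) unfolding laurent_values_def by blast
  obtain g n where g: "v * (x * y) ^ n = subst_xy g x y"
    "\<forall>s\<in>exponents g. d + weight w1 w2 (n, n) \<le> weight w1 w2 s"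
    using assms(2) unfolding laurent_values_def by blast
  define h where "h = f * bimonom n n + g * bimonom m m"
  have "subst_xy h x y = subst_xy f x y * (x * y) ^ n + subst_xy g x y * (x * y) ^ m"
    by (simp add: h_def power_mult_distrib)
  then have "subst_xy h x y = u * (x * y) ^ m * (x * y) ^ n + v * (x * y) ^ n * (x * y) ^ m"
    by (simp only: f(1) g(1))
  then have "(u + v) * (x * y) ^ (m + n) = subst_xy h x y"
    by (simp add: power_add algebra_simps)
  moreover have "d + weight w1 w2 (m + n, m + n) \<le> weight w1 w2 s" if s: "s \<in> exponents h" for s
  proof -
    have "s \<in> exponents (f * bimonom n n) \<or> s \<in> exponents (g * bimonom m m)"
      using s by (auto simp: exponents_def h_def)
    then show ?thesis
    proof
      assume "s \<in> exponents (f * bimonom n n)"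
      then obtain a where a: "a \<in> exponents f" "s = (fst a + fst (n, n), snd a + snd (n, n))"
        using exponents_mult[of s f "bimonom n n"] by auto
      have "d + weight w1 w2 (m, m) \<le> weight w1 w2 a" using f(2) a(1) by blast
      then show ?thesis unfolding a(2) weight_add by linarith
    next
      assume "s \<in> exponents (g * bimonom m m)"
      then obtain a where a: "a \<in> exponents g" "s = (fst a + fst (m, m), snd a + snd (m, m))"
        using exponents_mult[of s g "bimonom m m"] by auto
      have "d + weight w1 w2 (n, n) \<le> weight w1 w2 a" using g(2) a(1) by blast
      then show ?thesis unfolding a(2) weight_add by linarith
    qed
  qed
  ultimately show ?thesis unfolding laurent_values_def by blast
qed

lemma laurent_values_const: "const_fract c \<in> laurent_values x y w1 w2 0"
proof -
  have "exponents [:[:c:]:] \<subseteq> {(0, 0)}" by (auto simp: exponents_def coeff_pCons' split: if_splits)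
  then show ?thesis unfolding laurent_values_def
    by (intro CollectI exI[of _ "[:[:c:]:]"] exI[of _ 0]) (auto simp: weight_def)
qed

lemma laurent_values_monomial:
  assumes "x \<noteq> 0" "y \<noteq> 0"
  shows "x powi a * y powi b \<in> laurent_values x y w1 w2 (w1 * a + w2 * b)"
proof -
  define m where "m = nat \<bar>a\<bar> + nat \<bar>b\<bar>"
  define i j where "i = nat (a + int m)" and "j = nat (b + int m)"
  have ij: "int i = a + int m" "int j = b + int m" by (auto simp: i_def j_def m_def)
  have "x powi a * y powi b * (x * y) ^ m = (x powi a * x powi int m) * (y powi b * y powi int m)"
    by (simp add: power_mult_distrib)
  also have "\<dots> = x powi int i * y powi int j"
    using assms by (simp add: ij power_int_add)
  also have "\<dots> = x ^ i * y ^ j" by (simp only: power_int_of_nat)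
  finally show ?thesis unfolding laurent_values_def
    by (intro CollectI exI[of _ "bimonom i j"] exI[of _ m]) (simp add: weight_def ij algebra_simps)
qed

lemma laurent_values_mono: "d \<le> e \<Longrightarrow> laurent_values x y w1 w2 e \<subseteq> laurent_values x y w1 w2 d"
  unfolding laurent_values_def by fastforce

lemma unital_subring_laurent_values: "unital_subring (laurent_values x y w1 w2 0)"
proof
  show "1 \<in> laurent_values x y w1 w2 0" using laurent_values_const[of 1] by simp
  show mult: "u * v \<in> laurent_values x y w1 w2 0"
    if "u \<in> laurent_values x y w1 w2 0" "v \<in> laurent_values x y w1 w2 0" for u v
    using laurent_values_mult[OF that] by simp
  show "u - v \<in> laurent_values x y w1 w2 0"
    if uv: "u \<in> laurent_values x y w1 w2 0" "v \<in> laurent_values x y w1 w2 0" for u v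
  proof -
    have "const_fract (- 1) * v \<in> laurent_values x y w1 w2 0" by (rule mult[OF laurent_values_const uv(2)])
    from laurent_values_add[OF uv(1) this] show ?thesis by (simp add: const_fract.hom_uminus)
  qed
qed

text \<open>The integral equation of \<open>1 / Y\<close>, multiplied by a power of \<open>Y\<close>, has one term \<open>1\<close>, and all its
  other terms have positive weight.\<close>

lemma relation_with_unique_initial_exponent:
  assumes xy: "x \<noteq> 0" "y \<noteq> 0" and w: "(w1, w2) \<noteq> (0, 0)"
    and no_place: "\<And>v l :: real. l > 0 \<Longrightarrow>
      \<not> (of_int w1 = l * of_int (ord_at v x) \<and> of_int w2 = l * of_int (ord_at v y))"
  shows "\<exists>F m. subst_xy F x y = 0 \<and> (m, m) \<in> exponents F \<and>
    (\<forall>s\<in>exponents F. s \<noteq> (m, m) \<longrightarrow> weight w1 w2 (m, m) < weight w1 w2 s)"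
proof -
  let ?L = "laurent_values x y w1 w2"
  define X where "X = x powi w2 * y powi (- w1)"
  define Y where "Y = x powi w1 * y powi w2"
  define k where "k = w1 * w1 + w2 * w2"
  have kpos: "k > 0" using w unfolding k_def sum_squares_gt_zero_iff by auto
  have nz: "X \<noteq> 0" "Y \<noteq> 0" using xy by (simp_all add: X_def Y_def)
  have X0: "X \<in> ?L 0" using laurent_values_monomial[OF xy, of w2 "- w1" w1 w2] by (simp add: X_def mult.commute)
  have iX: "inverse X = x powi (- w2) * y powi w1"
    by (simp add: X_def power_int_minus)
  have iX0: "inverse X \<in> ?L 0"
    unfolding iX using laurent_values_monomial[OF xy, of "- w2" w1 w1 w2] by (simp add: mult.commute)
  have Yk: "Y \<in> ?L k" unfolding Y_def k_def by (rule laurent_values_monomial[OF xy])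
  have Ypow: "Y ^ n \<in> ?L (int n * k)" for n
    by (induction n) (use laurent_values_const[of 1] laurent_values_mult[OF Yk] in \<open>auto simp: ring_distribs\<close>)
  have "integral_over (?L 0) (inverse Y)"
  proof (rule integral_over_if_poles_subset[OF unital_subring_laurent_values laurent_values_const X0 iX0 nz(1)])
    show "inverse Y \<noteq> 0" using nz(2) by simp
    fix v assume neg: "ord_at v (inverse Y) < 0"
    define a b where "a = ord_at v x" and "b = ord_at v y"
    show "ord_at v X \<noteq> 0"
    proof
      assume "ord_at v X = 0"
      then have X: "w2 * a = w1 * b"
        using xy by (simp add: X_def ord_at_mult ord_at_power_int a_def b_def)
      define S where "S = w1 * a + w2 * b"
      have S: "0 < S"
        using neg nz(2) xy by (simp add: ord_at_inverse Y_def ord_at_mult ord_at_power_int a_def b_def S_def)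
      have "w1 * (w2 * b) = w2 * (w2 * a)" "w2 * (w1 * a) = w1 * (w1 * b)"
        using arg_cong[OF X, of "\<lambda>t. w2 * t"] arg_cong[OF X, of "\<lambda>t. w1 * t"] by (simp_all only: mult_ac)
      then have "k * a = w1 * S" "k * b = w2 * S"
        unfolding k_def S_def ring_distribs by (simp_all only: mult_ac add_ac)
      then have "real_of_int k * real_of_int a = real_of_int w1 * real_of_int S"
        "real_of_int k * real_of_int b = real_of_int w2 * real_of_int S"
        by (simp_all only: of_int_mult[symmetric])
      moreover have "real_of_int S \<noteq> 0" using S by simp
      ultimately have "real_of_int w1 = real_of_int k / real_of_int S * real_of_int a"
        "real_of_int w2 = real_of_int k / real_of_int S * real_of_int b"
        by (simp_all add: nonzero_eq_divide_eq)
      moreover have "real_of_int k / real_of_int S > 0" using kpos S by simp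
      ultimately show False using no_place[of "real_of_int k / real_of_int S" v] by (simp add: a_def b_def)
    qed
  qed
  then obtain h where h: "lead_coeff h = 1" "\<And>i. coeff h i \<in> ?L 0" "poly h (inverse Y) = 0"
    unfolding integral_over_def by blast
  define n where "n = degree h"
  interpret unital_subring "?L 0" by (rule unital_subring_laurent_values)
  have "0 = (\<Sum>i\<le>n. coeff h i * inverse Y ^ i) * Y ^ n" using h(3) by (simp add: poly_altdef n_def)
  also have "\<dots> = (\<Sum>i\<le>n. coeff h i * Y ^ (n - i))"
    unfolding sum_distrib_right
  proof (rule sum.cong)
    fix i assume "i \<in> {..n}"
    then have "Y ^ n = Y ^ i * Y ^ (n - i)" by (simp add: power_add[symmetric])
    then show "coeff h i * inverse Y ^ i * Y ^ n = coeff h i * Y ^ (n - i)"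
      using nz(2) by (simp add: field_simps)
  qed simp
  also have "\<dots> = (\<Sum>i<n. coeff h i * Y ^ (n - i)) + 1"
    using h(1) by (simp add: lessThan_Suc_atMost[symmetric] n_def)
  finally have rel: "- 1 = (\<Sum>i<n. coeff h i * Y ^ (n - i))"
    by (simp add: eq_neg_iff_add_eq_0[symmetric])
  have zero1: "0 \<in> ?L 1"
    unfolding laurent_values_def
    by (rule CollectI, rule exI[of _ 0], rule exI[of _ 0]) (auto simp: exponents_def)
  have sum_in: "(\<Sum>i\<in>I. coeff h i * Y ^ (n - i)) \<in> ?L 1" if "I \<subseteq> {..<n}" for I
    using finite_subset[OF that finite_lessThan] that
  proof (induction I)
    case (insert i I)
    have "coeff h i * Y ^ (n - i) \<in> ?L (0 + int (n - i) * k)"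
      by (rule laurent_values_mult[OF h(2) Ypow])
    moreover have "1 * 1 \<le> int (n - i) * k"
      using insert.prems kpos by (intro mult_mono) auto
    then have "1 \<le> 0 + int (n - i) * k" by (simp only: mult_1_left add_0_left)
    ultimately have "coeff h i * Y ^ (n - i) \<in> ?L 1" using laurent_values_mono by blast
    then show ?case using insert by (simp add: laurent_values_add)
  qed (simp add: zero1)
  have "- 1 \<in> ?L 1" by (subst rel) (rule sum_in, simp)
  then obtain f m where f: "- 1 * (x * y) ^ m = subst_xy f x y"
    "\<forall>s\<in>exponents f. 1 + weight w1 w2 (m, m) \<le> weight w1 w2 s"
    unfolding laurent_values_def by blast
  define F where "F = f + bimonom m m"
  have "(m, m) \<notin> exponents f" using f(2)[rule_format, of "(m, m)"] by auto
  moreover have "coeff (coeff (bimonom m m) m) m = 1" by (simp add: bimonom_def)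
  ultimately have "(m, m) \<in> exponents F" by (simp add: exponents_def F_def)
  moreover have "exponents F \<subseteq> insert (m, m) (exponents f)"
    using exponents_add[of f "bimonom m m"] by (simp add: F_def)
  moreover have "subst_xy F x y = subst_xy f x y + (x * y) ^ m" by (simp add: F_def power_mult_distrib)
  then have "subst_xy F x y = 0" by (simp only: f(1)[symmetric]) simp
  moreover have "weight w1 w2 (m, m) < weight w1 w2 s" if "s \<in> exponents f" for s
    using f(2)[rule_format, OF that] by simp
  ultimately have "subst_xy F x y = 0 \<and> (m, m) \<in> exponents F \<and>
    (\<forall>s\<in>exponents F. s \<noteq> (m, m) \<longrightarrow> weight w1 w2 (m, m) < weight w1 w2 s)"
    by blast
  then show ?thesis by metis
qed

lemma implicit_equation_iff: "implicit_equation \<phi> x y \<Longrightarrow> subst_xy f x y = 0 \<longleftrightarrow> \<phi> dvd f"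
  by (auto simp: implicit_equation_def)

text \<open>Otherwise the implicit equation would divide a relation with a unique initial exponent, while a
  multiple of a polynomial with two initial exponents has at least two.\<close>

theorem place_in_direction_of_tie:
  assumes \<phi>: "implicit_equation \<phi> x y" and xy: "x \<noteq> 0" "y \<noteq> 0" and w: "(w1, w2) \<noteq> (0, 0)"
    and p: "p \<in> initial_exponents w1 w2 \<phi>" "p' \<in> initial_exponents w1 w2 \<phi>" "p \<noteq> p'"
  shows "\<exists>v l. (l::real) > 0 \<and> of_int w1 = l * of_int (ord_at v x) \<and> of_int w2 = l * of_int (ord_at v y)"
proof (rule ccontr)
  assume "\<not> ?thesis"
  then obtain F m where F: "subst_xy F x y = 0" "(m, m) \<in> exponents F"
    "\<forall>s\<in>exponents F. s \<noteq> (m, m) \<longrightarrow> weight w1 w2 (m, m) < weight w1 w2 s"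
    using relation_with_unique_initial_exponent[OF xy w] by blast
  then obtain g where g: "F = \<phi> * g" using implicit_equation_iff[OF \<phi>] by (auto elim: dvdE)
  have "g \<noteq> 0" using F(2) g by (auto simp: exponents_def)
  from initial_exponents_mult_tie[OF w this p, folded g]
  obtain s s' where s: "s \<in> exponents F" "s' \<in> exponents F" "s \<noteq> s'" "weight w1 w2 s = weight w1 w2 s'"
    "\<forall>t\<in>exponents F. weight w1 w2 s \<le> weight w1 w2 t" by blast
  have "weight w1 w2 s \<le> weight w1 w2 (m, m)" using s(5) F(2) by blast
  moreover from this have "weight w1 w2 s' \<le> weight w1 w2 (m, m)" using s(4) by simp
  ultimately have "s = (m, m)" "s' = (m, m)" using F(3) s(1,2) by force+
  then show False using s(3) by simp
qed

lemma abs_poly_ord_le: "p \<noteq> 0 \<Longrightarrow> \<bar>poly_ord v p\<bar> \<le> int (degree p)"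
  using order_degree by (auto simp: poly_ord_def split: option.splits)

text \<open>The orders of \<open>y\<close> are bounded, so a steep direction in the first quadrant is not a multiple of
  any place vector. It provides a nontrivial relation between \<open>x\<close> and \<open>y\<close>.\<close>

lemma implicit_equation_nonzero:
  assumes \<phi>: "implicit_equation \<phi> x y" and xy: "x \<noteq> 0" "y \<noteq> 0"
  shows "\<phi> \<noteq> 0"
proof -
  obtain p q where y: "y = Fract p q" "p \<noteq> 0" "q \<noteq> 0" by (rule nonzero_fract_cases[OF xy(2)])
  \<comment> \<open>\<open>N\<close> exceeds the order of \<open>y\<close> at every place.\<close>
  define N where "N = int (degree p) + int (degree q) + 1"
  have "\<not> (of_int 1 = l * of_int (ord_at v x) \<and> of_int N = l * of_int (ord_at v y))" if "l > 0" for v and l :: real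
  proof
    assume l: "of_int 1 = l * of_int (ord_at v x) \<and> of_int N = l * of_int (ord_at v y)"
    then have "0 < l * real_of_int (ord_at v x)" by simp
    then have "1 \<le> ord_at v x" using that by (simp add: zero_less_mult_iff)
    then have "l * 1 \<le> l * real_of_int (ord_at v x)" using that by (intro mult_left_mono) auto
    then have "l \<le> 1" using l by simp
    have "\<bar>poly_ord v p\<bar> \<le> int (degree p)" "\<bar>poly_ord v q\<bar> \<le> int (degree q)"
      using y abs_poly_ord_le by blast+
    then have "ord_at v y \<le> N - 1" using y by (simp add: ord_at_Fract N_def)
    moreover have "0 < ord_at v y"
    proof -
      have "0 < real_of_int N" by (simp add: N_def)
      then have "0 < l * real_of_int (ord_at v y)" using l by simp
      then show ?thesis using that by (simp add: zero_less_mult_iff)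
    qed
    moreover have "l * real_of_int (ord_at v y) \<le> 1 * real_of_int (ord_at v y)"
      using \<open>l \<le> 1\<close> \<open>0 < ord_at v y\<close> by (intro mult_right_mono) auto
    ultimately show False using l by simp
  qed
  then obtain F m where "subst_xy F x y = 0" "(m, m) \<in> exponents F"
    using relation_with_unique_initial_exponent[OF xy, of 1 N] by auto
  then show ?thesis using implicit_equation_iff[OF \<phi>, of F] by (auto simp: exponents_def)
qed

text \<open>A monomial takes a nonzero value at \<open>(x, y)\<close>, so the cofactor would already be a relation, hence a
  multiple of \<open>\<phi>\<close>.\<close>

lemma bimonom_not_dvd_implicit_equation:
  assumes \<phi>: "implicit_equation \<phi> x y" and xy: "x \<noteq> 0" "y \<noteq> 0" and ij: "(i, j) \<noteq> (0, 0)"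
  shows "\<not> bimonom i j dvd \<phi>"
proof
  assume "bimonom i j dvd \<phi>"
  then obtain g where g: "\<phi> = bimonom i j * g" by (elim dvdE)
  have "subst_xy \<phi> x y = 0" using implicit_equation_iff[OF \<phi>, of \<phi>] by simp
  then have "subst_xy g x y = 0" using xy by (simp add: g)
  then obtain h where h: "g = \<phi> * h" using implicit_equation_iff[OF \<phi>] by (auto elim: dvdE)
  have "\<phi> * (bimonom i j * h) = bimonom i j * g" unfolding h by (simp only: mult_ac)
  then have "\<phi> * (bimonom i j * h) = \<phi> * 1" by (simp only: g[symmetric] mult_1_right)
  then have "bimonom i j * h = 1" using implicit_equation_nonzero[OF \<phi> xy] by (simp only: mult_cancel_left) simp
  then have "(0, 0) \<in> exponents (bimonom i j * h)" by simp
  then show False using exponents_mult[of "(0, 0)" "bimonom i j" h] ij by auto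
qed

lemma exponents_touch_axes:
  assumes \<phi>: "implicit_equation \<phi> x y" and xy: "x \<noteq> 0" "y \<noteq> 0"
  shows "\<exists>j. (0, j) \<in> exponents \<phi>" "\<exists>i. (i, 0) \<in> exponents \<phi>"
proof -
  show "\<exists>j. (0, j) \<in> exponents \<phi>"
  proof (rule ccontr)
    assume "\<not> ?thesis"
    then have "poly (coeff \<phi> j) 0 = 0" for j by (simp add: exponents_def poly_0_coeff_0)
    then have "[:- 0, 1:] dvd coeff \<phi> j" for j by (simp only: poly_eq_0_iff_dvd)
    then have "[:[:0, 1:]:] dvd \<phi>" by (simp add: const_poly_dvd_iff)
    moreover have "[:[:0, 1:]:] = bimonom 1 0" by (simp add: bimonom_def monom_altdef)
    ultimately show False using bimonom_not_dvd_implicit_equation[OF \<phi> xy, of 1 0] by simp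
  qed
  show "\<exists>i. (i, 0) \<in> exponents \<phi>"
  proof (rule ccontr)
    assume "\<not> ?thesis"
    then have "coeff \<phi> 0 = 0" by (simp add: exponents_def poly_eq_iff)
    then have "poly \<phi> 0 = 0" by (simp add: poly_0_coeff_0)
    then have "[:- 0, 1:] dvd \<phi>" by (simp only: poly_eq_0_iff_dvd)
    moreover have "[:- 0, 1:] = bimonom 0 1" by (simp add: bimonom_def monom_altdef)
    ultimately show False using bimonom_not_dvd_implicit_equation[OF \<phi> xy, of 0 1] by simp
  qed
qed

text \<open>A polynomial over the complex numbers splits into linear factors, and one of them vanishes at
  \<open>u\<close>.\<close>

lemma algebraic_over_constants_imp_constant:
  assumes "eval_at r u = 0" "r \<noteq> 0"
  shows "u \<in> range const_fract"
  using assms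
proof (induction "degree r" arbitrary: r)
  case 0
  then obtain c where "r = [:c:]" by (metis degree_eq_zeroE)
  then show ?case using 0 by simp
next
  case (Suc d)
  then have "\<not> constant (poly r)" by (simp add: constant_degree)
  then obtain a where "poly r a = 0" using fundamental_theorem_of_algebra by blast
  then obtain q where q: "r = [:- a, 1:] * q" by (metis dvd_def poly_eq_0_iff_dvd)
  have "q \<noteq> 0" using Suc.prems(2) q by auto
  then have "degree r = degree [:- a, 1:] + degree q" unfolding q by (intro degree_mult_eq) auto
  then have d: "d = degree q" using Suc.hyps(2) by simp
  have "eval_at r u = (u - const_fract a) * eval_at q u"
    unfolding q by (simp only: eval_at_simps) (simp add: const_fract.hom_uminus)
  then consider "u = const_fract a" | "eval_at q u = 0" using Suc.prems(1) by auto
  then show ?case using Suc.hyps(1)[OF d] \<open>q \<noteq> 0\<close> by cases auto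
qed

lemma exponents_off_axes:
  assumes \<phi>: "implicit_equation \<phi> x y" and xy: "x \<notin> range const_fract" "y \<notin> range const_fract"
    and nz: "\<phi> \<noteq> 0"
  shows "\<exists>s\<in>exponents \<phi>. 0 < fst s" "\<exists>s\<in>exponents \<phi>. 0 < snd s"
proof -
  have root: "subst_xy \<phi> x y = 0" using implicit_equation_iff[OF \<phi>, of \<phi>] by simp
  show "\<exists>s\<in>exponents \<phi>. 0 < fst s"
  proof (rule ccontr)
    assume "\<not> ?thesis"
    then have const: "coeff \<phi> j = [:coeff (coeff \<phi> j) 0:]" for j
      by (auto simp: exponents_def poly_eq_iff coeff_pCons' split: if_splits) 
    define r where "r = map_poly (\<lambda>p. coeff p 0) \<phi>"
    have r: "\<phi> = map_poly (\<lambda>c. [:c:]) r"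
      using const by (intro poly_eqI) (simp add: r_def coeff_map_poly)
    have "subst_xy (map_poly (\<lambda>c. [:c:]) r) x y = eval_at r y" for r
      by (induction r) (simp_all add: Polynomial.map_poly_pCons)
    then have "eval_at r y = 0" using root r by simp
    moreover have "r \<noteq> 0" using nz r by auto
    ultimately show False using algebraic_over_constants_imp_constant xy(2) by blast
  qed
  show "\<exists>s\<in>exponents \<phi>. 0 < snd s"
  proof (rule ccontr)
    assume "\<not> ?thesis"
    then have "coeff \<phi> j = 0" if "j > 0" for j
      using that by (auto simp: exponents_def poly_eq_iff)
    then have c: "\<phi> = [:coeff \<phi> 0:]" by (intro poly_eqI) (simp add: coeff_pCons')
    then have "subst_xy \<phi> x y = eval_at (coeff \<phi> 0) x"
      by (metis add.right_neutral mult_zero_right subst_xy_simps(1,3))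
    then have "eval_at (coeff \<phi> 0) x = 0" using root by simp
    moreover have "coeff \<phi> 0 \<noteq> 0" using nz c by (metis pCons_0_0)
    ultimately show False using algebraic_over_constants_imp_constant xy(1) by blast
  qed
qed

definition real_pair :: "nat \<times> nat \<Rightarrow> real \<times> real" where
  "real_pair s = (real (fst s), real (snd s))"

lemma newton_polygon_eq: "newton_polygon \<phi> = convex hull (real_pair ` exponents \<phi>)"
  unfolding newton_polygon_def exponents_def real_pair_def
  by (rule arg_cong[where f = "\<lambda>A. convex hull A"]) force

definition place_vector :: "complex option \<Rightarrow> complex poly fract \<Rightarrow> complex poly fract \<Rightarrow> real \<times> real" where
  "place_vector v x y = (of_int (ord_at v x), of_int (ord_at v y))"

lemma inner_real_pair: "inner (of_int w1, of_int w2) (real_pair s) = real_of_int (weight w1 w2 s)"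
  by (simp add: real_pair_def weight_def)

lemma place_vector_of_newton_polygon_tie:
  assumes \<phi>: "implicit_equation \<phi> x y" and xy: "x \<noteq> 0" "y \<noteq> 0"
    and p: "p \<in> real_pair ` exponents \<phi>" "q \<in> real_pair ` exponents \<phi>" "p \<noteq> q"
    and w: "w \<noteq> 0" "inner w p = inner w q" "\<forall>s\<in>real_pair ` exponents \<phi>. inner w p \<le> inner w s"
  shows "\<exists>v. \<exists>l>0. w = l *\<^sub>R place_vector v x y"
proof -
  obtain s t where s: "s \<in> exponents \<phi>" "p = real_pair s" and t: "t \<in> exponents \<phi>" "q = real_pair t"
    using p by blast
  \<comment> \<open>The direction \<open>w\<close> is orthogonal to an integer vector, hence a real multiple of an integer vector.\<close>
  define a b where "a = int (fst t) - int (fst s)" and "b = int (snd t) - int (snd s)"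
  obtain u v where uv: "w = (u, v)" by (cases w)
  have "s \<noteq> t" using p(3) s t by blast
  then have ab: "(a, b) \<noteq> (0, 0)" by (auto simp: a_def b_def prod_eq_iff)
  have orth: "u * of_int a + v * of_int b = 0"
    using w(2) by (simp add: uv s t a_def b_def real_pair_def algebra_simps)
  have "\<exists>c. u = c * of_int (- b) \<and> v = c * of_int a"
  proof (cases "a = 0")
    case True
    then show ?thesis using ab orth by (intro exI[of _ "- u / of_int b"]) auto
  next
    case False
    then show ?thesis using orth by (intro exI[of _ "v / of_int a"]) (auto simp: field_simps)
  qed
  then obtain c where c: "u = c * of_int (- b)" "v = c * of_int a" by blast
  have "c \<noteq> 0" using w(1) c uv by (auto simp: zero_prod_def)
  define e :: int where "e = (if c > 0 then 1 else - 1)"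
  define w1 w2 where "w1 = - e * b" and "w2 = e * a"
  have ce: "c = \<bar>c\<bar> * of_int e" by (simp add: e_def)
  have wc: "w = \<bar>c\<bar> *\<^sub>R (of_int w1, of_int w2)"
    using c ce by (simp add: uv w1_def w2_def)
  have w12: "(w1, w2) \<noteq> (0, 0)" using ab by (auto simp: w1_def w2_def e_def)
  have le: "weight w1 w2 s \<le> weight w1 w2 r" if "r \<in> exponents \<phi>" for r
  proof -
    have "inner w (real_pair s) \<le> inner w (real_pair r)" using w(3) that s by blast
    then show ?thesis using \<open>c \<noteq> 0\<close> by (simp add: wc inner_real_pair del: scaleR_Pair)
  qed
  have "weight w1 w2 s = weight w1 w2 t"
    using w(2) \<open>c \<noteq> 0\<close> by (simp add: wc inner_real_pair s t del: scaleR_Pair)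
  then have "s \<in> initial_exponents w1 w2 \<phi>" "t \<in> initial_exponents w1 w2 \<phi>"
    using le s t by (auto simp: initial_exponents_def)
  then obtain v l where "(l::real) > 0" "of_int w1 = l * of_int (ord_at v x)" "of_int w2 = l * of_int (ord_at v y)"
    using place_in_direction_of_tie[OF \<phi> xy w12] \<open>s \<noteq> t\<close> by blast
  then show ?thesis using \<open>c \<noteq> 0\<close>
    by (intro exI[of _ v] exI[of _ "\<bar>c\<bar> * l"]) (simp add: wc place_vector_def)
qed

section \<open>Constant coordinates\<close>

text \<open>The implicit equation is a nonunit that divides the irreducible polynomial \<open>x - a\<close>.\<close>

lemma constant_x_exponents:
  assumes \<phi>: "implicit_equation \<phi> (const_fract a) y"
  shows "exponents \<phi> = {(1, 0)} \<union> (if a = 0 then {} else {(0, 0)})"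
proof -
  define F where "F = [:[:- a, 1:]:]"
  have "subst_xy F (const_fract a) y = 0" by (simp add: F_def const_fract.hom_uminus)
  then obtain g where g: "F = \<phi> * g" using implicit_equation_iff[OF \<phi>] by (auto elim: dvdE)
  have not_unit: "\<not> \<phi> dvd 1" using implicit_equation_iff[OF \<phi>, of 1] by simp
  have "F \<noteq> 0" by (simp add: F_def)
  then have "\<phi> \<noteq> 0" "g \<noteq> 0" using g by auto
  then have "degree F = degree \<phi> + degree g" unfolding g by (rule degree_mult_eq)
  then have "degree \<phi> = 0" "degree g = 0" by (simp_all add: F_def)
  then obtain r s where rs: "\<phi> = [:r:]" "g = [:s:]" by (elim degree_eq_zeroE)
  have prod: "r * s = [:- a, 1:]" using g by (simp add: rs F_def mult.commute)
  have nz: "r \<noteq> 0" "s \<noteq> 0" using \<open>\<phi> \<noteq> 0\<close> \<open>g \<noteq> 0\<close> rs by auto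
  have "degree r + degree s = degree [:- a, 1:]" unfolding prod[symmetric] by (rule degree_mult_eq[OF nz, symmetric])
  then have deg: "degree r + degree s = 1" by simp
  have "degree r \<noteq> 0"
  proof
    assume "degree r = 0"
    then obtain c where c: "r = [:c:]" "c \<noteq> 0" using nz by (elim degree_eq_zeroE) auto
    have "[:r:] * [:[:inverse c:]:] = 1" unfolding c(1) using c(2) by simp
    then have "[:r:] dvd 1" by (rule dvdI[OF sym])
    then show False using not_unit rs(1) by simp
  qed
  then have "degree s = 0" using deg by simp
  then obtain d where d: "s = [:d:]" "d \<noteq> 0" using nz by (elim degree_eq_zeroE) auto
  have "Polynomial.smult d r = [:- a, 1:]" using prod d(1) by (simp add: mult.commute)
  then have cr: "d * coeff r i = coeff [:- a, 1:] i" for i by (metis coeff_smult)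
  have r: "coeff r i \<noteq> 0 \<longleftrightarrow> i = 1 \<or> i = 0 \<and> a \<noteq> 0" for i
  proof -
    have "coeff r i \<noteq> 0 \<longleftrightarrow> coeff [:- a, 1:] i \<noteq> 0" unfolding cr[symmetric] using d(2) by simp
    then show ?thesis by (cases i) (auto simp: coeff_pCons split: nat.splits)
  qed
  have "(i, j) \<in> exponents \<phi> \<longleftrightarrow> j = 0 \<and> (i = 1 \<or> i = 0 \<and> a \<noteq> 0)" for i j
    unfolding r[symmetric] by (cases j) (simp_all add: exponents_def rs(1))
  then show ?thesis by auto
qed

lemma constant_y_exponents:
  assumes \<phi>: "implicit_equation \<phi> x (const_fract b)"
  shows "exponents \<phi> = {(0, 1)} \<union> (if b = 0 then {} else {(0, 0)})"
proof -
  define F :: "complex poly poly" where "F = [:[:- b:], 1:]"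
  have "subst_xy F x (const_fract b) = 0" by (simp add: F_def const_fract.hom_uminus)
  then obtain g where g: "F = \<phi> * g" using implicit_equation_iff[OF \<phi>] by (auto elim: dvdE)
  have not_unit: "\<not> \<phi> dvd 1" using implicit_equation_iff[OF \<phi>, of 1] by simp
  have "F \<noteq> 0" by (simp add: F_def)
  then have nz: "\<phi> \<noteq> 0" "g \<noteq> 0" using g by auto
  then have "degree F = degree \<phi> + degree g" unfolding g by (rule degree_mult_eq)
  then have deg: "degree \<phi> + degree g = 1" by (simp add: F_def)
  have "lead_coeff \<phi> * lead_coeff g = lead_coeff F" unfolding g by (rule lead_coeff_mult[symmetric])
  then have lc: "lead_coeff \<phi> * lead_coeff g = 1" by (simp add: F_def)
  have "degree \<phi> \<noteq> 0"
  proof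
    assume "degree \<phi> = 0"
    then obtain r where r: "\<phi> = [:r:]" by (elim degree_eq_zeroE)
    have "r * lead_coeff g = 1" using lc r by simp
    then have "[:r:] * [:lead_coeff g:] = 1" by (simp add: mult.commute)
    then have "[:r:] dvd 1" by (rule dvdI[OF sym])
    then show False using not_unit r by simp
  qed
  then have "degree g = 0" using deg by simp
  then obtain s where s: "g = [:s:]" by (elim degree_eq_zeroE)
  then have "lead_coeff \<phi> * s = 1" using lc by simp
  then have "1 = s * lead_coeff \<phi>" "s \<noteq> 0" by (auto simp: mult.commute)
  then have "degree s = 0" using is_unit_iff_degree[of s] dvdI[of 1 s] by blast
  then obtain d where s': "s = [:d:]" by (elim degree_eq_zeroE)
  then have d: "s = [:d:]" "d \<noteq> 0" using \<open>s \<noteq> 0\<close> by auto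
  have "F = Polynomial.smult s \<phi>" using g s by (simp add: mult.commute)
  then have cr: "d * coeff (coeff \<phi> j) i = coeff (coeff F j) i" for i j by (simp add: d(1))
  have "(i, j) \<in> exponents \<phi> \<longleftrightarrow> i = 0 \<and> (j = 1 \<or> j = 0 \<and> b \<noteq> 0)" for i j
  proof -
    have "(i, j) \<in> exponents \<phi> \<longleftrightarrow> coeff (coeff F j) i \<noteq> 0"
      unfolding cr[symmetric] using d(2) by (simp add: exponents_def)
    then show ?thesis
      by (cases i; cases j) (auto simp: F_def coeff_pCons coeff_1 split: nat.splits)
  qed
  then show ?thesis by auto
qed

lemma newton_polygon_constant_coordinate:
  assumes \<phi>: "implicit_equation \<phi> x y" and c: "constant_coordinate x y"
  obtains e where "e = (1, 0) \<or> e = (0, 1)"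
    "newton_polygon \<phi> = {e} \<or> newton_polygon \<phi> = closed_segment (0, 0) e"
proof -
  from c consider a where "x = const_fract a" | b where "y = const_fract b"
    unfolding constant_coordinate_def by blast
  then show ?thesis
  proof cases
    case 1
    have "exponents \<phi> = {(1, 0)} \<union> (if a = 0 then {} else {(0, 0)})"
      using \<phi> unfolding 1 by (rule constant_x_exponents)
    then have "real_pair ` exponents \<phi> = {(1, 0)} \<or> real_pair ` exponents \<phi> = {(0, 0), (1, 0)}"
      by (simp add: real_pair_def insert_commute)
    then have "newton_polygon \<phi> = {(1, 0)} \<or> newton_polygon \<phi> = closed_segment (0, 0) (1, 0)"
      by (elim disjE) (simp_all only: newton_polygon_eq segment_convex_hull convex_hull_singleton simp_thms)
    then show ?thesis by (rule that[rotated]) simp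
  next
    case 2
    have "exponents \<phi> = {(0, 1)} \<union> (if b = 0 then {} else {(0, 0)})"
      using \<phi> unfolding 2 by (rule constant_y_exponents)
    then have "real_pair ` exponents \<phi> = {(0, 1)} \<or> real_pair ` exponents \<phi> = {(0, 0), (0, 1)}"
      by (simp add: real_pair_def insert_commute)
    then have "newton_polygon \<phi> = {(0, 1)} \<or> newton_polygon \<phi> = closed_segment (0, 0) (0, 1)"
      by (elim disjE) (simp_all only: newton_polygon_eq segment_convex_hull convex_hull_singleton simp_thms)
    then show ?thesis by (rule that[rotated]) simp
  qed
qed

lemma obtained_by_cuts_self: "obtained_by_cuts V k T T"
  unfolding obtained_by_cuts_def by (intro exI[of _ "{}"]) simp

lemma obtained_by_cuts_of_axis_segment:
  assumes e: "e = (1, 0) \<or> e = (0, 1)" and N: "N = {e} \<or> N = closed_segment (0, 0) e"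
  shows "\<exists>T. axis_segment T \<and> obtained_by_cuts {(0, 0)} 1 T N"
proof -
  let ?T = "closed_segment (0, 0) e"
  have T: "axis_segment ?T" unfolding axis_segment_def using e by (intro exI[of _ 1]) auto
  have pt: "{e} = ?T \<inter> {z. 1 \<le> inner e z}"
  proof (rule disjE[OF e])
    assume e: "e = (1, 0)"
    show ?thesis unfolding e by (auto simp: closed_segment_axis)
  next
    assume e: "e = (0, 1)"
    show ?thesis unfolding e by (auto simp: closed_segment_axis)
  qed
  have "e \<noteq> (0, 0)" "1 \<le> inner e e" using e by auto
  then have cut: "corner_cut ?T (0, 0) {z. 1 \<le> inner e z}"
    by (intro corner_cutI exI[of _ e]) (auto simp: extreme_point_of_segment zero_prod_def[symmetric])
  have "obtained_by_cuts {(0, 0)} 1 ?T {e}"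
  proof (rule obtained_by_cutsI[of "{e}" _ _ _ "\<lambda>_. 1"])
    have "(\<Inter>\<rho>\<in>{e}. {z. 1 \<le> inner \<rho> z}) = {z. 1 \<le> inner e z}" by simp
    then show "{e} = ?T \<inter> (\<Inter>\<rho>\<in>{e}. {z. 1 \<le> inner \<rho> z})" by (rule ssubst) (rule pt)
    show "?T \<subseteq> {z. 1 \<le> inner \<rho> z} \<or> (\<exists>v\<in>{(0, 0)}. corner_cut ?T v {z. 1 \<le> inner \<rho> z})"
      if "\<rho> \<in> {e}" for \<rho> using cut that by blast
  qed simp_all
  then show ?thesis using N T obtained_by_cuts_self by metis
qed

text \<open>Cutting off one corner of the triangle leaves the opposite side; this is a segment on an
  axis if the corner is the end point of the other leg. To leave only \<open>e\<close>, the origin is cut off along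
  the hypotenuse.\<close>

lemma obtained_by_cuts_of_unit_triangle:
  assumes e: "e = (1, 0) \<or> e = (0, 1)" and N: "N = {e} \<or> N = closed_segment (0, 0) e"
  shows "\<exists>T. axis_polygon 3 T \<and> obtained_by_cuts UNIV 2 T N"
proof -
  let ?T = "axis_triangle 1 1"
  have ext: "v extreme_point_of ?T \<longleftrightarrow> v = (0, 0) \<or> v = (1, 0) \<or> v = (0, 1)" for v
    by (simp add: extreme_point_of_axis_triangle)
  define e' :: "real \<times> real" where "e' = (1, 1) - e"
  define c :: "real \<times> real \<Rightarrow> real" where "c = (\<lambda>\<rho>. if \<rho> = (1, 1) then 1 else 0)"
  have c: "c (1, 1) = 1" "c (- e') = 0" using e by (auto simp: c_def e'_def)
  have facts: "e' extreme_point_of ?T" "inner e' e' = 1" "inner e' e = 0"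
    "\<And>w. w extreme_point_of ?T \<Longrightarrow> w \<noteq> e' \<Longrightarrow> inner e' w = 0" "e \<noteq> e'" "e extreme_point_of ?T"
    using e by (auto simp: ext e'_def)
  have cut1: "corner_cut ?T e' {z. c (- e') \<le> inner (- e') z}"
    by (rule corner_cutI) (use facts c in \<open>auto simp del: split_paired_Ex\<close>)
  have cut2: "corner_cut ?T (0, 0) {z. c (1, 1) \<le> inner (1, 1) z}"
  proof (rule corner_cutI)
    show "(0, 0) extreme_point_of ?T" by (simp add: ext)
    show "\<exists>w. w extreme_point_of ?T \<and> w \<noteq> (0, 0)" by (rule exI[of _ "(1, 0)"]) (simp add: ext)
    show "\<not> c (1, 1) \<le> inner (1, 1) (0, 0)" by (simp add: c)
    show "c (1, 1) \<le> inner (1, 1) w" if "w extreme_point_of ?T" "w \<noteq> (0, 0)" for w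
      using that by (auto simp: c ext)
  qed
  have seg: "closed_segment (0, 0) e = ?T \<inter> {z. 0 \<le> inner (- e') z}"
  proof (rule disjE[OF e])
    assume e: "e = (1, 0)"
    show ?thesis unfolding e'_def e by (auto simp: axis_triangle_eq closed_segment_axis)
  next
    assume e: "e = (0, 1)"
    show ?thesis unfolding e'_def e by (auto simp: axis_triangle_eq closed_segment_axis)
  qed
  have pt: "{e} = closed_segment (0, 0) e \<inter> {z. 1 \<le> inner (1, 1) z}"
  proof (rule disjE[OF e])
    assume e: "e = (1, 0)"
    show ?thesis unfolding e by (auto simp: closed_segment_axis)
  next
    assume e: "e = (0, 1)"
    show ?thesis unfolding e by (auto simp: closed_segment_axis)
  qed
  have "obtained_by_cuts UNIV 2 ?T (closed_segment (0, 0) e)"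
  proof (rule obtained_by_cutsI[of "{- e'}" _ _ _ c])
    show "closed_segment (0, 0) e = ?T \<inter> (\<Inter>\<rho>\<in>{- e'}. {z. c \<rho> \<le> inner \<rho> z})"
      using seg c by simp
    show "?T \<subseteq> {z. c \<rho> \<le> inner \<rho> z} \<or> (\<exists>v\<in>UNIV. corner_cut ?T v {z. c \<rho> \<le> inner \<rho> z})"
      if "\<rho> \<in> {- e'}" for \<rho> using cut1 that by blast
  qed simp_all
  moreover have "obtained_by_cuts UNIV 2 ?T {e}"
  proof (rule obtained_by_cutsI[of "{- e', (1, 1)}" _ _ _ c])
    show "{e} = ?T \<inter> (\<Inter>\<rho>\<in>{- e', (1, 1)}. {z. c \<rho> \<le> inner \<rho> z})"
      using pt unfolding seg by (simp add: c Int_assoc)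
    show "?T \<subseteq> {z. c \<rho> \<le> inner \<rho> z} \<or> (\<exists>v\<in>UNIV. corner_cut ?T v {z. c \<rho> \<le> inner \<rho> z})"
      if "\<rho> \<in> {- e', (1, 1)}" for \<rho> using cut1 cut2 that by blast
  qed (simp_all add: card_insert_if)
  ultimately show ?thesis using N axis_polygon_triangle[of 1 1] by auto
qed

lemma obtained_by_cuts_mono:
  "obtained_by_cuts V k T N \<Longrightarrow> V \<subseteq> W \<Longrightarrow> k \<le> l \<Longrightarrow> obtained_by_cuts W l T N"
  unfolding obtained_by_cuts_def by (blast intro: order_trans)

lemma cut_axis_polygonI:
  "axis_polygon n T \<Longrightarrow> obtained_by_cuts V k T N \<Longrightarrow> cut_axis_polygon N"
  unfolding cut_axis_polygon_def using obtained_by_cuts_mono[of V k T N UNIV k] by blast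

section \<open>The three kinds of parameterizations\<close>

lemma place_vector_Fract:
  assumes "p \<noteq> 0" "q \<noteq> 0" "r \<noteq> 0" "s \<noteq> 0"
  shows "place_vector (Some a) (Fract p q) (Fract r s) =
      (real (order a p) - real (order a q), real (order a r) - real (order a s))"
    and "place_vector None (Fract p q) (Fract r s) =
      (real (degree q) - real (degree p), real (degree s) - real (degree r))"
  using assms by (simp_all add: place_vector_def ord_at_Fract poly_ord_def)

lemma nonconstant_imp_nonzero:
  assumes "u \<notin> range const_fract"
  shows "u \<noteq> 0"
proof
  assume "u = 0"
  then have "u = const_fract 0" by simp
  then show False using assms by blast
qed

lemma nonconstant_Fract_numerator: "Fract p q \<notin> range const_fract \<Longrightarrow> p \<noteq> 0"
  using nonconstant_imp_nonzero[of "Fract p q"] by (auto simp: fract_collapse)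


lemma real_pair_nonneg: "s \<in> real_pair ` A \<Longrightarrow> 0 \<le> fst s \<and> 0 \<le> snd s"
  by (auto simp: real_pair_def)

lemma newton_polygon_touches_axes:
  assumes \<phi>: "implicit_equation \<phi> x y" and xy: "x \<notin> range const_fract" "y \<notin> range const_fract"
  obtains p q s t where "p \<in> real_pair ` exponents \<phi>" "fst p = 0" "q \<in> real_pair ` exponents \<phi>" "snd q = 0"
    "s \<in> real_pair ` exponents \<phi>" "0 < fst s" "t \<in> real_pair ` exponents \<phi>" "0 < snd t"
proof -
  have nz: "x \<noteq> 0" "y \<noteq> 0" using xy nonconstant_imp_nonzero by blast+
  obtain i j where "(0, j) \<in> exponents \<phi>" "(i, 0) \<in> exponents \<phi>" using exponents_touch_axes[OF \<phi> nz] by blast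
  moreover obtain s t where "s \<in> exponents \<phi>" "0 < fst s" "t \<in> exponents \<phi>" "0 < snd t"
    using exponents_off_axes[OF \<phi> xy implicit_equation_nonzero[OF \<phi> nz]] by blast
  moreover have "fst (real_pair (0, j)) = 0" "snd (real_pair (i, 0)) = 0"
    "0 < fst s \<Longrightarrow> 0 < fst (real_pair s)" "0 < snd t \<Longrightarrow> 0 < snd (real_pair t)" for i j s t
    by (simp_all add: real_pair_def)
  ultimately show ?thesis using that by (metis imageI)
qed

lemma place_vector_multiple:
  assumes "(w :: real \<times> real) = l *\<^sub>R v" "l > 0" "v = k *\<^sub>R \<rho>" "k > 0"
  shows "\<exists>l>0. w = l *\<^sub>R \<rho>"
  using assms by (intro exI[of _ "l * k"]) simp

text \<open>The only pole is at infinity, where both orders are negative; this is the normal of the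
  hypotenuse. The place zero has a vector in the first quadrant, which gives the cut at the origin.\<close>

lemma newton_polygon_polynomial_case:
  fixes p0 p1 :: "complex poly"
  defines "x \<equiv> Fract p0 1" and "y \<equiv> Fract p1 1"
  assumes \<phi>: "implicit_equation \<phi> x y" and xy: "x \<notin> range const_fract" "y \<notin> range const_fract"
    and roots: "\<And>a. a \<noteq> 0 \<Longrightarrow> poly p0 a = 0 \<Longrightarrow> poly p1 a \<noteq> 0"
  shows "\<exists>T. axis_polygon 3 T \<and> obtained_by_cuts {(0, 0)} 1 T (newton_polygon \<phi>)"
proof -
  have nz: "x \<noteq> 0" "y \<noteq> 0" using xy nonconstant_imp_nonzero by blast+
  have pnz: "p0 \<noteq> 0" "p1 \<noteq> 0" using nz by (auto simp: x_def y_def fract_collapse)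
  have deg: "degree p0 > 0" "degree p1 > 0"
  proof -
    show "degree p0 > 0"
    proof (rule ccontr)
      assume "\<not> ?thesis"
      then obtain c where "p0 = [:c:]" by (auto elim: degree_eq_zeroE)
      then have "x = const_fract c" by (simp add: x_def const_fract_def)
      then show False using xy(1) by blast
    qed
    show "degree p1 > 0"
    proof (rule ccontr)
      assume "\<not> ?thesis"
      then obtain c where "p1 = [:c:]" by (auto elim: degree_eq_zeroE)
      then have "y = const_fract c" by (simp add: y_def const_fract_def)
      then show False using xy(2) by blast
    qed
  qed
  let ?S = "real_pair ` exponents \<phi>"
  obtain p q s t where touch: "p \<in> ?S" "fst p = 0" "q \<in> ?S" "snd q = 0" and s: "s \<in> ?S" "0 < fst s"
    by (rule newton_polygon_touches_axes[OF \<phi> xy])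
  have v: "place_vector (Some a) x y = (real (order a p0), real (order a p1))" for a
    unfolding x_def y_def using place_vector_Fract(1)[of p0 1 p1 1 a] pnz by (simp add: order_0I)
  have v_inf: "place_vector None x y = (- real (degree p0), - real (degree p1))"
    unfolding x_def y_def using place_vector_Fract(2)[of p0 1 p1 1] pnz by simp
  have "\<exists>T. axis_polygon 3 T \<and> obtained_by_cuts {(0, 0)} 1 T (convex hull ?S)"
  proof (rule obtained_by_cuts_of_triangle[OF _ real_pair_nonneg touch s(1)])
    show "finite ?S" by (simp add: finite_exponents)
    show "s \<noteq> 0" using s(2) by auto
    show "0 < real (degree p0)" "0 < real (degree p1)" using deg by simp_all
    let ?K = "{place_vector (Some 0) x y}"
    show "finite ?K" "card ?K \<le> 1" by simp_all
    show "{(0, 0)} = UNIV \<or> {(0, 0)} = {(0, 0)} \<and> (\<forall>\<rho>\<in>?K. 0 \<le> fst \<rho> \<and> 0 \<le> snd \<rho>)"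
      by (simp add: v)
    fix p q w
    assume "p \<in> ?S" "q \<in> ?S" "p \<noteq> q" "w \<noteq> 0" "inner w p = inner w q" "\<forall>s\<in>?S. inner w p \<le> inner w s"
    then obtain b l where bl: "l > 0" "w = l *\<^sub>R place_vector b x y"
      using place_vector_of_newton_polygon_tie[OF \<phi> nz] by blast
    let ?D = "{(1, 0), (0, 1), (- real (degree p0), - real (degree p1))}"
    show "\<exists>\<rho>\<in>?D \<union> ?K. \<exists>l>0. w = l *\<^sub>R \<rho>"
    proof (cases b)
      case None
      then show ?thesis using bl v_inf by auto
    next
      case (Some a)
      consider "a = 0" | "a \<noteq> 0" "order a p1 = 0" | "a \<noteq> 0" "order a p0 = 0"
        using roots[of a] order_0I[of p0 a] order_0I[of p1 a] by metis
      then show ?thesis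
      proof cases
        case 1
        then show ?thesis using bl Some by blast
      next
        case 2
        then have pv: "place_vector b x y = real (order a p0) *\<^sub>R (1, 0)" by (simp add: Some v)
        moreover have "order a p0 > 0" using bl \<open>w \<noteq> 0\<close> pv by (cases "order a p0 = 0") (auto simp: zero_prod_def)
        ultimately have "\<exists>l>0. w = l *\<^sub>R (1, 0)" using place_vector_multiple[OF bl(2,1) pv] by simp
        then show ?thesis by blast
      next
        case 3
        then have pv: "place_vector b x y = real (order a p1) *\<^sub>R (0, 1)" by (simp add: Some v)
        moreover have "order a p1 > 0" using bl \<open>w \<noteq> 0\<close> pv by (cases "order a p1 = 0") (auto simp: zero_prod_def)
        ultimately have "\<exists>l>0. w = l *\<^sub>R (0, 1)" using place_vector_multiple[OF bl(2,1) pv] by simp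
        then show ?thesis by blast
      qed
    qed
  qed
  then show ?thesis by (simp add: newton_polygon_eq)
qed

text \<open>At a root of \<open>q\<close> both coordinates have the same pole order, by coprimality. So the vectors of the
  places other than zero and infinity are multiples of the three inner normals of the triangle that is
  cut off by a line of slope \<open>- 1\<close>.\<close>

lemma newton_polygon_common_denominator_case:
  fixes p0 p1 q :: "complex poly"
  defines "x \<equiv> Fract p0 q" and "y \<equiv> Fract p1 q"
  assumes \<phi>: "implicit_equation \<phi> x y" and xy: "x \<notin> range const_fract" "y \<notin> range const_fract"
    and q: "q \<noteq> 0" "coprime p0 q" "coprime p1 q"
    and roots: "\<And>a. a \<noteq> 0 \<Longrightarrow> poly p0 a = 0 \<Longrightarrow> poly p1 a \<noteq> 0"
  shows "\<exists>T. axis_polygon 3 T \<and> obtained_by_cuts UNIV 2 T (newton_polygon \<phi>)"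
proof -
  have nz: "x \<noteq> 0" "y \<noteq> 0" using xy nonconstant_imp_nonzero by blast+
  have pnz: "p0 \<noteq> 0" "p1 \<noteq> 0" using nz by (auto simp: x_def y_def fract_collapse)
  let ?S = "real_pair ` exponents \<phi>"
  obtain p r s t where touch: "p \<in> ?S" "fst p = 0" "r \<in> ?S" "snd r = 0" and s: "s \<in> ?S" "0 < fst s"
    by (rule newton_polygon_touches_axes[OF \<phi> xy])
  have v: "place_vector (Some a) x y = (real (order a p0) - real (order a q), real (order a p1) - real (order a q))" for a
    unfolding x_def y_def by (rule place_vector_Fract(1)[OF pnz(1) q(1) pnz(2) q(1)])
  have "\<exists>T. axis_polygon 3 T \<and> obtained_by_cuts UNIV 2 T (convex hull ?S)"
  proof (rule obtained_by_cuts_of_triangle[OF _ real_pair_nonneg touch s(1)])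
    show "finite ?S" by (simp add: finite_exponents)
    show "s \<noteq> 0" using s(2) by auto
    show "(0::real) < 1" "(0::real) < 1" by simp_all
    let ?K = "{place_vector (Some 0) x y, place_vector None x y}"
    show "finite ?K" "card ?K \<le> 2" by (simp_all add: card_insert_if)
    show "UNIV = UNIV \<or> UNIV = {(0, 0)} \<and> (\<forall>\<rho>\<in>?K. 0 \<le> fst \<rho> \<and> 0 \<le> snd \<rho>)" by simp
    fix p r w
    assume "p \<in> ?S" "r \<in> ?S" "p \<noteq> r" "w \<noteq> 0" "inner w p = inner w r" "\<forall>s\<in>?S. inner w p \<le> inner w s"
    then obtain b l where bl: "l > 0" "w = l *\<^sub>R place_vector b x y"
      using place_vector_of_newton_polygon_tie[OF \<phi> nz] by blast
    let ?D = "{(1, 0), (0, 1), (- 1, - 1)}"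
    show "\<exists>\<rho>\<in>?D \<union> ?K. \<exists>l>0. w = l *\<^sub>R \<rho>"
    proof (cases "b \<in> {Some 0, None}")
      case True
      then show ?thesis using bl by blast
    next
      case False
      then obtain a where a: "b = Some a" "a \<noteq> 0" by (cases b) auto
      have cop: "poly q a = 0 \<Longrightarrow> order a p0 = 0 \<and> order a p1 = 0"
        using q(2,3) common_root_not_coprime[of q _ a] by (simp add: order_0I coprime_commute)
      consider "order a p0 = 0" "order a p1 = 0" | "order a q = 0" "order a p1 = 0" | "order a q = 0" "order a p0 = 0"
        using roots[OF a(2)] cop order_0I[of p0 a] order_0I[of p1 a] order_0I[of q a] by metis
      then obtain k \<rho> where k: "place_vector b x y = real k *\<^sub>R \<rho>" "\<rho> \<in> ?D"
      proof cases
        case 1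
        then show ?thesis using that[of "order a q" "(- 1, - 1)"] by (simp add: a v)
      next
        case 2
        then show ?thesis using that[of "order a p0" "(1, 0)"] by (simp add: a v)
      next
        case 3
        then show ?thesis using that[of "order a p1" "(0, 1)"] by (simp add: a v)
      qed
      have "k > 0" using bl k \<open>w \<noteq> 0\<close> by (cases "k = 0") (auto simp: zero_prod_def)
      then have "\<exists>l>0. w = l *\<^sub>R \<rho>" using place_vector_multiple[OF bl(2,1) k(1)] by simp
      then show ?thesis using k(2) by blast
    qed
  qed
  then show ?thesis by (simp add: newton_polygon_eq)
qed

text \<open>At a place other than zero and infinity at least one of the coordinates has order zero, so the
  place vector is parallel to an axis.\<close>

lemma newton_polygon_distinct_denominators_case:
  fixes p0 p1 q0 q1 :: "complex poly"
  defines "x \<equiv> Fract p0 q0" and "y \<equiv> Fract p1 q1"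
  assumes \<phi>: "implicit_equation \<phi> x y" and xy: "x \<notin> range const_fract" "y \<notin> range const_fract"
    and q: "q0 \<noteq> 0" "q1 \<noteq> 0"
    and roots: "\<And>a f g. \<lbrakk>a \<noteq> 0; f \<in> {p0, q0}; g \<in> {p1, q1}; poly f a = 0\<rbrakk> \<Longrightarrow> poly g a \<noteq> 0"
  shows "\<exists>T. axis_polygon 4 T \<and> obtained_by_cuts UNIV 2 T (newton_polygon \<phi>)"
proof -
  have nz: "x \<noteq> 0" "y \<noteq> 0" using xy nonconstant_imp_nonzero by blast+
  have pnz: "p0 \<noteq> 0" "p1 \<noteq> 0" using nz by (auto simp: x_def y_def fract_collapse)
  let ?S = "real_pair ` exponents \<phi>"
  obtain p r s t where touch: "p \<in> ?S" "fst p = 0" "r \<in> ?S" "snd r = 0"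
    and st: "s \<in> ?S" "0 < fst s" "t \<in> ?S" "0 < snd t"
    by (rule newton_polygon_touches_axes[OF \<phi> xy])
  have v: "place_vector (Some a) x y = (real (order a p0) - real (order a q0), real (order a p1) - real (order a q1))" for a
    unfolding x_def y_def by (rule place_vector_Fract(1)[OF pnz(1) q(1) pnz(2) q(2)])
  have "\<exists>T. axis_polygon 4 T \<and> obtained_by_cuts UNIV 2 T (convex hull ?S)"
  proof (rule obtained_by_cuts_of_rectangle[OF _ real_pair_nonneg touch st])
    show "finite ?S" by (simp add: finite_exponents)
    let ?K = "{place_vector (Some 0) x y, place_vector None x y}"
    show "finite ?K" "card ?K \<le> 2" by (simp_all add: card_insert_if)
    fix p r w
    assume "p \<in> ?S" "r \<in> ?S" "p \<noteq> r" "w \<noteq> 0" "inner w p = inner w r" "\<forall>s\<in>?S. inner w p \<le> inner w s"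
    then obtain b l where bl: "l > 0" "w = l *\<^sub>R place_vector b x y"
      using place_vector_of_newton_polygon_tie[OF \<phi> nz] by blast
    let ?D = "{(1, 0), (0, 1), (- 1, 0), (0, - 1)}"
    show "\<exists>\<rho>\<in>?D \<union> ?K. \<exists>l>0. w = l *\<^sub>R \<rho>"
    proof (cases "b \<in> {Some 0, None}")
      case True
      then show ?thesis using bl by blast
    next
      case False
      then obtain a where a: "b = Some a" "a \<noteq> 0" by (cases b) auto
      consider "order a p0 = 0" "order a q0 = 0" | "order a p1 = 0" "order a q1 = 0"
        using roots[OF a(2)] order_0I by (metis insertCI)
      then obtain k where k: "place_vector b x y = k *\<^sub>R (1, 0) \<or> place_vector b x y = k *\<^sub>R (0, 1)"
        by cases (auto simp: a v)
      have "k \<noteq> 0" using bl k \<open>w \<noteq> 0\<close> by (auto simp: zero_prod_def)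
      define \<sigma> :: real where "\<sigma> = sgn k"
      have \<sigma>: "\<sigma> = 1 \<or> \<sigma> = - 1" using \<open>k \<noteq> 0\<close> by (auto simp: \<sigma>_def sgn_if)
      have "k = \<bar>k\<bar> * \<sigma>" by (simp add: \<sigma>_def abs_mult_sgn)
      then have "place_vector b x y = \<bar>k\<bar> *\<^sub>R (\<sigma>, 0) \<or> place_vector b x y = \<bar>k\<bar> *\<^sub>R (0, \<sigma>)"
        using k by auto
      then obtain \<rho> where \<rho>: "place_vector b x y = \<bar>k\<bar> *\<^sub>R \<rho>" "\<rho> \<in> ?D"
        using \<sigma> by blast
      have "\<exists>l>0. w = l *\<^sub>R \<rho>" using place_vector_multiple[OF bl(2,1) \<rho>(1)] \<open>k \<noteq> 0\<close> by simp
      then show ?thesis using \<rho>(2) by blast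
    qed
  qed
  then show ?thesis by (simp add: newton_polygon_eq)
qed

theorem proposition1:
  shows
    "(\<forall>S0 S1. finite S0 \<and> finite S1 \<longrightarrow>
      for_generic_coeffs [S0, S1] (\<lambda>P.
        has_param_degree (P 0) 1 (P 1) 1 1 \<longrightarrow>
        (let x = Fract (P 0) 1; y = Fract (P 1) 1 in
         \<forall>\<phi>. implicit_equation \<phi> x y \<longrightarrow>
           cut_axis_polygon (newton_polygon \<phi>) \<and>
           (\<exists>T. (axis_polygon 3 T \<or> constant_coordinate x y \<and> axis_segment T) \<and>
                obtained_by_cuts {(0, 0)} 1 T (newton_polygon \<phi>))))) \<and>
     (\<forall>S0 S1 R. finite S0 \<and> finite S1 \<and> finite R \<and> R \<noteq> {} \<longrightarrow>
      for_generic_coeffs [S0, S1, R] (\<lambda>P.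
        coprime (P 0) (P 2) \<and> coprime (P 1) (P 2) \<and>
        has_param_degree (P 0) (P 2) (P 1) (P 2) 1 \<longrightarrow>
        (let x = Fract (P 0) (P 2); y = Fract (P 1) (P 2) in
         \<forall>\<phi>. implicit_equation \<phi> x y \<longrightarrow>
           cut_axis_polygon (newton_polygon \<phi>) \<and>
           (\<exists>T. axis_polygon 3 T \<and> obtained_by_cuts UNIV 2 T (newton_polygon \<phi>))))) \<and>
     (\<forall>S0 S1 R0 R1. finite S0 \<and> finite S1 \<and> finite R0 \<and> finite R1 \<and> R0 \<noteq> {} \<and> R1 \<noteq> {} \<longrightarrow>
      for_generic_coeffs [S0, S1, R0, R1] (\<lambda>P.
        coprime (P 0) (P 2) \<and> coprime (P 1) (P 3) \<and>
        has_param_degree (P 0) (P 2) (P 1) (P 3) 1 \<longrightarrow>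
        (let x = Fract (P 0) (P 2); y = Fract (P 1) (P 3) in
         \<forall>\<phi>. implicit_equation \<phi> x y \<longrightarrow>
           cut_axis_polygon (newton_polygon \<phi>) \<and>
           (\<exists>T. (axis_polygon 4 T \<or> constant_coordinate x y \<and> axis_segment T) \<and>
                obtained_by_cuts UNIV 2 T (newton_polygon \<phi>)))))"
proof (intro conjI allI impI, goal_cases)
  case (1 S0 S1)
  then have "\<forall>S\<in>set [S0, S1]. finite S" by simp
  from generic_no_common_roots[OF this] show ?case
  proof (rule for_generic_coeffs_mono, goal_cases)
    case (1 P)
    have roots: "poly (P 1) a \<noteq> 0"
      if "a \<noteq> 0" "poly (P 0) a = 0" "P 0 \<noteq> 0" "P 1 \<noteq> 0" for a
      using conjunct2[OF 1, rule_format, of 0 1 a] that by simp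
    show ?case unfolding Let_def
    proof (intro impI allI)
      fix \<phi> assume \<phi>: "implicit_equation \<phi> (Fract (P 0) 1) (Fract (P 1) 1)"
      let ?x = "Fract (P 0) 1" and ?y = "Fract (P 1) 1" and ?N = "newton_polygon \<phi>"
      show "cut_axis_polygon ?N \<and> (\<exists>T. (axis_polygon 3 T \<or> constant_coordinate ?x ?y \<and> axis_segment T) \<and>
          obtained_by_cuts {(0, 0)} 1 T ?N)"
      proof (cases "constant_coordinate ?x ?y")
        case True
        obtain e where e: "e = (1, 0) \<or> e = (0, 1)" "?N = {e} \<or> ?N = closed_segment (0, 0) e"
          by (rule newton_polygon_constant_coordinate[OF \<phi> True])
        show ?thesis
          using obtained_by_cuts_of_axis_segment[OF e] obtained_by_cuts_of_unit_triangle[OF e] True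
            cut_axis_polygonI by blast
      next
        case False
        then have xy: "?x \<notin> range const_fract" "?y \<notin> range const_fract"
          by (auto simp: constant_coordinate_def)
        obtain T where "axis_polygon 3 T" "obtained_by_cuts {(0, 0)} 1 T ?N"
          using newton_polygon_polynomial_case[OF \<phi> xy] roots nonconstant_Fract_numerator[OF xy(1)]
            nonconstant_Fract_numerator[OF xy(2)] by blast
        then show ?thesis using cut_axis_polygonI by blast
      qed
    qed
  qed
next
  case (2 S0 S1 R)
  then have "\<forall>S\<in>set [S0, S1, R]. finite S" by simp
  from generic_no_common_roots[OF this] show ?case
  proof (rule for_generic_coeffs_mono, goal_cases)
    case (1 P)
    have zero: "P 2 = 0 \<longleftrightarrow> R = {}" using conjunct1[OF 1, rule_format, of 2] by simp
    have roots: "poly (P 1) a \<noteq> 0"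
      if "a \<noteq> 0" "poly (P 0) a = 0" "P 0 \<noteq> 0" "P 1 \<noteq> 0" for a
      using conjunct2[OF 1, rule_format, of 0 1 a] that by simp
    show ?case unfolding Let_def
    proof (intro impI allI)
      fix \<phi> assume \<phi>: "implicit_equation \<phi> (Fract (P 0) (P 2)) (Fract (P 1) (P 2))"
        and cop: "coprime (P 0) (P 2) \<and> coprime (P 1) (P 2) \<and> has_param_degree (P 0) (P 2) (P 1) (P 2) 1"
      let ?x = "Fract (P 0) (P 2)" and ?y = "Fract (P 1) (P 2)" and ?N = "newton_polygon \<phi>"
      have "\<exists>T. axis_polygon 3 T \<and> obtained_by_cuts UNIV 2 T ?N"
      proof (cases "constant_coordinate ?x ?y")
        case True
        obtain e where e: "e = (1, 0) \<or> e = (0, 1)" "?N = {e} \<or> ?N = closed_segment (0, 0) e"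
          by (rule newton_polygon_constant_coordinate[OF \<phi> True])
        show ?thesis by (rule obtained_by_cuts_of_unit_triangle[OF e])
      next
        case False
        then have xy: "?x \<notin> range const_fract" "?y \<notin> range const_fract"
          by (auto simp: constant_coordinate_def)
        have "P 2 \<noteq> 0" using zero 2 by simp
        then show ?thesis
          using newton_polygon_common_denominator_case[OF \<phi> xy] roots cop nonconstant_Fract_numerator[OF xy(1)]
            nonconstant_Fract_numerator[OF xy(2)] by blast
      qed
      then show "cut_axis_polygon ?N \<and> (\<exists>T. axis_polygon 3 T \<and> obtained_by_cuts UNIV 2 T ?N)"
        using cut_axis_polygonI by blast
    qed
  qed
next
  case (3 S0 S1 R0 R1)
  then have "\<forall>S\<in>set [S0, S1, R0, R1]. finite S" by simp
  from generic_no_common_roots[OF this] show ?case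
  proof (rule for_generic_coeffs_mono, goal_cases)
    case (1 P)
    have zero: "P k = 0 \<longleftrightarrow> [S0, S1, R0, R1] ! k = {}" if "k < 4" for k
      using conjunct1[OF 1, rule_format, of k] that by simp
    have roots: "poly (P l) a \<noteq> 0"
      if "k < 4" "l < 4" "k \<noteq> l" "a \<noteq> 0" "poly (P k) a = 0" "P k \<noteq> 0" "P l \<noteq> 0" for k l a
      using conjunct2[OF 1, rule_format, of k l a] that by simp
    show ?case unfolding Let_def
    proof (intro impI allI)
      fix \<phi> assume \<phi>: "implicit_equation \<phi> (Fract (P 0) (P 2)) (Fract (P 1) (P 3))"
      let ?x = "Fract (P 0) (P 2)" and ?y = "Fract (P 1) (P 3)" and ?N = "newton_polygon \<phi>"
      show "cut_axis_polygon ?N \<and> (\<exists>T. (axis_polygon 4 T \<or> constant_coordinate ?x ?y \<and> axis_segment T) \<and>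
          obtained_by_cuts UNIV 2 T ?N)"
      proof (cases "constant_coordinate ?x ?y")
        case True
        obtain e where e: "e = (1, 0) \<or> e = (0, 1)" "?N = {e} \<or> ?N = closed_segment (0, 0) e"
          by (rule newton_polygon_constant_coordinate[OF \<phi> True])
        obtain T where "axis_segment T" "obtained_by_cuts {(0, 0)} 1 T ?N"
          using obtained_by_cuts_of_axis_segment[OF e] by blast
        moreover from this have "obtained_by_cuts UNIV 2 T ?N" by (auto intro: obtained_by_cuts_mono)
        ultimately show ?thesis
          using obtained_by_cuts_of_unit_triangle[OF e] True cut_axis_polygonI by blast
      next
        case False
        then have xy: "?x \<notin> range const_fract" "?y \<notin> range const_fract"
          by (auto simp: constant_coordinate_def)
        have nz: "P 0 \<noteq> 0" "P 1 \<noteq> 0" "P 2 \<noteq> 0" "P 3 \<noteq> 0"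
          using zero[of 2] zero[of 3] 3 nonconstant_Fract_numerator[OF xy(1)] nonconstant_Fract_numerator[OF xy(2)]
          by simp_all
        have "\<exists>T. axis_polygon 4 T \<and> obtained_by_cuts UNIV 2 T ?N"
        proof (rule newton_polygon_distinct_denominators_case[OF \<phi> xy nz(3,4)])
          fix a f g assume "a \<noteq> 0" "f \<in> {P 0, P 2}" "g \<in> {P 1, P 3}" "poly f a = 0"
          then show "poly g a \<noteq> 0"
            using roots[of 0 1 a] roots[of 0 3 a] roots[of 2 1 a] roots[of 2 3 a] nz by auto
        qed
        then show ?thesis using cut_axis_polygonI by blast
      qed
    qed
  qed
qed

end
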